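(* Fix $1 \leq p<\infty$ and let $f\in\mathscr{H}^\infty$. Then \[\|f\|_{\mathscr{H}^p}^p = |f(+\infty)|^p + p^2 \int_{\mathbb{T}^\infty} \int_0^\infty |f_\chi(\sigma)|^{p-2} |f_\chi'(\sigma)|^2 \,\sigma\, d\sigma\, dm_\infty(\chi),\] and for $m_\infty$-almost every $\chi\in\mathbb{T}^\infty$, \[\|f\|_{\mathscr{H}^p}^p = |f(+\infty)|^p + \lim_{T\to\infty} \frac{p^2}{2T} \int_{-T}^T \int_0^\infty |f_\chi(\sigma+it)|^{p-2} |f_\chi'(\sigma+it)|^2 \,\sigma\, d\sigma\, dt.\]
   Context: $\mathbb{C}_\kappa=\{s:\mathrm{Re}\,s>\kappa\}$. $\mathscr{H}^\infty$ is the set of bounded analytic functions on $\mathbb{C}_0$ represented by a Dirichlet series $f(s)=\sum_{n\ge1}a_nn^{-s}$ converging in $\mathbb{C}_\kappa$ for some $\kappa>0$; $f(+\infty)=a_1$. For $1\le p<\infty$, $\|f\|_{\mathscr{H}^p}=\lim_{\sigma_0\to0^+}\big(\lim_{T\to\infty}\frac{1}{2T}\int_{-T}^T|f(\sigma_0+it)|^p\,dt\big)^{1/p}$ (all limits exist). A character is a completely multiplicative map $\chi:\mathbb{N}\to\mathbb{T}$, identified with a point of $\mathbb{T}^\infty$ via its values at the primes; $m_\infty$ is the normalized Haar measure on $\mathbb{T}^\infty$, and $f_\chi(s)=\sum_{n\ge1}a_n\chi(n)n^{-s}$, which belongs to $\mathscr{H}^\infty$. *)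

theory Defs
  imports "HOL-Complex_Analysis.Complex_Analysis" "HOL-Probability.Probability"
    "HOL-Computational_Algebra.Primes"
begin

definition dirichlet_partial :: "(nat \<Rightarrow> complex) \<Rightarrow> complex \<Rightarrow> nat \<Rightarrow> complex" where
  "dirichlet_partial a s N = (\<Sum>n\<in>{1..N}. a n / (of_nat n powr s))"

definition Hinf_rep :: "(nat \<Rightarrow> complex) \<Rightarrow> (complex \<Rightarrow> complex) \<Rightarrow> bool" where
  "Hinf_rep a f \<longleftrightarrow>
     f holomorphic_on {s. Re s > 0} \<and> bounded (f ` {s. Re s > 0}) \<and>
     (\<exists>\<kappa>>0. \<forall>s. Re s > \<kappa> \<longrightarrow> dirichlet_partial a s \<longlonglongrightarrow> f s)"

definition Hp_norm :: "real \<Rightarrow> (complex \<Rightarrow> complex) \<Rightarrow> real" where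
  "Hp_norm p f =
     (Lim (at_right 0) (\<lambda>\<sigma>0. Lim at_top (\<lambda>T.
        (1 / (2 * T)) * (\<integral>t\<in>{-T..T}. norm (f (Complex \<sigma>0 t)) powr p \<partial>lborel))))
     powr (1 / p)"

text \<open>Points of T^infinity are sequences z :: nat => complex; the coordinate z p at a
  prime p is the value of the character at p (coordinates at non-primes are dummies,
  which does not affect the Haar measure computations).\<close>
definition char_of :: "(nat \<Rightarrow> complex) \<Rightarrow> nat \<Rightarrow> complex" where
  "char_of z n = (\<Prod>p\<in>prime_factors n. z p ^ multiplicity p n)"

definition circle_measure :: "complex measure" where
  "circle_measure = distr (uniform_measure lborel {0..<1::real}) borel (\<lambda>\<theta>. cis (2 * pi * \<theta>))"

definition m_inf :: "(nat \<Rightarrow> complex) measure" where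
  "m_inf = Pi\<^sub>M UNIV (\<lambda>_. circle_measure)"

definition f_chi :: "(nat \<Rightarrow> complex) \<Rightarrow> (nat \<Rightarrow> complex) \<Rightarrow> complex \<Rightarrow> complex" where
  "f_chi a z = (THE g. Hinf_rep (\<lambda>n. a n * char_of z n) g \<and> (\<forall>s. Re s \<le> 0 \<longrightarrow> g s = 0))"

end

theory Submission
  imports Defs "HOL-Real_Asymp.Real_Asymp"
begin

text \<open>
  By Kronecker's theorem and Montel's theorem, each \<open>f_chi a z\<close> is a limit of vertical translates of \<open>f\<close>;
  vertical translation by \<open>t\<close> corresponds to the Kronecker flow \<open>rot t\<close> on the infinite torus.
  The Laplacian of \<open>|f| powr p\<close> is \<open>p\<^sup>2 |f| powr (p - 2) |f'|\<^sup>2\<close>. Integrating it against the weight \<open>\<sigma> - e\<close>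
  over the part \<open>-T \<le> t \<le> T\<close> of the half-plane \<open>\<sigma> \<ge> e\<close> expresses the truncated area integral as the
  mean of \<open>|f| powr p\<close> on the line \<open>\<sigma> = e\<close> minus \<open>|a 1| powr p\<close>, up to an error \<open>O(1/T)\<close> after division
  by \<open>2 T\<close>. Since the flow is uniquely ergodic, for \<open>e > 0\<close> this mean converges for every character to the
  same limit. Invariance of the Haar measure and monotone convergence as \<open>e\<close> decreases to \<open>0\<close> give the first
  formula. For the second one, the contribution of the weight \<open>min \<sigma> e\<close> has small integral over the
  torus, so the maximal ergodic inequality controls its averages uniformly in \<open>T\<close> off a small set.
\<close>

section \<open>Characters and the Kronecker flow\<close>

text \<open>The Dirichlet series need not converge near the imaginary axis, so for
  \<open>Re s\<close> up to \<open>\<kappa>\<close> nothing can be read off it; every statement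
  there is reached by compactness from the half-plane of absolute convergence. The same compactness
  makes \<open>f_chi a z\<close> depend continuously on \<open>z\<close> at each point with positive
  real part, and unique ergodicity rests on this continuity. It is lost on the imaginary axis, which
  is why the second formula is restricted to almost every character. There the limit is already
  known for each \<open>e > 0\<close>: the lower bound follows because the weight
  \<open>\<sigma> - e\<close> lies below \<open>\<sigma>\<close>, and only the upper bound calls on
  the maximal inequality. For \<open>p < 2\<close> the factor \<open>|f| powr (p - 2)\<close> is
  singular at the zeros of \<open>f\<close>, so Green's formula is applied to a smooth
  regularisation, which is removed afterwards. Area integrals live in \<open>ennreal\<close>; their
  finiteness is a consequence of Green's formula.\<close>

definition torus :: "(nat \<Rightarrow> complex) set" where
  "torus = {z. \<forall>n. norm (z n) = 1}"

text \<open>With this sign, rotation by \<open>t\<close> becomes the translation of \<open>s\<close>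
  by \<open>\<i> * t\<close> in \<open>F_rot\<close>. The dummy coordinates at non-primes are
  rotated by the same formula; the factor has modulus one everywhere, and invariance of
  \<open>m_inf\<close> depends on nothing else.\<close>

definition rot :: "real \<Rightarrow> (nat \<Rightarrow> complex) \<Rightarrow> nat \<Rightarrow> complex" where
  "rot t z = (\<lambda>n. z n * cis (- t * ln (real n)))"

lemma rot_torus [simp]: "rot t z \<in> torus \<longleftrightarrow> z \<in> torus"
  by (simp add: torus_def rot_def norm_mult)

lemma rot_add: "rot s (rot t z) = rot (s + t) z"
  by (simp add: rot_def cis_mult fun_eq_iff algebra_simps)

lemma rot_0 [simp]: "rot 0 z = z"
  by (simp add: rot_def)

lemma norm_torus: "z \<in> torus \<Longrightarrow> norm (z n) = 1"
  by (simp add: torus_def)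

lemma char_of_1 [simp]: "char_of z (Suc 0) = 1"
  by (simp add: char_of_def)

lemma one_torus [simp]: "(\<lambda>_. 1) \<in> torus"
  by (simp add: torus_def)

lemma char_of_one [simp]: "char_of (\<lambda>_. 1) n = 1"
  by (simp add: char_of_def)

text \<open>Lets the characters of two integers be written over a common set of primes, so that
  factors can be compared one by one.\<close>

lemma char_of_superset:
  assumes "n > 0" "finite A" "prime_factors n \<subseteq> A" "\<And>p. p \<in> A \<Longrightarrow> prime p"
  shows "char_of z n = (\<Prod>p\<in>A. z p ^ multiplicity p n)"
  unfolding char_of_def
proof (rule prod.mono_neutral_left)
  show "\<forall>p\<in>A - prime_factors n. z p ^ multiplicity p n = 1"
    using assms by (auto simp: in_prime_factors_iff not_dvd_imp_multiplicity_0)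
qed (use assms in auto)

lemma char_of_mult:
  assumes "m > 0" "n > 0"
  shows "char_of z (m * n) = char_of z m * char_of z n"
proof -
  let ?A = "prime_factors m \<union> prime_factors n"
  have pf: "prime_factors (m * n) = ?A"
    using assms by (intro prime_factors_product) auto
  have "char_of z (m * n) = (\<Prod>p\<in>?A. z p ^ multiplicity p (m * n))"
    by (simp add: char_of_def pf)
  also have "\<dots> = (\<Prod>p\<in>?A. z p ^ multiplicity p m * z p ^ multiplicity p n)"
    using assms
    by (intro prod.cong refl, subst prime_elem_multiplicity_mult_distrib)
      (auto simp: power_add in_prime_factors_iff)
  also have "\<dots> = char_of z m * char_of z n"
    unfolding prod.distrib using assms
    by (subst (1 2) char_of_superset[where A = ?A]) (auto simp: in_prime_factors_iff)
  finally show ?thesis .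
qed

lemma char_of_prime: "prime p \<Longrightarrow> char_of z p = z p"
  by (simp add: char_of_def prime_factorization_prime)

lemma norm_char_of: "z \<in> torus \<Longrightarrow> norm (char_of z n) = 1"
  by (simp add: char_of_def torus_def prod_norm[symmetric] norm_power)

lemma cis_ln_prod:
  assumes "finite A" "\<And>p. p \<in> A \<Longrightarrow> g p > 0"
  shows "(\<Prod>p\<in>A. cis (t * ln (real (g p)))) = cis (t * ln (real (\<Prod>p\<in>A. g p)))"
  using assms
proof (induction A rule: finite_induct)
  case (insert x F)
  have "(\<Prod>p\<in>F. g p) > 0" using insert by (intro prod_pos) auto
  with insert show ?case
    by (simp add: ln_mult algebra_simps cis_mult)
qed auto

text \<open>Multiplying the rotation factors over the prime factorisation reassembles
  \<open>n\<close>, because the imaginary power of \<open>n\<close> is itself completely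
  multiplicative.\<close>

lemma char_of_rot:
  assumes "n > 0"
  shows "char_of (rot t z) n = char_of z n * cis (- t * ln (real n))"
proof -
  have "char_of (rot t z) n = char_of z n *
      (\<Prod>p\<in>prime_factors n. cis (- t * ln (real (p ^ multiplicity p n))))"
    unfolding char_of_def prod.distrib[symmetric]
  proof (intro prod.cong refl)
    fix p assume "p \<in> prime_factors n"
    then have "p > 0" by (auto simp: in_prime_factors_iff prime_gt_0_nat)
    then show "rot t z p ^ multiplicity p n = z p ^ multiplicity p n *
        cis (- t * ln (real (p ^ multiplicity p n)))"
      by (simp add: rot_def power_mult_distrib Complex.DeMoivre ln_realpow algebra_simps)
  qed
  also have "(\<Prod>p\<in>prime_factors n. cis (- t * ln (real (p ^ multiplicity p n))))
      = cis (- t * ln (real (\<Prod>p\<in>prime_factors n. p ^ multiplicity p n)))"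
    by (rule cis_ln_prod) (auto simp: in_prime_factors_iff prime_gt_0_nat)
  also have "(\<Prod>p\<in>prime_factors n. p ^ multiplicity p n) = n"
    using assms by (simp add: prime_factorization_nat[symmetric])
  finally show ?thesis .
qed

lemma continuous_char_of [continuous_intros]: "continuous_on A (\<lambda>z. char_of z n)"
  unfolding char_of_def
  by (intro continuous_intros continuous_on_product_then_coordinatewise)

lemma tendsto_char_of:
  assumes "\<And>p. prime p \<Longrightarrow> (\<lambda>k. z k p) \<longlonglongrightarrow> w p"
  shows "(\<lambda>k. char_of (z k) n) \<longlonglongrightarrow> char_of w n"
  unfolding char_of_def
  by (intro tendsto_prod tendsto_power assms) (auto simp: in_prime_factors_iff)

lemma char_of_cong_prime: "(\<And>p. prime p \<Longrightarrow> z p = w p) \<Longrightarrow> char_of z = char_of w"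
  unfolding char_of_def by (intro ext prod.cong) (auto simp: in_prime_factors_iff)

lemma powr_nat_shift:
  assumes "n > 0"
  shows "1 / (of_nat n powr (s + \<i> * of_real t)) =
    cis (- t * ln (real n)) * (1 / (of_nat n powr s :: complex))"
proof -
  have "of_nat n powr (s + \<i> * of_real t) = of_nat n powr s * (of_nat n powr (\<i> * of_real t) :: complex)"
    by (rule powr_add)
  also have "of_nat n powr (\<i> * of_real t) = cis (t * ln (real n))"
    using assms by (simp add: powr_def cis_conv_exp Ln_of_nat mult_ac)
  finally show ?thesis
    using assms by (simp add: field_simps cis_mult)
qed

section \<open>Analytic continuation and normal families in the right half-plane\<close>

lemma open_RHP: "open {s. Re s > c}" and connected_RHP: "connected {s. Re s > c}"
  by (auto simp: open_halfspace_Re_gt convex_halfspace_Re_gt intro: convex_connected)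

lemma RHP_identity:
  assumes "g holomorphic_on {s. Re s > 0}" "h holomorphic_on {s. Re s > 0}"
    and "\<And>s. Re s > \<kappa> \<Longrightarrow> g s = h s" and "Re s > 0"
  shows "g s = h s"
proof -
  have "g s - h s = 0"
  \<comment> \<open>As \<open>\<kappa>\<close> may be negative, \<open>max \<kappa> 0\<close> keeps
    the set of known agreement inside the right half-plane.\<close>
  proof (rule analytic_continuation_open[of "{s. Re s > max \<kappa> 0}" "{s. Re s > 0}" "\<lambda>s. g s - h s" "\<lambda>_. 0"])
    have "complex_of_real (max \<kappa> 0 + 1) \<in> {s. Re s > max \<kappa> 0}" by (simp add: max_def)
    then show "{s. Re s > max \<kappa> 0} \<noteq> {}" by blast
    show "(\<lambda>s. g s - h s) holomorphic_on {s. Re s > 0}"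
      using assms by (intro holomorphic_intros)
    show "open {s. Re s > max \<kappa> 0}" "open {s. Re s > 0}" "connected {s. Re s > 0}"
      by (rule open_RHP connected_RHP)+
  qed (use assms in auto)
  then show ?thesis by simp
qed

text \<open>Vitali's theorem: by Montel every subsequence has a locally uniformly convergent further
  subsequence, and the identity theorem forces all these limits to agree, since they are prescribed
  for \<open>Re s > \<kappa>\<close>. The conclusion with moving points \<open>s n\<close> is
  locally uniform convergence in sequential form; it yields joint continuity in the character and
  the point.\<close>

lemma vitali_RHP:
  fixes h :: "nat \<Rightarrow> complex \<Rightarrow> complex"
  assumes hol: "\<And>n. h n holomorphic_on {s. Re s > 0}"
    and bd: "\<And>n s. Re s > 0 \<Longrightarrow> norm (h n s) \<le> B"
    and lim: "\<And>s. Re s > \<kappa> \<Longrightarrow> (\<lambda>n. h n s) \<longlonglongrightarrow> l s"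
  obtains g where "g holomorphic_on {s. Re s > 0}" "\<And>s. Re s > 0 \<Longrightarrow> norm (g s) \<le> B"
    "\<And>s. Re s > \<kappa> \<Longrightarrow> Re s > 0 \<Longrightarrow> g s = l s"
    "\<And>s t. Re t > 0 \<Longrightarrow> s \<longlonglongrightarrow> t \<Longrightarrow> (\<lambda>n. h n (s n)) \<longlonglongrightarrow> g t"
proof -
  let ?S = "{s. Re s > 0}"
  \<comment> \<open>The reindexing \<open>q\<close> is arbitrary because the selection is made
    twice: once to produce \<open>g\<close>, once along a subsequence on which convergence is
    supposed to fail.\<close>
  have sub: "\<exists>g r. g holomorphic_on ?S \<and> strict_mono (r :: nat \<Rightarrow> nat) \<and>
      (\<forall>x\<in>?S. (\<lambda>n. h (q (r n)) x) \<longlonglongrightarrow> g x) \<and>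
      (\<forall>K. compact K \<and> K \<subseteq> ?S \<longrightarrow> uniform_limit K (\<lambda>n. h (q (r n))) g sequentially)"
    for q :: "nat \<Rightarrow> nat"
  proof -
    obtain g r where "g holomorphic_on ?S" "strict_mono (r :: nat \<Rightarrow> nat)"
      "\<And>x. x \<in> ?S \<Longrightarrow> ((\<lambda>n. (\<lambda>n. h (q n)) (r n) x) \<longlongrightarrow> g x) sequentially"
      "\<And>K. \<lbrakk>compact K; K \<subseteq> ?S\<rbrakk> \<Longrightarrow> uniform_limit K ((\<lambda>n. h (q n)) \<circ> r) g sequentially"
    proof (rule Montel[where \<H> = "range (\<lambda>n. h (q n))" and \<F> = "\<lambda>n. h (q n)" and S = ?S])
      show "open ?S" by (rule open_RHP)
      show "\<exists>B. \<forall>h\<in>range (\<lambda>n. h (q n)). \<forall>z\<in>K. norm (h z) \<le> B" if "K \<subseteq> ?S" for K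
        using bd that by blast
    qed (use hol in auto)
    then show ?thesis unfolding o_def by blast
  qed
  obtain g r where g: "g holomorphic_on ?S" "strict_mono (r :: nat \<Rightarrow> nat)"
      "\<And>x. x\<in>?S \<Longrightarrow> (\<lambda>n. h (r n) x) \<longlonglongrightarrow> g x"
    using sub[of id] by auto
  have gl: "g s = l s" if "Re s > \<kappa>" "Re s > 0" for s
    using LIMSEQ_unique[OF g(3)[of s] LIMSEQ_subseq_LIMSEQ[OF lim[OF that(1)] g(2), unfolded o_def]] that
    by auto
  have main: "(\<lambda>n. h n (s n)) \<longlonglongrightarrow> g t" if t: "Re t > 0" "s \<longlonglongrightarrow> t" for s t
  proof (rule ccontr)
    assume "\<not> (\<lambda>n. h n (s n)) \<longlonglongrightarrow> g t"
    then obtain e where e: "e > 0" "\<And>N. \<exists>n\<ge>N. dist (h n (s n)) (g t) \<ge> e"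
      unfolding lim_sequentially by (metis not_le)
    have inf: "infinite {n. dist (h n (s n)) (g t) \<ge> e}"
      unfolding infinite_nat_iff_unbounded_le using e(2) by auto
    then obtain q where q: "strict_mono (q :: nat \<Rightarrow> nat)" "\<And>n. dist (h (q n) (s (q n))) (g t) \<ge> e"
      using infinite_enumerate[OF inf] by auto
    obtain g' r' where g': "g' holomorphic_on ?S" "strict_mono (r' :: nat \<Rightarrow> nat)"
      "\<And>x. x\<in>?S \<Longrightarrow> (\<lambda>n. h (q (r' n)) x) \<longlonglongrightarrow> g' x"
      "\<And>K. compact K \<Longrightarrow> K \<subseteq> ?S \<Longrightarrow> uniform_limit K (\<lambda>n. h (q (r' n))) g' sequentially"
      using sub[of q] by auto
    have qr: "strict_mono (\<lambda>n. q (r' n))"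
      using q(1) g'(2) by (auto simp: strict_mono_def)
    have "g' x = l x" if "Re x > \<kappa>" "Re x > 0" for x
      using LIMSEQ_unique[OF g'(3)[of x] LIMSEQ_subseq_LIMSEQ[OF lim[OF that(1)] qr, unfolded o_def]] that
      by auto
    then have gg': "g' t = g t"
      using RHP_identity[of g' g "max \<kappa> 0" t] g g' gl t by auto
    let ?K = "cball t (Re t / 2)"
    have KS: "?K \<subseteq> ?S"
    proof
      fix x assume x: "x \<in> ?K"
      have "Re t - Re x \<le> norm (t - x)" using complex_Re_le_cmod[of "t - x"] by simp
      then show "x \<in> ?S" using x t by (auto simp: dist_norm)
    qed
    have st: "(\<lambda>n. s (q (r' n))) \<longlonglongrightarrow> t"
      using LIMSEQ_subseq_LIMSEQ[OF t(2) qr] by (simp add: o_def)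
    have evK: "eventually (\<lambda>n. s (q (r' n)) \<in> ?K) sequentially"
      using tendstoD[OF st, of "Re t / 2"] t
      by (auto elim!: eventually_mono simp: dist_commute)
    \<comment> \<open>Uniform convergence on the closed ball handles the change of function,
      continuity of \<open>g'\<close> the moving point.\<close>
    have "(\<lambda>n. h (q (r' n)) (s (q (r' n)))) \<longlonglongrightarrow> g' t"
    proof -
      have ct: "isCont g' t"
        using g'(1) t by (intro continuous_on_interior[OF holomorphic_on_imp_continuous_on])
          (auto simp: interior_open open_RHP)
      have c1: "(\<lambda>n. g' (s (q (r' n)))) \<longlonglongrightarrow> g' t"
        using isCont_tendsto_compose[OF ct st] .
      have c2: "(\<lambda>n. h (q (r' n)) (s (q (r' n))) - g' (s (q (r' n)))) \<longlonglongrightarrow> 0"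
      proof (rule tendstoI)
        fix e :: real assume "e > 0"
        then have "eventually (\<lambda>n. \<forall>x\<in>?K. dist (h (q (r' n)) x) (g' x) < e) sequentially"
          using uniform_limitD[OF g'(4)[OF _ KS]] by simp
        with evK show "eventually (\<lambda>n. dist (h (q (r' n)) (s (q (r' n))) - g' (s (q (r' n)))) 0 < e) sequentially"
          by eventually_elim (auto simp: dist_norm)
      qed
      from tendsto_add[OF c2 c1] show ?thesis by simp
    qed
    then have "eventually (\<lambda>n. dist (h (q (r' n)) (s (q (r' n)))) (g' t) < e) sequentially"
      using e(1) by (rule tendstoD)
    then show False
      using q(2) gg' by (auto simp: eventually_sequentially not_less[symmetric])
  qed
  show ?thesis
  proof (rule that[OF g(1) _ gl main])
    show "norm (g s) \<le> B" if "Re s > 0" for s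
      using g(3)[of s] bd[of s] that by (intro LIMSEQ_le_const2[OF tendsto_norm]) auto
  qed auto
qed

section \<open>Twisted Dirichlet series\<close>

text \<open>Unique factorisation: separating positive from negative exponents turns the relation
  into an equality of two products of prime powers, and comparing multiplicities at \<open>q\<close>
  gives \<open>nat (u q) = nat (- u q)\<close>.\<close>

lemma log_primes_independent:
  fixes u :: "nat \<Rightarrow> int"
  assumes "finite P" "\<And>p. p \<in> P \<Longrightarrow> prime p" "(\<Sum>p\<in>P. of_int (u p) * ln (real p)) = 0" "q \<in> P"
  shows "u q = 0"
proof -
  define A where "A = (\<Prod>p\<in>P. p ^ nat (u p))"
  define A' where "A' = (\<Prod>p\<in>P. p ^ nat (- u p))"
  have pos: "p > 0" if "p \<in> P" for p using assms(2)[OF that] by (rule prime_gt_0_nat)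
  have lnprod: "ln (real (\<Prod>p\<in>P. p ^ v p)) = (\<Sum>p\<in>P. real (v p) * ln (real p))" for v
  proof -
    have "ln (\<Prod>p\<in>P. real (p ^ v p)) = (\<Sum>p\<in>P. ln (real (p ^ v p)))"
      using assms(1) pos by (intro ln_prod) auto
    then show ?thesis using pos by (simp add: ln_realpow)
  qed
  have "ln (real A) - ln (real A') = (\<Sum>p\<in>P. of_int (u p) * ln (real p))"
    unfolding A_def A'_def lnprod sum_subtractf[symmetric]
  proof (intro sum.cong refl)
    fix p
    have "real (nat (u p)) - real (nat (- u p)) = of_int (u p)" by (cases "u p \<ge> 0") auto
    then show "real (nat (u p)) * ln (real p) - real (nat (- u p)) * ln (real p) = of_int (u p) * ln (real p)"
      by (metis left_diff_distrib)
  qed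
  moreover have "A > 0" "A' > 0" using pos by (auto simp: A_def A'_def prod_pos)
  ultimately have "A = A'" using assms(3) by simp
  then have "multiplicity q A = multiplicity q A'" by simp
  then have "nat (u q) = nat (- u q)"
    unfolding A_def A'_def using assms by (simp add: multiplicity_prod_prime_powers)
  then show ?thesis by linarith
qed

text \<open>Kronecker's theorem approximates modulo 1, so angles are measured in full turns, hence
  the divisions by \<open>2 * pi\<close>. Only prime coordinates can be prescribed: along the orbit
  those at composite numbers are determined by them.\<close>

lemma torus_orbit_dense_finite:
  assumes z: "z \<in> torus" and "e > 0"
  obtains t where "\<And>p. prime p \<Longrightarrow> p \<le> N \<Longrightarrow> norm (rot t (\<lambda>_. 1) p - z p) < e"
proof -
  define P where "P = {p::nat. prime p \<and> p \<le> N}"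
  have finP: "finite P" unfolding P_def by (rule finite_subset[of _ "{..N}"]) auto
  define n where "n = card P"
  obtain q where q: "bij_betw q {..<n} P"
    using ex_bij_betw_nat_finite[OF finP] unfolding n_def lessThan_atLeast0 by blast
  define \<theta> where "\<theta> i = ln (real (q i)) / (2 * pi)" for i
  define \<alpha> where "\<alpha> i = Arg (z (q i)) / (2 * pi)" for i
  have qP: "prime (q i)" if "i < n" for i
    using q that unfolding P_def bij_betw_def by auto
  have inj: "inj_on \<theta> {..<n}"
  proof
    fix i j assume ij: "i \<in> {..<n}" "j \<in> {..<n}" "\<theta> i = \<theta> j"
    then have "q i = q j"
      using qP[of i] qP[of j] by (auto simp: \<theta>_def prime_gt_0_nat)
    then show "i = j" using q ij by (auto simp: bij_betw_def inj_on_def)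
  qed
  interpret Modules.module "(\<lambda>r. (*) (real_of_int r))"
    by (simp add: Modules.module.intro distrib_left mult.commute)
  have indep: "independent (\<theta> ` {..<n})"
  proof -
    have "\<forall>v\<in>\<theta> ` {..<n}. u v = 0" if "(\<Sum>v\<in>\<theta> ` {..<n}. of_int (u v) * v) = 0" for u
    proof -
      have "0 = 2 * pi * (\<Sum>v\<in>\<theta> ` {..<n}. of_int (u v) * v)" using that by simp
      also have "\<dots> = (\<Sum>i<n. of_int (u (\<theta> i)) * ln (real (q i)))"
        by (subst sum.reindex[OF inj]) (simp add: sum_distrib_left \<theta>_def)
      also have "\<dots> = (\<Sum>p\<in>P. of_int (u (ln (real p) / (2 * pi))) * ln (real p))"
        by (subst sum.reindex_bij_betw[OF q, symmetric]) (simp add: \<theta>_def)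
      finally have "u (ln (real p) / (2 * pi)) = 0" if "p \<in> P" for p
        using log_primes_independent[OF finP, of "\<lambda>p. u (ln (real p) / (2 * pi))" p] that
        by (auto simp: P_def)
      moreover have "q i \<in> P" if "i < n" for i using q that by (auto simp: bij_betw_def)
      ultimately show ?thesis by (auto simp: \<theta>_def)
    qed
    then show ?thesis by (simp add: dependent_finite) blast
  qed
  have "isCont cis 0" unfolding cis_conv_exp[abs_def] by (intro continuous_intros)
  then obtain d where d: "d > 0" "\<And>x. \<bar>x\<bar> < d \<Longrightarrow> norm (cis x - 1) < e"
    using \<open>e > 0\<close> unfolding continuous_at_eps_delta dist_norm by auto
  obtain t h where th: "\<And>i. i < n \<Longrightarrow> \<bar>t * \<theta> i - of_int (h i) - \<alpha> i\<bar> < d / (2 * pi)"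
    using Kronecker_thm_1[OF indep inj, of "d / (2 * pi)" \<alpha>] d(1) by auto
  \<comment> \<open>\<open>rot\<close> turns by \<open>- t * ln p\<close>, so the time found by
    Kronecker's theorem enters with the opposite sign.\<close>
  show ?thesis
  proof (rule that[of "-t"])
    fix p assume "prime p" "p \<le> N"
    then have "p \<in> q ` {..<n}" using bij_betw_imp_surj_on[OF q] by (simp add: P_def)
    then obtain i where i: "i < n" "q i = p"
      by auto
    define x where "x = 2 * pi * (t * \<theta> i - of_int (h i) - \<alpha> i)"
    have "\<bar>x\<bar> = 2 * pi * \<bar>t * \<theta> i - of_int (h i) - \<alpha> i\<bar>"
      unfolding x_def abs_mult by simp
    then have "\<bar>x\<bar> < d" using th[OF i(1)] by (simp add: less_divide_eq mult.commute)
    have zp: "z p = cis (Arg (z p))"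
      using rcis_cmod_Arg[of "z p"] norm_torus[OF z, of p] by (simp add: rcis_def)
    have "t * ln (real p) = x + 2 * pi * of_int (h i) + Arg (z p)"
      using i by (simp add: x_def \<theta>_def \<alpha>_def field_simps)
    then have "rot (- t) (\<lambda>_. 1) p = cis (x + 2 * pi * of_int (h i) + Arg (z p))"
      by (simp add: rot_def)
    also have "\<dots> = cis x * cis (2 * pi * of_int (h i)) * cis (Arg (z p))"
      by (simp only: cis_mult)
    also have "cis (2 * pi * of_int (h i)) = 1" by (simp add: cis_multiple_2pi)
    finally have "rot (- t) (\<lambda>_. 1) p - z p = (cis x - 1) * z p"
      using zp by (simp add: algebra_simps)
    then show "norm (rot (- t) (\<lambda>_. 1) p - z p) < e"
      using d(2)[OF \<open>\<bar>x\<bar> < d\<close>] norm_torus[OF z, of p] by (simp add: norm_mult)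
  qed
qed

text \<open>One sequence of times serves all primes: the \<open>k\<close>-th time handles the primes
  up to \<open>k\<close> with error \<open>1 / Suc k\<close>.\<close>

lemma torus_orbit_dense:
  assumes z: "z \<in> torus"
  obtains t where "\<And>p. prime p \<Longrightarrow> (\<lambda>k::nat. rot (t k) (\<lambda>_. 1) p) \<longlonglongrightarrow> z p"
proof -
  have "\<exists>t. \<forall>p. prime p \<longrightarrow> p \<le> k \<longrightarrow> norm (rot t (\<lambda>_. 1) p - z p) < 1 / Suc k" for k
    using torus_orbit_dense_finite[OF z, of "1 / Suc k" k] by (metis of_nat_0_less_iff zero_less_Suc zero_less_divide_1_iff)
  then obtain t where t: "\<And>k p. prime p \<Longrightarrow> p \<le> k \<Longrightarrow> norm (rot (t k) (\<lambda>_. 1) p - z p) < 1 / Suc k"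
    by metis
  have "(\<lambda>k. rot (t k) (\<lambda>_. 1) p) \<longlonglongrightarrow> z p" if "prime p" for p
  proof (rule LIM_zero_cancel, rule Lim_null_comparison)
    show "eventually (\<lambda>k. norm (rot (t k) (\<lambda>_. 1) p - z p) \<le> 1 / Suc k) sequentially"
      using t[OF that] by (auto simp: eventually_sequentially intro!: exI[of _ p] less_imp_le)
    show "(\<lambda>k. 1 / real (Suc k)) \<longlonglongrightarrow> 0"
      using LIMSEQ_inverse_real_of_nat by (simp add: inverse_eq_divide)
  qed
  then show ?thesis by (rule that)
qed

section \<open>Twists as limits of vertical translates\<close>

text \<open>Here \<open>\<kappa>\<close> is an abscissa of absolute convergence, to the right of the
  one supplied by \<open>Hinf_rep\<close>. The bound \<open>B\<close> will pass to all twists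
  unchanged.\<close>

locale hinf =
  fixes a :: "nat \<Rightarrow> complex" and f :: "complex \<Rightarrow> complex" and B \<kappa> :: real
  assumes hol: "f holomorphic_on {s. Re s > 0}"
    and bound: "\<And>s. Re s > 0 \<Longrightarrow> norm (f s) \<le> B"
    and \<kappa>_pos: "\<kappa> > 0"
    and abs_conv: "summable (\<lambda>n. norm (a n) / real n powr \<kappa>)"
    and conv: "\<And>s. Re s > \<kappa> \<Longrightarrow> dirichlet_partial a s \<longlonglongrightarrow> f s"

lemma norm_of_nat_powr: "norm (of_nat n powr (s::complex)) = real n powr Re s"
  by (subst norm_powr_real_powr) auto

text \<open>The terms of a series convergent at \<open>\<kappa> + 1\<close> are bounded, so
  \<open>a n\<close> is \<open>O(n powr (\<kappa> + 1))\<close>; dividing by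
  \<open>n powr (\<kappa> + 3)\<close> leaves the summable \<open>n powr (- 2)\<close>.\<close>

lemma Hinf_rep_hinf:
  assumes "Hinf_rep a f"
  obtains B \<kappa> where "hinf a f B \<kappa>"
proof -
  from assms obtain \<kappa> where hol: "f holomorphic_on {s. Re s > 0}" and bd: "bounded (f ` {s. Re s > 0})"
    and \<kappa>: "\<kappa> > 0" "\<And>s. Re s > \<kappa> \<Longrightarrow> dirichlet_partial a s \<longlonglongrightarrow> f s"
    unfolding Hinf_rep_def by blast
  from bd obtain B where B: "\<And>s. Re s > 0 \<Longrightarrow> norm (f s) \<le> B"
    unfolding bounded_iff by blast
  define s where "s = complex_of_real (\<kappa> + 1)"
  have lim: "dirichlet_partial a s \<longlonglongrightarrow> f s" by (rule \<kappa>) (simp add: s_def)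
  have "(\<lambda>n. dirichlet_partial a s (Suc n) - dirichlet_partial a s n) \<longlonglongrightarrow> 0"
    using tendsto_diff[OF LIMSEQ_Suc[OF lim] lim] by simp
  then have "(\<lambda>n. a (Suc n) / of_nat (Suc n) powr s) \<longlonglongrightarrow> 0"
    by (simp add: dirichlet_partial_def)
  then have "Bseq (\<lambda>n. a (Suc n) / of_nat (Suc n) powr s)"
    by (rule convergent_imp_Bseq[OF convergentI])
  then obtain K where K: "K > 0" "\<And>n. norm (a (Suc n) / of_nat (Suc n) powr s) \<le> K"
    unfolding Bseq_def by auto
  have le: "norm (a n) \<le> K * real n powr (\<kappa> + 1)" if "n > 0" for n
    using K(2)[of "n - 1"] that by (simp add: norm_divide norm_of_nat_powr s_def field_simps del: of_nat_Suc)
  have "summable (\<lambda>n. norm (a n) / real n powr (\<kappa> + 3))"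
  proof (rule summable_comparison_test_ev)
    show "eventually (\<lambda>n. norm (norm (a n) / real n powr (\<kappa> + 3)) \<le> K * real n powr (- 2)) sequentially"
    proof (intro eventually_sequentiallyI[of 1])
      fix n :: nat assume "n \<ge> 1"
      then have "norm (a n) / real n powr (\<kappa> + 3) \<le> K * real n powr (\<kappa> + 1) / real n powr (\<kappa> + 3)"
        using le[of n] by (intro divide_right_mono) auto
      also have "\<dots> = K * real n powr (- 2)"
        using powr_diff[of "real n" "\<kappa> + 1" "\<kappa> + 3"] by (simp add: field_simps)
      finally show "norm (norm (a n) / real n powr (\<kappa> + 3)) \<le> K * real n powr (- 2)" by simp
    qed
    show "summable (\<lambda>n. K * real n powr (- 2))"
      by (intro summable_mult) (simp add: summable_real_powr_iff)
  qed
  then have "hinf a f B (\<kappa> + 3)"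
    using hol B \<kappa> by unfold_locales auto
  then show ?thesis by (rule that)
qed

context hinf
begin

text \<open>The term at \<open>n = 0\<close> vanishes, because \<open>0 powr s = 0\<close> and
  division by zero gives zero; this reconciles the sum with \<open>dirichlet_partial\<close>, which
  starts at \<open>1\<close>.\<close>

definition series :: "(nat \<Rightarrow> complex) \<Rightarrow> complex \<Rightarrow> complex" where
  "series z s = (\<Sum>n. a n * char_of z n / of_nat n powr s)"

lemma norm_twist_le:
  assumes "z \<in> torus" "Re s \<ge> \<kappa>"
  shows "norm (a n * char_of z n / of_nat n powr s) \<le> norm (a n) / real n powr \<kappa>"
proof (cases "n = 0")
  case False
  then have "real n powr \<kappa> \<le> real n powr Re s" using assms by (intro powr_mono) auto
  then show ?thesis using assms False
    by (simp add: norm_mult norm_divide norm_char_of norm_of_nat_powr divide_left_mono)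
qed auto

lemma summable_twist:
  assumes "z \<in> torus" "Re s \<ge> \<kappa>"
  shows "summable (\<lambda>n. a n * char_of z n / of_nat n powr s)"
  by (rule summable_comparison_test'[OF abs_conv]) (use norm_twist_le[OF assms] in auto)

lemma dirichlet_partial_twist:
  assumes "z \<in> torus" "Re s \<ge> \<kappa>"
  shows "dirichlet_partial (\<lambda>n. a n * char_of z n) s \<longlonglongrightarrow> series z s"
proof -
  have "(\<lambda>N. \<Sum>n\<le>N. a n * char_of z n / of_nat n powr s) \<longlonglongrightarrow> series z s"
    unfolding series_def using summable_LIMSEQ'[OF summable_twist[OF assms]] by simp
  moreover have "(\<Sum>n\<le>N. a n * char_of z n / of_nat n powr s) = dirichlet_partial (\<lambda>n. a n * char_of z n) s N" for N
    unfolding dirichlet_partial_def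
    by (rule sum.mono_neutral_right) auto
  ultimately show ?thesis by simp
qed

lemma f_series: "Re s > \<kappa> \<Longrightarrow> f s = series (\<lambda>_. 1) s"
  using LIMSEQ_unique[OF conv[of s], of "series (\<lambda>_. 1) s"] dirichlet_partial_twist[of "\<lambda>_. 1" s] by simp

lemma series_rot: "Re s \<ge> \<kappa> \<Longrightarrow> series (rot t z) s = series z (s + \<i> * of_real t)"
  unfolding series_def
proof (rule suminf_cong)
  fix n show "a n * char_of (rot t z) n / of_nat n powr s = a n * char_of z n / of_nat n powr (s + \<i> * of_real t)"
  proof (cases "n = 0")
    case False
    have "a n * char_of (rot t z) n / of_nat n powr s =
      a n * char_of z n * (cis (- t * ln (real n)) * (1 / of_nat n powr s))"
      using False by (simp add: char_of_rot)
    also have "\<dots> = a n * char_of z n / of_nat n powr (s + \<i> * of_real t)"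
      using False by (subst powr_nat_shift[symmetric]) auto
    finally show ?thesis .
  qed auto
qed

text \<open>Dominated convergence for series: the majorant at abscissa \<open>\<kappa>\<close> is
  the same for all characters.\<close>

lemma series_tendsto:
  assumes "\<And>k. z k \<in> torus" "\<And>p. prime p \<Longrightarrow> (\<lambda>k. z k p) \<longlonglongrightarrow> w p" "Re s \<ge> \<kappa>"
  shows "(\<lambda>k. series (z k) s) \<longlonglongrightarrow> series w s"
  unfolding series_def
proof (rule tannerys_theorem[THEN conjunct2, THEN conjunct2])
  show "(\<lambda>k. a n * char_of (z k) n / of_nat n powr s) \<longlonglongrightarrow> a n * char_of w n / of_nat n powr s" for n
    unfolding divide_inverse by (intro tendsto_mult tendsto_const tendsto_char_of assms)
  show "\<forall>\<^sub>F (n, k) in at_top \<times>\<^sub>F sequentially. norm (a n * char_of (z k) n / of_nat n powr s) \<le> norm (a n) / real n powr \<kappa>"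
    using norm_twist_le[OF assms(1,3)] by (intro always_eventually) auto
qed (use abs_conv in auto)

text \<open>Translates of \<open>f\<close> along times whose orbit of the trivial character tends to
  \<open>z\<close> at all primes are bounded by \<open>B\<close> and converge to the twisted series
  for \<open>Re s > \<kappa>\<close>; \<open>vitali_RHP\<close> carries the limit to the whole right
  half-plane.\<close>

lemma exists_twist:
  assumes z: "z \<in> torus"
  obtains g where "Hinf_rep (\<lambda>n. a n * char_of z n) g" "\<And>s. Re s > 0 \<Longrightarrow> norm (g s) \<le> B"
    "\<And>s. Re s > \<kappa> \<Longrightarrow> g s = series z s" "\<And>s. Re s \<le> 0 \<Longrightarrow> g s = 0"
proof -
  obtain t where t: "\<And>p. prime p \<Longrightarrow> (\<lambda>k::nat. rot (t k) (\<lambda>_. 1) p) \<longlonglongrightarrow> z p"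
    using torus_orbit_dense[OF z] by blast
  obtain g where g: "g holomorphic_on {s. Re s > 0}" "\<And>s. Re s > 0 \<Longrightarrow> norm (g s) \<le> B"
    "\<And>s. Re s > \<kappa> \<Longrightarrow> Re s > 0 \<Longrightarrow> g s = series z s"
  proof (rule vitali_RHP[of "\<lambda>k s. f (s + \<i> * of_real (t k))" B \<kappa> "series z"])
    show "(\<lambda>s. f (s + \<i> * of_real (t n))) holomorphic_on {s. Re s > 0}" for n
      by (rule holomorphic_on_compose_gen[OF _ hol, unfolded o_def]) (auto intro!: holomorphic_intros)
    show "(\<lambda>n. f (s + \<i> * of_real (t n))) \<longlonglongrightarrow> series z s" if "Re s > \<kappa>" for s
    proof -
      have "f (s + \<i> * of_real (t n)) = series (rot (t n) (\<lambda>_. 1)) s" for n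
        using that by (subst series_rot) (auto simp: f_series)
      then show ?thesis
        using that by (simp add: series_tendsto[OF _ t])
    qed
  qed (use bound in auto)
  \<comment> \<open>Vanishing for \<open>Re s \<le> 0\<close> is the normalisation by which
    \<open>f_chi\<close> selects a unique function.\<close>
  define g' where "g' s = (if Re s > 0 then g s else 0)" for s
  show ?thesis
  proof (rule that[of g'])
    have "g' holomorphic_on {s. Re s > 0}"
      using g(1) by (rule holomorphic_transform) (auto simp: g'_def)
    moreover have "bounded (g' ` {s. Re s > 0})"
      using g(2) by (auto simp: bounded_iff g'_def)
    moreover have "dirichlet_partial (\<lambda>n. a n * char_of z n) s \<longlonglongrightarrow> g' s" if "Re s > \<kappa>" for s
      using dirichlet_partial_twist[OF z, of s] that g(3)[of s] \<kappa>_pos by (simp add: g'_def)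
    ultimately show "Hinf_rep (\<lambda>n. a n * char_of z n) g'"
      unfolding Hinf_rep_def using \<kappa>_pos by blast
  qed (use g \<kappa>_pos in \<open>auto simp: g'_def\<close>)
qed

abbreviation "F \<equiv> f_chi a"

text \<open>Two candidates agree far to the right as limits of the same partial sums, hence on the
  right half-plane by the identity theorem, and both are \<open>0\<close> elsewhere.\<close>

lemma F_eqI:
  assumes "Hinf_rep (\<lambda>n. a n * char_of z n) g" "\<And>s. Re s \<le> 0 \<Longrightarrow> g s = 0"
  shows "F z = g"
  unfolding f_chi_def
proof (rule the_equality)
  fix h assume h: "Hinf_rep (\<lambda>n. a n * char_of z n) h \<and> (\<forall>s. Re s \<le> 0 \<longrightarrow> h s = 0)"
  obtain k1 k2 where k: "\<And>s. Re s > k1 \<Longrightarrow> dirichlet_partial (\<lambda>n. a n * char_of z n) s \<longlonglongrightarrow> g s"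
    "\<And>s. Re s > k2 \<Longrightarrow> dirichlet_partial (\<lambda>n. a n * char_of z n) s \<longlonglongrightarrow> h s"
    using assms h unfolding Hinf_rep_def by blast
  show "h = g"
  proof
    fix s
    show "h s = g s"
    proof (cases "Re s > 0")
      case True
      then show ?thesis
      proof (rule RHP_identity[of h g "max k1 k2", rotated 3])
        show "h s = g s" if "Re s > max k1 k2" for s
          using that by (intro LIMSEQ_unique[OF k(2) k(1)]) auto
      qed (use assms h in \<open>auto simp: Hinf_rep_def\<close>)
    qed (use assms h in auto)
  qed
qed (use assms in auto)

lemma F_props:
  assumes z: "z \<in> torus"
  shows F_hol: "F z holomorphic_on {s. Re s > 0}"
    and F_bound: "Re s > 0 \<Longrightarrow> norm (F z s) \<le> B"
    and F_series: "Re s > \<kappa> \<Longrightarrow> F z s = series z s"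
    and F_left: "Re s \<le> 0 \<Longrightarrow> F z s = 0"
proof -
  obtain g where g: "Hinf_rep (\<lambda>n. a n * char_of z n) g" "\<And>s. Re s > 0 \<Longrightarrow> norm (g s) \<le> B"
    "\<And>s. Re s > \<kappa> \<Longrightarrow> g s = series z s" "\<And>s. Re s \<le> 0 \<Longrightarrow> g s = 0"
    using exists_twist[OF z] by blast
  have "F z = g" using g(1,4) by (rule F_eqI)
  then show "F z holomorphic_on {s. Re s > 0}" "Re s > 0 \<Longrightarrow> norm (F z s) \<le> B"
    "Re s > \<kappa> \<Longrightarrow> F z s = series z s" "Re s \<le> 0 \<Longrightarrow> F z s = 0"
    using g by (auto simp: Hinf_rep_def)
qed

text \<open>The identity is termwise for \<open>Re s > \<kappa>\<close> and continues
  analytically.\<close>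

lemma F_rot:
  assumes z: "z \<in> torus" and s: "Re s > 0"
  shows "F (rot t z) s = F z (s + \<i> * of_real t)"
proof (rule RHP_identity[of "F (rot t z)" "\<lambda>s. F z (s + \<i> * of_real t)" \<kappa> s])
  show "(\<lambda>s. F z (s + \<i> * of_real t)) holomorphic_on {s. Re s > 0}"
    by (rule holomorphic_on_compose_gen[OF _ F_hol[OF z], unfolded o_def]) (auto intro!: holomorphic_intros)
  show "F (rot t z) s = F z (s + \<i> * of_real t)" if "Re s > \<kappa>" for s
    using that z by (simp add: F_series series_rot)
qed (use z s F_hol in auto)

lemma F_one: "Re s > 0 \<Longrightarrow> F (\<lambda>_. 1) s = f s"
  by (rule RHP_identity[OF F_hol[OF one_torus] hol, of \<kappa>]) (simp_all add: F_series f_series)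

text \<open>Joint sequential continuity up to, but excluding, the imaginary axis. It supplies both
  the continuous observable for the ergodic argument and the measurability of
  \<open>F_ext\<close>.\<close>

lemma F_tendsto:
  assumes z: "\<And>k. z k \<in> torus" and w: "w \<in> torus"
    and zw: "\<And>p. prime p \<Longrightarrow> (\<lambda>k. z k p) \<longlonglongrightarrow> w p" and s: "s \<longlonglongrightarrow> t" "Re t > 0"
  shows "(\<lambda>k. F (z k) (s k)) \<longlonglongrightarrow> F w t"
proof -
  obtain g where g: "g holomorphic_on {s. Re s > 0}"
    "\<And>s. Re s > \<kappa> \<Longrightarrow> Re s > 0 \<Longrightarrow> g s = series w s"
    "\<And>s t. Re t > 0 \<Longrightarrow> s \<longlonglongrightarrow> t \<Longrightarrow> (\<lambda>n. F (z n) (s n)) \<longlonglongrightarrow> g t"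
  proof (rule vitali_RHP[of "\<lambda>k. F (z k)" B \<kappa> "series w"])
    show "(\<lambda>n. F (z n) s) \<longlonglongrightarrow> series w s" if "Re s > \<kappa>" for s
      using that z by (simp add: F_series series_tendsto[OF _ zw])
  qed (use z F_hol F_bound in auto)
  have "g t = F w t"
    by (rule RHP_identity[of g "F w" \<kappa>]) (use g w s \<kappa>_pos F_hol F_series in auto)
  then show ?thesis using g(3)[OF s(2,1)] by simp
qed

text \<open>The rate comes from \<open>ln 2\<close> being the least frequency of \<open>F z - a 1\<close>.\<close>

lemma F_decay:
  obtains C where "C > 0" "\<And>z s. z \<in> torus \<Longrightarrow> Re s > 0 \<Longrightarrow> norm (F z s - a 1) \<le> C * 2 powr (- Re s)"
proof -
  define A where "A = (\<Sum>n. norm (a n) / real n powr \<kappa>)"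
  \<comment> \<open>The second and third entries serve \<open>Re s > \<kappa>\<close> and
    \<open>Re s \<le> \<kappa>\<close> respectively; the entry \<open>1\<close> makes
    \<open>C\<close> positive.\<close>
  define C where "C = max 1 (max (A * 2 powr \<kappa>) ((B + norm (a 1)) * 2 powr \<kappa>))"
  have "norm (F z s - a 1) \<le> C * 2 powr (- Re s)" if z: "z \<in> torus" and s: "Re s > 0" for z s
  proof (cases "Re s > \<kappa>")
    case True
    define b where "b n = a n * char_of z n / of_nat n powr s" for n
    have sb: "b sums F z s"
      unfolding b_def using True z summable_sums[OF summable_twist[of z s]] by (simp add: F_series series_def)
    \<comment> \<open>With the vanishing term at \<open>0\<close> and the constant term at
      \<open>1\<close> removed, the series starts at frequency \<open>ln 2\<close>.\<close>
    have b01: "b 0 = 0" "b 1 = a 1" by (auto simp: b_def)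
    have sums2: "(\<lambda>n. b (n + 2)) sums (F z s - a 1)"
      using sums_split_initial_segment[OF sb, of 2] b01 by (simp add: numeral_2_eq_2)
    have le: "norm (b (n + 2)) \<le> 2 powr (\<kappa> - Re s) * (norm (a (n + 2)) / real (n + 2) powr \<kappa>)" for n
    proof -
      have "real (n + 2) powr (\<kappa> - Re s) \<le> 2 powr (\<kappa> - Re s)"
        using True by (intro powr_mono2') auto
      then have "real (n + 2) powr (- Re s) \<le> 2 powr (\<kappa> - Re s) / real (n + 2) powr \<kappa>"
        by (simp add: powr_diff powr_minus field_simps)
      then have "norm (a (n + 2)) * real (n + 2) powr (- Re s) \<le> norm (a (n + 2)) * (2 powr (\<kappa> - Re s) / real (n + 2) powr \<kappa>)"
        by (rule mult_left_mono) simp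
      moreover have "norm (b (n + 2)) = norm (a (n + 2)) * real (n + 2) powr (- Re s)"
        unfolding b_def norm_mult norm_divide norm_char_of[OF z] norm_of_nat_powr
        by (simp add: powr_minus field_simps)
      ultimately show ?thesis by (simp add: mult_ac)
    qed
    have sa: "summable (\<lambda>n. norm (a (n + 2)) / real (n + 2) powr \<kappa>)"
      using summable_ignore_initial_segment[OF abs_conv, of 2] by simp
    have "norm (F z s - a 1) \<le> (\<Sum>n. 2 powr (\<kappa> - Re s) * (norm (a (n + 2)) / real (n + 2) powr \<kappa>))"
      unfolding sums_unique[OF sums2]
      by (rule norm_suminf_le[OF le summable_mult[OF sa]])
    also have "\<dots> = 2 powr (\<kappa> - Re s) * (\<Sum>n. norm (a (n + 2)) / real (n + 2) powr \<kappa>)"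
      by (rule suminf_mult[OF sa])
    also have "(\<Sum>n. norm (a (n + 2)) / real (n + 2) powr \<kappa>) \<le> A"
      unfolding A_def suminf_split_initial_segment[OF abs_conv, of 2]
      by (simp add: sum_nonneg)
    also have "2 powr (\<kappa> - Re s) * A = A * 2 powr \<kappa> * 2 powr (- Re s)"
      by (simp add: powr_diff powr_minus field_simps)
    also have "\<dots> \<le> C * 2 powr (- Re s)"
      by (intro mult_right_mono) (auto simp: C_def)
    finally show ?thesis by simp
  next
    case False
    \<comment> \<open>Left of \<open>\<kappa>\<close> the factor
      \<open>2 powr (\<kappa> - Re s)\<close> is at least 1, so boundedness alone suffices.\<close>
    have "0 \<le> B" using order_trans[OF norm_ge_zero F_bound[OF z s]] .
    have "norm (F z s - a 1) \<le> (B + norm (a 1)) * 1"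
      using norm_triangle_ineq4[of "F z s" "a 1"] F_bound[OF z s] by simp
    also have "\<dots> \<le> (B + norm (a 1)) * 2 powr (\<kappa> - Re s)"
      using False \<open>0 \<le> B\<close> by (intro mult_left_mono ge_one_powr_ge_zero) auto
    also have "\<dots> = (B + norm (a 1)) * 2 powr \<kappa> * 2 powr (- Re s)"
      by (simp add: powr_diff powr_minus field_simps)
    also have "\<dots> \<le> C * 2 powr (- Re s)"
      by (intro mult_right_mono) (auto simp: C_def)
    finally show ?thesis .
  qed
  then show ?thesis by (intro that[of C]) (auto simp: C_def)
qed

end

section \<open>Green's formula in a half-plane\<close>

text \<open>One computation along a curve serves both the horizontal and the vertical second
  derivative of the regularised power. Positivity of \<open>d\<close> keeps the base of
  \<open>powr\<close> away from 0.\<close>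

lemma powr_norm_curve_deriv:
  fixes \<gamma> \<beta> \<delta> :: "real \<Rightarrow> complex"
  assumes d1: "(\<gamma> has_vector_derivative \<beta> x) (at x)"
    and d2: "(\<beta> has_vector_derivative \<delta> x) (at x)" and "d > 0"
  shows "((\<lambda>x. ((norm (\<gamma> x))\<^sup>2 + d) powr (p / 2)) has_real_derivative
           p * ((norm (\<gamma> x))\<^sup>2 + d) powr (p / 2 - 1) * Re (cnj (\<gamma> x) * \<beta> x)) (at x)"
    and "((\<lambda>x. p * ((norm (\<gamma> x))\<^sup>2 + d) powr (p / 2 - 1) * Re (cnj (\<gamma> x) * \<beta> x)) has_real_derivative
           p * (p - 2) * ((norm (\<gamma> x))\<^sup>2 + d) powr (p / 2 - 2) * (Re (cnj (\<gamma> x) * \<beta> x))\<^sup>2 +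
           p * ((norm (\<gamma> x))\<^sup>2 + d) powr (p / 2 - 1) * ((norm (\<beta> x))\<^sup>2 + Re (cnj (\<gamma> x) * \<delta> x))) (at x)"
proof -
  have R: "((\<lambda>x. Re (\<gamma> x)) has_real_derivative Re (\<beta> x)) (at x)"
    "((\<lambda>x. Im (\<gamma> x)) has_real_derivative Im (\<beta> x)) (at x)"
    "((\<lambda>x. Re (\<beta> x)) has_real_derivative Re (\<delta> x)) (at x)"
    "((\<lambda>x. Im (\<beta> x)) has_real_derivative Im (\<delta> x)) (at x)"
    using bounded_linear.has_vector_derivative[OF bounded_linear_Re d1]
      bounded_linear.has_vector_derivative[OF bounded_linear_Im d1]
      bounded_linear.has_vector_derivative[OF bounded_linear_Re d2]
      bounded_linear.has_vector_derivative[OF bounded_linear_Im d2]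
    by (simp_all add: has_real_derivative_iff_has_vector_derivative)
  have w: "((\<lambda>x. (norm (\<gamma> x))\<^sup>2 + d) has_real_derivative 2 * Re (cnj (\<gamma> x) * \<beta> x)) (at x)"
    unfolding cmod_power2
    by (rule DERIV_cong[OF DERIV_add[OF DERIV_add[OF DERIV_power[OF R(1), of 2] DERIV_power[OF R(2), of 2]] DERIV_const[of d]]])
      (simp add: algebra_simps)
  have pos: "(norm (\<gamma> x))\<^sup>2 + d > 0" using \<open>d > 0\<close> by (simp add: add_nonneg_pos)
  have P: "((\<lambda>x. ((norm (\<gamma> x))\<^sup>2 + d) powr r) has_real_derivative
      r * ((norm (\<gamma> x))\<^sup>2 + d) powr (r - 1) * (2 * Re (cnj (\<gamma> x) * \<beta> x))) (at x)" for r
    by (rule DERIV_chain2[OF has_real_derivative_powr[OF pos] w])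
  show "((\<lambda>x. ((norm (\<gamma> x))\<^sup>2 + d) powr (p / 2)) has_real_derivative
           p * ((norm (\<gamma> x))\<^sup>2 + d) powr (p / 2 - 1) * Re (cnj (\<gamma> x) * \<beta> x)) (at x)"
    by (rule DERIV_cong[OF P[of "p / 2"]]) simp
  have S: "((\<lambda>x. Re (cnj (\<gamma> x) * \<beta> x)) has_real_derivative (norm (\<beta> x))\<^sup>2 + Re (cnj (\<gamma> x) * \<delta> x)) (at x)"
  proof -
    have "((\<lambda>x. Re (\<gamma> x) * Re (\<beta> x) + Im (\<gamma> x) * Im (\<beta> x)) has_real_derivative
        (norm (\<beta> x))\<^sup>2 + Re (cnj (\<gamma> x) * \<delta> x)) (at x)"
      by (rule DERIV_cong[OF DERIV_add[OF DERIV_mult[OF R(1) R(3)] DERIV_mult[OF R(2) R(4)]]])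
        (simp add: cmod_power2, simp add: algebra_simps power2_eq_square)
    then show ?thesis by simp
  qed
  have e: "p / 2 - 1 - 1 = p / 2 - 2" by simp
  show "((\<lambda>x. p * ((norm (\<gamma> x))\<^sup>2 + d) powr (p / 2 - 1) * Re (cnj (\<gamma> x) * \<beta> x)) has_real_derivative
           p * (p - 2) * ((norm (\<gamma> x))\<^sup>2 + d) powr (p / 2 - 2) * (Re (cnj (\<gamma> x) * \<beta> x))\<^sup>2 +
           p * ((norm (\<gamma> x))\<^sup>2 + d) powr (p / 2 - 1) * ((norm (\<beta> x))\<^sup>2 + Re (cnj (\<gamma> x) * \<delta> x))) (at x)"
    by (rule DERIV_cong[OF DERIV_mult[OF DERIV_cmult[OF P[of "p / 2 - 1", unfolded e], of p] S]])
      (simp add: algebra_simps power2_eq_square)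
qed

text \<open>Controls the linear weight against the exponential decay of the gradient. The bound is
  free of \<open>k\<close>, so the right edge of the rectangle can be sent to infinity.\<close>

lemma x_2_powr_integral_le:
  fixes e k :: real
  assumes "0 \<le> e" "e \<le> k"
  shows "(\<lambda>x. x * 2 powr (- x)) integrable_on {e..k}"
    and "integral {e..k} (\<lambda>x. x * 2 powr (- x)) \<le> e / ln 2 + 1 / (ln 2)\<^sup>2"
proof -
  define A where "A x = - (x / ln 2 + 1 / (ln 2)\<^sup>2) * 2 powr (- x)" for x :: real
  have "((\<lambda>x. x * 2 powr (- x)) has_integral A k - A e) {e..k}"
  proof (rule fundamental_theorem_of_calculus)
    fix x assume "x \<in> {e..k}"
    have "(A has_real_derivative x * 2 powr (- x)) (at x)"
      unfolding A_def
      by (auto intro!: derivative_eq_intros simp: field_simps power2_eq_square)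
    then show "(A has_vector_derivative x * 2 powr (- x)) (at x within {e..k})"
      by (simp add: has_real_derivative_iff_has_vector_derivative has_vector_derivative_at_within)
  qed (use assms in auto)
  moreover have "A k \<le> 0"
    unfolding A_def neg_le_0_iff_le minus_mult_left[symmetric] using assms
    by (intro mult_nonneg_nonneg add_nonneg_nonneg) auto
  moreover have "- A e \<le> (e / ln 2 + 1 / (ln 2)\<^sup>2) * 1"
    unfolding A_def minus_mult_left minus_minus using assms
    by (intro mult_left_mono powr_le_one_le add_nonneg_nonneg) (auto simp: powr_minus field_simps ge_one_powr_ge_zero)
  ultimately show "(\<lambda>x. x * 2 powr (- x)) integrable_on {e..k}"
    "integral {e..k} (\<lambda>x. x * 2 powr (- x)) \<le> e / ln 2 + 1 / (ln 2)\<^sup>2"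
    by (auto simp: integral_unique integrable_on_def)
qed

text \<open>Models a single twist on the half-plane right of the line \<open>Re s = e\<close>, with
  \<open>c\<close> its value at infinity. \<open>B\<close> and \<open>C\<close> will be chosen
  independently of the character, which makes the final error uniform over the torus.\<close>

locale halfplane =
  fixes g :: "complex \<Rightarrow> complex" and c :: complex and B C e :: real
  assumes hol: "g holomorphic_on {s. Re s > 0}"
    and bound: "\<And>s. Re s > 0 \<Longrightarrow> norm (g s) \<le> B"
    and decay: "\<And>s. Re s > 0 \<Longrightarrow> norm (g s - c) \<le> C * 2 powr (- Re s)"
    and e: "e > 0"
begin

text \<open>Cauchy's estimate for \<open>g - c\<close> on circles of radius \<open>e / 2\<close>:
  the radius contributes \<open>2 / e\<close>, and the decay at the leftmost point of the circle
  costs \<open>2 powr (e / 2)\<close>.\<close>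

definition "D = 2 / e * C * 2 powr (e / 2)"

lemma C_nonneg: "C \<ge> 0"
  using order_trans[OF norm_ge_zero decay[of 1]] by (simp add: zero_le_mult_iff)

lemma D_nonneg: "D \<ge> 0"
  using C_nonneg e by (simp add: D_def)

lemma deriv_bound:
  assumes s: "Re s \<ge> e"
  shows "norm (deriv g s) \<le> D * 2 powr (- Re s)"
proof -
  have sub: "cball s (e / 2) \<subseteq> {s. Re s > 0}"
  proof
    fix x assume x: "x \<in> cball s (e / 2)"
    have "Re s - Re x \<le> norm (s - x)" using complex_Re_le_cmod[of "s - x"] by simp
    then show "x \<in> {s. Re s > 0}" using x s e by (auto simp: dist_norm)
  qed
  have "norm ((deriv ^^ 1) (\<lambda>s. g s - c) s) \<le> fact 1 * (C * 2 powr (e / 2) * 2 powr (- Re s)) / (e / 2) ^ 1"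
  proof (rule Cauchy_inequality)
    have h: "(\<lambda>s. g s - c) holomorphic_on cball s (e / 2)"
      by (intro holomorphic_intros holomorphic_on_subset[OF hol sub])
    then show "(\<lambda>s. g s - c) holomorphic_on ball s (e / 2)"
      by (rule holomorphic_on_subset) auto
    show "continuous_on (cball s (e / 2)) (\<lambda>s. g s - c)"
      using h by (rule holomorphic_on_imp_continuous_on)
    fix x assume x: "norm (s - x) = e / 2"
    then have x0: "Re x > 0" using sub by (auto simp: dist_norm)
    have "Re s - Re x \<le> e / 2" using complex_Re_le_cmod[of "s - x"] x by simp
    then have "2 powr (- Re x) \<le> 2 powr (e / 2 - Re s)" by (intro powr_mono) auto
    then have "C * 2 powr (- Re x) \<le> C * 2 powr (e / 2 - Re s)" using C_nonneg by (rule mult_left_mono)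
    then show "norm (g x - c) \<le> C * 2 powr (e / 2) * 2 powr (- Re s)"
      using decay[OF x0] powr_add[of 2 "e / 2" "- Re s"] by (simp add: mult.assoc)
  qed (use e in auto)
  moreover have "deriv (\<lambda>s. g s - c) s = deriv g s"
  proof -
    have "g field_differentiable at s"
      using holomorphic_on_imp_differentiable_at[OF hol open_RHP] s e by auto
    then show ?thesis by (simp add: deriv_diff)
  qed
  ultimately show ?thesis by (simp add: D_def field_simps)
qed

lemma hol1: "deriv g holomorphic_on {s. Re s > 0}"
  and hol2: "deriv (deriv g) holomorphic_on {s. Re s > 0}"
  using hol by (auto intro!: holomorphic_deriv open_RHP)

lemma has_field_deriv:
  assumes "Re s > 0"
  shows "(g has_field_derivative deriv g s) (at s)"
    "(deriv g has_field_derivative deriv (deriv g) s) (at s)"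
  using assms hol hol1 by (auto intro!: holomorphic_derivI[OF _ open_RHP])

lemma curve_x:
  assumes "x > 0"
  shows "((\<lambda>x. g (Complex x t)) has_vector_derivative deriv g (Complex x t)) (at x)"
    "((\<lambda>x. deriv g (Complex x t)) has_vector_derivative deriv (deriv g) (Complex x t)) (at x)"
proof -
  have l: "((\<lambda>x. Complex x t) has_vector_derivative 1) (at x)"
    unfolding Complex_eq by (auto intro!: derivative_eq_intros)
  show "((\<lambda>x. g (Complex x t)) has_vector_derivative deriv g (Complex x t)) (at x)"
    "((\<lambda>x. deriv g (Complex x t)) has_vector_derivative deriv (deriv g) (Complex x t)) (at x)"
    using field_vector_diff_chain_at[OF l has_field_deriv(1)[of "Complex x t"]]
      field_vector_diff_chain_at[OF l has_field_deriv(2)[of "Complex x t"]] assms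
    by (simp_all add: o_def)
qed

lemma curve_t:
  assumes "x > 0"
  shows "((\<lambda>t. g (Complex x t)) has_vector_derivative \<i> * deriv g (Complex x t)) (at t)"
    "((\<lambda>t. \<i> * deriv g (Complex x t)) has_vector_derivative - deriv (deriv g) (Complex x t)) (at t)"
proof -
  have l: "((\<lambda>t. Complex x t) has_vector_derivative \<i>) (at t)"
    unfolding Complex_eq by (auto intro!: derivative_eq_intros)
  show "((\<lambda>t. g (Complex x t)) has_vector_derivative \<i> * deriv g (Complex x t)) (at t)"
    using field_vector_diff_chain_at[OF l has_field_deriv(1)[of "Complex x t"]] assms
    by (simp add: o_def)
  have "((\<lambda>t. deriv g (Complex x t)) has_vector_derivative \<i> * deriv (deriv g) (Complex x t)) (at t)"
    using field_vector_diff_chain_at[OF l has_field_deriv(2)[of "Complex x t"]] assms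
    by (simp add: o_def)
  then have "((\<lambda>t. \<i> * deriv g (Complex x t)) has_vector_derivative \<i> * (\<i> * deriv (deriv g) (Complex x t))) (at t)"
    by (rule has_vector_derivative_mult_right)
  then show "((\<lambda>t. \<i> * deriv g (Complex x t)) has_vector_derivative - deriv (deriv g) (Complex x t)) (at t)"
    by simp
qed

lemma cont_plane:
  assumes "h holomorphic_on {s. Re s > 0}"
  shows "continuous_on {q. fst q > 0} (\<lambda>q. h (Complex (fst q) (snd q)))"
  unfolding Complex_eq
  by (rule continuous_on_compose2[OF holomorphic_on_imp_continuous_on[OF assms]])
    (auto intro!: continuous_intros)

text \<open>
  \<open>U\<close> regularises \<open>|g| powr p\<close>, which is not smooth at the zeros of \<open>g\<close>. In \<open>U1\<close> and \<open>U2\<close> the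
  direction of differentiation is \<open>\<omega> = 1\<close> along the real and \<open>\<omega> = \<i>\<close> along the imaginary axis.
\<close>

definition U :: "real \<Rightarrow> real \<Rightarrow> real \<Rightarrow> real \<Rightarrow> real" where
  "U p d x t = ((norm (g (Complex x t)))\<^sup>2 + d) powr (p / 2)"

definition U1 :: "real \<Rightarrow> real \<Rightarrow> complex \<Rightarrow> real \<Rightarrow> real \<Rightarrow> real" where
  "U1 p d \<omega> x t = p * ((norm (g (Complex x t)))\<^sup>2 + d) powr (p / 2 - 1) *
     Re (cnj (g (Complex x t)) * (\<omega> * deriv g (Complex x t)))"

definition U2 :: "real \<Rightarrow> real \<Rightarrow> complex \<Rightarrow> real \<Rightarrow> real \<Rightarrow> real" where
  "U2 p d \<omega> x t =
     p * (p - 2) * ((norm (g (Complex x t)))\<^sup>2 + d) powr (p / 2 - 2) *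
       (Re (cnj (g (Complex x t)) * (\<omega> * deriv g (Complex x t))))\<^sup>2 +
     p * ((norm (g (Complex x t)))\<^sup>2 + d) powr (p / 2 - 1) *
       ((norm (\<omega> * deriv g (Complex x t)))\<^sup>2 + Re (cnj (g (Complex x t)) * (\<omega>\<^sup>2 * deriv (deriv g) (Complex x t))))"

text \<open>The Laplacian of \<open>U p d\<close>. Setting \<open>d = 0\<close> where
  \<open>g\<close> is nonzero gives \<open>p\<^sup>2\<close> times \<open>|g| powr (p - 2)\<close>
  times the square of \<open>|g'|\<close>.\<close>

definition Lap :: "real \<Rightarrow> real \<Rightarrow> real \<Rightarrow> real \<Rightarrow> real" where
  "Lap p d x t = p * ((norm (g (Complex x t)))\<^sup>2 + d) powr (p / 2 - 2) *
     (norm (deriv g (Complex x t)))\<^sup>2 * (p * (norm (g (Complex x t)))\<^sup>2 + 2 * d)"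

lemma U_deriv:
  assumes "x > 0" "d > 0"
  shows "((\<lambda>x. U p d x t) has_real_derivative U1 p d 1 x t) (at x)"
    "((\<lambda>x. U1 p d 1 x t) has_real_derivative U2 p d 1 x t) (at x)"
    "((\<lambda>t. U p d x t) has_real_derivative U1 p d \<i> x t) (at t)"
    "((\<lambda>t. U1 p d \<i> x t) has_real_derivative U2 p d \<i> x t) (at t)"
  using powr_norm_curve_deriv[where \<gamma> = "\<lambda>x. g (Complex x t)" and \<beta> = "\<lambda>x. deriv g (Complex x t)"
      and \<delta> = "\<lambda>x. deriv (deriv g) (Complex x t)", OF curve_x[OF assms(1)] assms(2), of p]
    powr_norm_curve_deriv[where \<gamma> = "\<lambda>t. g (Complex x t)" and \<beta> = "\<lambda>t. \<i> * deriv g (Complex x t)"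
      and \<delta> = "\<lambda>t. - deriv (deriv g) (Complex x t)", OF curve_t[OF assms(1)] assms(2), of p]
  unfolding U_def U1_def U2_def by simp_all

lemma w_pos: "d > 0 \<Longrightarrow> (norm (z::complex))\<^sup>2 + d > 0"
  by (simp add: add_nonneg_pos)

text \<open>The second derivatives of \<open>g\<close> cancel because
  \<open>\<i>\<^sup>2 = - 1\<close>, and the squares of the two real parts add up to the square of
  \<open>|g| * |g'|\<close>.\<close>

lemma U2_sum:
  assumes "d > 0"
  shows "U2 p d 1 x t + U2 p d \<i> x t = Lap p d x t"
proof -
  define G G1 G2 where "G = g (Complex x t)" and "G1 = deriv g (Complex x t)" and "G2 = deriv (deriv g) (Complex x t)"
  define w where "w = (norm G)\<^sup>2 + d"
  have "w > 0" unfolding w_def by (rule w_pos[OF assms])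
  have w1: "w powr (p / 2 - 1) = w * w powr (p / 2 - 2)"
    using powr_add[of w 1 "p / 2 - 2"] \<open>w > 0\<close> by simp
  have sq: "(Re (cnj G * G1))\<^sup>2 + (Re (cnj G * (\<i> * G1)))\<^sup>2 = (norm G)\<^sup>2 * (norm G1)\<^sup>2"
    unfolding cmod_power2 by (simp add: power2_eq_square algebra_simps)
  have "U2 p d 1 x t + U2 p d \<i> x t =
      p * (p - 2) * w powr (p / 2 - 2) * ((Re (cnj G * G1))\<^sup>2 + (Re (cnj G * (\<i> * G1)))\<^sup>2) +
      2 * p * (w * w powr (p / 2 - 2)) * (norm G1)\<^sup>2"
    unfolding U2_def G_def[symmetric] G1_def[symmetric] G2_def[symmetric] w_def[symmetric] w1
    by (simp add: norm_mult algebra_simps)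
  also have "\<dots> = Lap p d x t"
    unfolding sq Lap_def G_def[symmetric] G1_def[symmetric] w_def[symmetric]
    by (simp add: algebra_simps w_def)
  finally show ?thesis .
qed

lemma cont_U:
  assumes "d > 0"
  shows "continuous_on {q. fst q > 0} (\<lambda>q. U p d (fst q) (snd q))"
    "continuous_on {q. fst q > 0} (\<lambda>q. U1 p d \<omega> (fst q) (snd q))"
    "continuous_on {q. fst q > 0} (\<lambda>q. U2 p d \<omega> (fst q) (snd q))"
    "continuous_on {q. fst q > 0} (\<lambda>q. Lap p d (fst q) (snd q))"
  unfolding U_def U1_def U2_def Lap_def
  using w_pos[OF assms]
  by (auto intro!: continuous_intros cont_plane[OF hol] cont_plane[OF hol1] cont_plane[OF hol2] simp: less_imp_neq[symmetric])

lemma cont_slice: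
  assumes "continuous_on {q. fst q > (0::real)} (\<lambda>q. h (fst q) (snd q))"
  shows "x > 0 \<Longrightarrow> continuous_on A (\<lambda>t. h x t)"
    and "(\<And>x. x \<in> A \<Longrightarrow> x > 0) \<Longrightarrow> continuous_on A (\<lambda>x. h x t)"
proof -
  show "continuous_on A (\<lambda>t. h x t)" if "x > 0"
    using continuous_on_compose2[OF assms, of A "\<lambda>t. (x, t)"] that by (simp add: continuous_on_Pair image_subset_iff)
  show "continuous_on A (\<lambda>x. h x t)" if "\<And>x. x \<in> A \<Longrightarrow> x > 0"
    using continuous_on_compose2[OF assms, of A "\<lambda>x. (x, t)"] that by (simp add: continuous_on_Pair image_subset_iff)
qed

text \<open>Estimating \<open>|g|\<close> by the square root of \<open>w = |g|\<^sup>2 + d\<close>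
  leaves the exponent \<open>(p - 1) / 2\<close>, which is nonnegative for \<open>p \<ge> 1\<close>.
  The upper bound for \<open>w\<close> therefore applies, uniformly in \<open>d\<close>.\<close>

lemma U1_bound:
  assumes "0 < d" "d \<le> 1" "p \<ge> 1" "x \<ge> e" "norm \<omega> = 1"
  shows "\<bar>U1 p d \<omega> x t\<bar> \<le> p * (B\<^sup>2 + 1) powr ((p - 1) / 2) * D * 2 powr (- x)"
proof -
  define G G1 where "G = g (Complex x t)" and "G1 = deriv g (Complex x t)"
  define w where "w = (norm G)\<^sup>2 + d"
  have "w > 0" unfolding w_def by (rule w_pos[OF assms(1)])
  have "norm G \<le> B" unfolding G_def using assms e by (intro bound) auto
  then have wB: "w \<le> B\<^sup>2 + 1" unfolding w_def using assms by (intro add_mono power_mono) auto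
  have G1: "norm G1 \<le> D * 2 powr (- x)"
    unfolding G1_def using deriv_bound[of "Complex x t"] assms by simp
  have "norm G \<le> sqrt w" by (rule real_le_rsqrt) (use assms in \<open>simp add: w_def\<close>)
  then have Gw: "norm G \<le> w powr (1 / 2)" using \<open>w > 0\<close> by (simp add: powr_half_sqrt)
  have "\<bar>Re (cnj G * (\<omega> * G1))\<bar> \<le> norm (cnj G * (\<omega> * G1))" by (rule abs_Re_le_cmod)
  also have "\<dots> = norm G * norm G1" using assms by (simp add: norm_mult)
  finally have "\<bar>U1 p d \<omega> x t\<bar> \<le> p * w powr (p / 2 - 1) * (norm G * norm G1)"
    unfolding U1_def G_def[symmetric] G1_def[symmetric] w_def[symmetric] abs_mult
    using assms by (intro mult_mono) auto
  also have "\<dots> \<le> p * w powr (p / 2 - 1) * (w powr (1 / 2) * norm G1)"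
    using assms Gw by (intro mult_left_mono mult_right_mono) auto
  also have "\<dots> = p * w powr ((p - 1) / 2) * norm G1"
    using powr_add[of w "p / 2 - 1" "1 / 2"] by (simp add: diff_divide_distrib)
  also have "\<dots> \<le> p * (B\<^sup>2 + 1) powr ((p - 1) / 2) * (D * 2 powr (- x))"
    using assms wB \<open>w > 0\<close> G1 by (intro mult_mono powr_mono2) auto
  finally show ?thesis by (simp add: mult_ac)
qed

definition "Q p = p * (B\<^sup>2 + 1) powr ((p - 1) / 2) * D"

text \<open>Integration by parts: in \<open>x\<close> the antiderivative is
  \<open>(x - e) * U1 - U\<close>, and since the weight vanishes at \<open>x = e\<close> no normal
  derivative survives on the left edge; in \<open>t\<close> only the horizontal edges remain. The
  two error summands bound the normal derivative on the right edge and on the horizontal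
  edges.\<close>

lemma green_rectangle:
  assumes d: "0 < d" "d \<le> 1" and p: "p \<ge> 1" and k: "k \<ge> e" and T: "T \<ge> 0"
  defines "J \<equiv> integral (cbox (e, -T) (k, T)) (\<lambda>(x, t). (x - e) * Lap p d x t)"
  shows "\<bar>J - (integral {-T..T} (U p d e) - integral {-T..T} (U p d k))\<bar>
     \<le> 2 * T * k * (Q p * 2 powr (- k)) + 2 * Q p * (e / ln 2 + 1 / (ln 2)\<^sup>2)"
proof -
  note cU = cont_U[OF d(1), of p]
  have sub: "cbox (e, -T) (k, T) \<subseteq> {q. fst q > 0}" using e by auto
  have Q0: "Q p \<ge> 0" using p D_nonneg by (simp add: Q_def)
  have cX: "continuous_on (cbox (e, -T) (k, T)) (\<lambda>(x, t). (x - e) * U2 p d 1 x t)"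
    and cY: "continuous_on (cbox (e, -T) (k, T)) (\<lambda>(x, t). (x - e) * U2 p d \<i> x t)"
    unfolding case_prod_unfold
    by (intro continuous_intros continuous_on_subset[OF cU(3) sub])+
  have "J = integral (cbox (e, -T) (k, T)) (\<lambda>q. (\<lambda>(x, t). (x - e) * U2 p d 1 x t) q + (\<lambda>(x, t). (x - e) * U2 p d \<i> x t) q)"
    unfolding J_def U2_sum[OF d(1), symmetric]
    by (intro integral_cong) (auto simp: algebra_simps)
  also have "\<dots> = integral (cbox (e, -T) (k, T)) (\<lambda>(x, t). (x - e) * U2 p d 1 x t) +
      integral (cbox (e, -T) (k, T)) (\<lambda>(x, t). (x - e) * U2 p d \<i> x t)"
    by (intro integral_add integrable_continuous cX cY)
  also have "integral (cbox (e, -T) (k, T)) (\<lambda>(x, t). (x - e) * U2 p d 1 x t) =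
      integral {-T..T} (\<lambda>t. integral {e..k} (\<lambda>x. (x - e) * U2 p d 1 x t))"
    using integral_prod_continuous[OF cX] integral_swap_continuous[OF cX] by simp
  also have "\<dots> = integral {-T..T} (\<lambda>t. (k - e) * U1 p d 1 k t - U p d k t + U p d e t)"
  proof (intro integral_cong integral_unique)
    fix t
    have "((\<lambda>x. (x - e) * U2 p d 1 x t) has_integral
        ((k - e) * U1 p d 1 k t - U p d k t) - ((e - e) * U1 p d 1 e t - U p d e t)) {e..k}"
    proof (rule fundamental_theorem_of_calculus[where f = "\<lambda>x. (x - e) * U1 p d 1 x t - U p d x t"])
      fix x assume "x \<in> {e..k}"
      then have "x > 0" using e by auto
      note U = U_deriv(1,2)[OF this d(1), of p t]
      have "((\<lambda>x. (x - e) * U1 p d 1 x t - U p d x t) has_real_derivative (x - e) * U2 p d 1 x t) (at x)"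
        by (auto intro!: derivative_eq_intros U)
      then show "((\<lambda>x. (x - e) * U1 p d 1 x t - U p d x t) has_vector_derivative (x - e) * U2 p d 1 x t) (at x within {e..k})"
        by (simp add: has_real_derivative_iff_has_vector_derivative has_vector_derivative_at_within)
    qed (use k in auto)
    then show "((\<lambda>x. (x - e) * U2 p d 1 x t) has_integral (k - e) * U1 p d 1 k t - U p d k t + U p d e t) {e..k}"
      by simp
  qed
  also have "\<dots> = (k - e) * integral {-T..T} (U1 p d 1 k) - integral {-T..T} (U p d k) + integral {-T..T} (U p d e)"
  proof -
    have "continuous_on {-T..T} (U1 p d 1 k)" "continuous_on {-T..T} (U p d k)" "continuous_on {-T..T} (U p d e)"
      using k e by (auto intro!: cont_slice(1) cU)
    then have "((\<lambda>t. (k - e) * U1 p d 1 k t - U p d k t + U p d e t) has_integral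
        (k - e) * integral {-T..T} (U1 p d 1 k) - integral {-T..T} (U p d k) + integral {-T..T} (U p d e)) {-T..T}"
      by (intro has_integral_add has_integral_diff has_integral_mult_right integrable_integral integrable_continuous_interval)
    then show ?thesis by (rule integral_unique)
  qed
  also have "integral (cbox (e, -T) (k, T)) (\<lambda>(x, t). (x - e) * U2 p d \<i> x t) =
      integral {e..k} (\<lambda>x. integral {-T..T} (\<lambda>t. (x - e) * U2 p d \<i> x t))"
    using integral_prod_continuous[OF cY] by simp
  also have "\<dots> = integral {e..k} (\<lambda>x. (x - e) * (U1 p d \<i> x T - U1 p d \<i> x (-T)))"
  proof (intro integral_cong integral_unique)
    fix x assume "x \<in> {e..k}"
    then have x: "x > 0" using e by auto
    have "((\<lambda>t. U2 p d \<i> x t) has_integral U1 p d \<i> x T - U1 p d \<i> x (-T)) {-T..T}"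
    proof (rule fundamental_theorem_of_calculus)
      show "(U1 p d \<i> x has_vector_derivative U2 p d \<i> x t) (at t within {-T..T})" for t
        using U_deriv(4)[OF x d(1), of p t]
        by (simp add: has_real_derivative_iff_has_vector_derivative has_vector_derivative_at_within)
    qed (use T in auto)
    then show "((\<lambda>t. (x - e) * U2 p d \<i> x t) has_integral (x - e) * (U1 p d \<i> x T - U1 p d \<i> x (-T))) {-T..T}"
      by (rule has_integral_mult_right)
  qed
  finally have J: "J - (integral {-T..T} (U p d e) - integral {-T..T} (U p d k)) =
      (k - e) * integral {-T..T} (U1 p d 1 k) + integral {e..k} (\<lambda>x. (x - e) * (U1 p d \<i> x T - U1 p d \<i> x (-T)))"
    by simp
  have b1: "\<bar>integral {-T..T} (U1 p d 1 k)\<bar> \<le> Q p * 2 powr (- k) * (T - (-T))"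
  proof -
    have "norm (integral {-T..T} (U1 p d 1 k)) \<le> Q p * 2 powr (- k) * (T - (-T))"
    proof (rule integral_bound)
      show "continuous_on {-T..T} (U1 p d 1 k)"
        using k e by (intro cont_slice(1) cU) auto
      show "norm (U1 p d 1 k t) \<le> Q p * 2 powr (- k)" for t
        using U1_bound[OF d p k, of 1 t] by (simp add: Q_def)
    qed (use T in auto)
    then show ?thesis by simp
  qed
  have b2: "\<bar>integral {e..k} (\<lambda>x. (x - e) * (U1 p d \<i> x T - U1 p d \<i> x (-T)))\<bar> \<le>
      integral {e..k} (\<lambda>x. 2 * Q p * (x * 2 powr (- x)))"
  proof -
    have "norm (integral {e..k} (\<lambda>x. (x - e) * (U1 p d \<i> x T - U1 p d \<i> x (-T)))) \<le>
      integral {e..k} (\<lambda>x. 2 * Q p * (x * 2 powr (- x)))"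
    proof (rule integral_norm_bound_integral)
      show "(\<lambda>x. (x - e) * (U1 p d \<i> x T - U1 p d \<i> x (-T))) integrable_on {e..k}"
        using e by (intro integrable_continuous_interval continuous_intros cont_slice(2) cU) auto
      show "(\<lambda>x. 2 * Q p * (x * 2 powr (- x))) integrable_on {e..k}"
        using integrable_on_cmult_left[OF x_2_powr_integral_le(1)[of e k], of "2 * Q p"] e k by simp
      fix x assume x: "x \<in> {e..k}"
      have "\<bar>U1 p d \<i> x T - U1 p d \<i> x (-T)\<bar> \<le> 2 * (Q p * 2 powr (- x))"
        using U1_bound[OF d p, of x \<i> T] U1_bound[OF d p, of x \<i> "-T"] x by (simp add: Q_def)
      then have "\<bar>x - e\<bar> * \<bar>U1 p d \<i> x T - U1 p d \<i> x (-T)\<bar> \<le> x * (2 * (Q p * 2 powr (- x)))"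
        using x e by (intro mult_mono) auto
      then show "norm ((x - e) * (U1 p d \<i> x T - U1 p d \<i> x (-T))) \<le> 2 * Q p * (x * 2 powr (- x))"
        by (simp add: abs_mult mult_ac)
    qed
    then show ?thesis by simp
  qed
  also have "\<dots> \<le> 2 * Q p * (e / ln 2 + 1 / (ln 2)\<^sup>2)"
    using x_2_powr_integral_le[of e k] e k Q0 by (simp add: mult_left_mono)
  finally have b2': "\<bar>integral {e..k} (\<lambda>x. (x - e) * (U1 p d \<i> x T - U1 p d \<i> x (-T)))\<bar> \<le> 2 * Q p * (e / ln 2 + 1 / (ln 2)\<^sup>2)" .
  have "\<bar>(k - e) * integral {-T..T} (U1 p d 1 k)\<bar> \<le> k * (Q p * 2 powr (- k) * (T - (-T)))"
    unfolding abs_mult using b1 k e by (intro mult_mono) auto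
  then show ?thesis unfolding J using b2' by (simp add: mult_ac)
qed

end

section \<open>Removing the regularisation and the right edge\<close>

lemma square_powr:
  fixes x :: real
  assumes "x \<ge> 0"
  shows "(x\<^sup>2) powr r = x powr (2 * r)"
proof (cases "x = 0")
  case False
  then have "x\<^sup>2 = x powr 2" using assms by simp
  then show ?thesis by (simp only: powr_powr)
qed auto

text \<open>Enters the countability of the zeros of a nonconstant holomorphic function on this
  half-plane.\<close>

lemma fsigma_RHP: "fsigma {s::complex. Re s > 0}"
proof -
  have "{s::complex. Re s > 0} = (\<Union>n::nat. {s. Re s \<ge> 1 / real (Suc n)})"
  proof (intro set_eqI iffI)
    fix s :: complex assume "s \<in> {s. Re s > 0}"
    then obtain n where "1 / real (Suc n) < Re s"
      using nat_approx_posE by auto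
    then show "s \<in> (\<Union>n::nat. {s. Re s \<ge> 1 / real (Suc n)})"
      by (auto intro!: exI[of _ n] less_imp_le)
  next
    fix s :: complex assume "s \<in> (\<Union>n::nat. {s. Re s \<ge> 1 / real (Suc n)})"
    then obtain n where "1 / real (Suc n) \<le> Re s" by auto
    moreover have "0 < 1 / real (Suc n)" by simp
    ultimately have "0 < Re s" by linarith
    then show "s \<in> {s. Re s > 0}" by simp
  qed
  moreover have "closed {s::complex. Re s \<ge> 1 / real (Suc n)}" for n
    by (rule closed_halfspace_Re_ge)
  ultimately show ?thesis by (auto intro!: fsigma.intros)
qed

context halfplane
begin

text \<open>Zeros of a nonconstant \<open>g\<close> are countable, hence null, and a constant
  \<open>g\<close> has zero derivative. Simple zeros must be excluded: for \<open>p < 2\<close> the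
  regularised Laplacian blows up there as \<open>d\<close> tends to 0, whereas
  \<open>0 powr (p - 2)\<close> is \<open>0\<close> by convention.\<close>

lemma AE_nonzero: "AE q in lborel. fst q > 0 \<longrightarrow>
   g (Complex (fst q) (snd q)) \<noteq> 0 \<or> deriv g (Complex (fst q) (snd q)) = 0"
proof (cases "g constant_on {s. Re s > 0}")
  case True
  then obtain w where w: "\<And>s. Re s > 0 \<Longrightarrow> g s = w" by (auto simp: constant_on_def)
  have "deriv g s = 0" if "Re s > 0" for s
  proof -
    have "(g has_field_derivative 0) (at s)"
      by (rule has_field_derivative_transform_within_open[of "\<lambda>_. w" _ _ "{s. Re s > 0}"])
        (use that w in \<open>auto intro: open_RHP\<close>)
    then show ?thesis by (rule DERIV_imp_deriv)
  qed
  then show ?thesis by simp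
next
  case False
  let ?Z = "{s \<in> {s. Re s > 0}. g s = 0}"
  have "countable ?Z"
    by (rule holomorphic_countable_zeros[OF hol open_RHP connected_RHP fsigma_RHP False])
  then have "countable ((\<lambda>s. (Re s, Im s)) ` ?Z)" by (rule countable_image)
  then have "(\<lambda>s. (Re s, Im s)) ` ?Z \<in> null_sets lborel" by (rule countable_imp_null_set_lborel)
  then show ?thesis
  proof (rule AE_I')
    show "{q \<in> space lborel. \<not> (fst q > 0 \<longrightarrow> g (Complex (fst q) (snd q)) \<noteq> 0 \<or> deriv g (Complex (fst q) (snd q)) = 0)}
      \<subseteq> (\<lambda>s. (Re s, Im s)) ` ?Z"
    proof
      fix q assume "q \<in> {q \<in> space lborel. \<not> (fst q > 0 \<longrightarrow> g (Complex (fst q) (snd q)) \<noteq> 0 \<or> deriv g (Complex (fst q) (snd q)) = 0)}"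
      then show "q \<in> (\<lambda>s. (Re s, Im s)) ` ?Z"
        by (intro image_eqI[of _ _ "Complex (fst q) (snd q)"]) auto
    qed
  qed
qed

text \<open>Points are real pairs so that Fubini's theorem applies to planar Lebesgue measure. Where
  the weight \<open>fst q - e'\<close> is negative, \<open>ennreal\<close> sets the density to
  0.\<close>

definition dens :: "real \<Rightarrow> real \<Rightarrow> real \<Rightarrow> real \<times> real \<Rightarrow> ennreal" where
  "dens p e' T q = ennreal (norm (g (Complex (fst q) (snd q))) powr (p - 2) *
     norm (deriv g (Complex (fst q) (snd q))) ^ 2 * (fst q - e')) *
     indicator {0<..} (fst q) * indicator {-T..T} (snd q)"

lemma measurable_plane:
  fixes h :: "real \<times> real \<Rightarrow> real"
  assumes "continuous_on {q. fst q > 0} h"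
  shows "(\<lambda>q. indicator {0<..} (fst q) * h q) \<in> borel_measurable borel"
proof -
  have "open {q::real \<times> real. fst q > 0}" by (intro open_Collect_less continuous_intros)
  from borel_measurable_continuous_on_indicator[OF borel_open[OF this] assms]
  show ?thesis by (simp add: indicator_def mem_Collect_eq)
qed

lemma dens_measurable [measurable]: "dens p e' T \<in> borel_measurable borel"
proof -
  define G where "G q = indicator {0<..} (fst q) * norm (g (Complex (fst q) (snd q)))" for q
  define G1 where "G1 q = indicator {0<..} (fst q) * norm (deriv g (Complex (fst q) (snd q)))" for q
  have [measurable]: "G \<in> borel_measurable borel" "G1 \<in> borel_measurable borel"
    unfolding G_def G1_def
    by (intro measurable_plane continuous_intros cont_plane hol hol1)+
  have [measurable]: "fst \<in> borel_measurable (borel :: (real \<times> real) measure)"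
    "snd \<in> borel_measurable (borel :: (real \<times> real) measure)"
    by (intro borel_measurable_continuous_onI continuous_intros)+
  have "dens p e' T = (\<lambda>q. ennreal (G q powr (p - 2) * G1 q ^ 2 * (fst q - e')) *
     indicator {0<..} (fst q) * indicator {-T..T} (snd q))"
    by (auto simp: dens_def G_def G1_def fun_eq_iff split: split_indicator)
  also have "\<dots> \<in> borel_measurable borel" by measurable
  finally show ?thesis .
qed

lemma nn_integral_dens:
  "(\<integral>\<^sup>+ t\<in>{-T..T}. (\<integral>\<^sup>+ \<sigma>\<in>{0<..}. ennreal (norm (g (Complex \<sigma> t)) powr (p - 2) *
      norm (deriv g (Complex \<sigma> t)) ^ 2 * (\<sigma> - e')) \<partial>lborel) \<partial>lborel) = integral\<^sup>N lborel (dens p e' T)"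
proof -
  have m: "dens p e' T \<in> borel_measurable (lborel \<Otimes>\<^sub>M lborel)"
    by (simp add: lborel_prod)
  have "integral\<^sup>N lborel (dens p e' T) = (\<integral>\<^sup>+ t. (\<integral>\<^sup>+ \<sigma>. dens p e' T (\<sigma>, t) \<partial>lborel) \<partial>lborel)"
    using lborel_pair.nn_integral_snd[OF m] by (simp add: lborel_prod)
  also have "\<dots> = (\<integral>\<^sup>+ t\<in>{-T..T}. (\<integral>\<^sup>+ \<sigma>\<in>{0<..}. ennreal (norm (g (Complex \<sigma> t)) powr (p - 2) *
      norm (deriv g (Complex \<sigma> t)) ^ 2 * (\<sigma> - e')) \<partial>lborel) \<partial>lborel)"
    by (intro nn_integral_cong) (simp add: dens_def split: split_indicator)
  finally show ?thesis by simp
qed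

lemma Lap_nonneg: "p \<ge> 1 \<Longrightarrow> d > 0 \<Longrightarrow> Lap p d x t \<ge> 0"
  unfolding Lap_def by (intro mult_nonneg_nonneg add_nonneg_nonneg) auto

definition del :: "nat \<Rightarrow> real" where "del n = 1 / (real n + 1)"

lemma del: "del n > 0" "del n \<le> 1" "del \<longlonglongrightarrow> 0"
  unfolding del_def by (auto simp: field_simps) real_asymp

text \<open>The rectangle grows and the regularisation vanishes simultaneously as \<open>n\<close> tends to infinity.\<close>

definition Phi :: "real \<Rightarrow> real \<Rightarrow> nat \<Rightarrow> real \<times> real \<Rightarrow> real" where
  "Phi p T n q = indicator (cbox (e, -T) (e + real n, T)) q * ((fst q - e) * Lap p (del n) (fst q) (snd q))"

definition J :: "real \<Rightarrow> real \<Rightarrow> nat \<Rightarrow> real" where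
  "J p T n = integral (cbox (e, -T) (e + real n, T)) (\<lambda>(x, t). (x - e) * Lap p (del n) x t)"

lemma Phi_nonneg: "p \<ge> 1 \<Longrightarrow> Phi p T n q \<ge> 0"
  using Lap_nonneg[OF _ del(1)]
  by (cases q) (auto simp: Phi_def cbox_Pair_eq intro!: mult_nonneg_nonneg split: split_indicator)

lemma Phi_measurable [measurable]: "Phi p T n \<in> borel_measurable borel"
proof -
  have "Phi p T n = (\<lambda>q. indicator (cbox (e, -T) (e + real n, T)) q *\<^sub>R ((fst q - e) * Lap p (del n) (fst q) (snd q)))"
    by (simp add: Phi_def fun_eq_iff)
  also have "\<dots> \<in> borel_measurable borel"
    by (intro borel_measurable_continuous_on_indicator continuous_intros
        continuous_on_subset[OF cont_U(4)[OF del(1)]]) (use e in auto)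
  finally show ?thesis .
qed

lemma nn_integral_Phi:
  assumes "p \<ge> 1"
  shows "(\<integral>\<^sup>+ q. ennreal (Phi p T n q) \<partial>lborel) = ennreal (J p T n)" and "J p T n \<ge> 0"
proof -
  have "((\<lambda>(x, t). (x - e) * Lap p (del n) x t) has_integral J p T n) (cbox (e, -T) (e + real n, T))"
    unfolding J_def case_prod_unfold
    by (intro integrable_integral integrable_continuous continuous_intros
        continuous_on_subset[OF cont_U(4)[OF del(1)]]) (use e in auto)
  then have "((\<lambda>q. if q \<in> cbox (e, -T) (e + real n, T) then (\<lambda>(x, t). (x - e) * Lap p (del n) x t) q else 0)
      has_integral J p T n) UNIV"
    by (simp only: has_integral_restrict_UNIV)
  moreover have "(\<lambda>q. if q \<in> cbox (e, -T) (e + real n, T) then (\<lambda>(x, t). (x - e) * Lap p (del n) x t) q else 0) = Phi p T n"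
    by (auto simp: Phi_def fun_eq_iff)
  ultimately have h: "(Phi p T n has_integral J p T n) UNIV" by simp
  show "(\<integral>\<^sup>+ q. ennreal (Phi p T n q) \<partial>lborel) = ennreal (J p T n)"
    by (rule nn_integral_has_integral_lborel[OF Phi_measurable Phi_nonneg[OF assms] h])
  show "J p T n \<ge> 0"
    by (rule has_integral_nonneg[OF h]) (simp add: Phi_nonneg[OF assms])
qed

text \<open>Where \<open>deriv g\<close> vanishes both sides are 0; elsewhere \<open>g\<close> is
  nonzero, so \<open>d\<close> may be set to 0 by continuity, and every fixed point of the strip
  with \<open>fst q > e\<close> eventually lies in the growing rectangle.\<close>

lemma Phi_tendsto:
  assumes p: "p \<ge> 1"
    and nz: "fst q > 0 \<longrightarrow> g (Complex (fst q) (snd q)) \<noteq> 0 \<or> deriv g (Complex (fst q) (snd q)) = 0"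
  shows "(\<lambda>n. ennreal (Phi p T n q)) \<longlonglongrightarrow> ennreal (p\<^sup>2) * dens p e T q"
proof -
  obtain x t where q: "q = (x, t)" by (cases q)
  show ?thesis
  proof (cases "x > e \<and> t \<in> {-T..T}")
    case False
    have "dens p e T q = 0"
    proof (cases "x \<le> e")
      case True
      have "norm (g (Complex x t)) powr (p - 2) * (norm (deriv g (Complex x t)))\<^sup>2 * (x - e) \<le> 0"
        using True by (intro mult_nonneg_nonpos) auto
      then show ?thesis by (simp add: dens_def q ennreal_neg)
    qed (use False in \<open>auto simp: dens_def q split: split_indicator\<close>)
    moreover have "Phi p T n q = 0" for n
      using False by (auto simp: Phi_def q split: split_indicator)
    ultimately show ?thesis by simp
  next
    case True
    define G G1 where "G = g (Complex x t)" and "G1 = deriv g (Complex x t)"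
    have nz': "G \<noteq> 0 \<or> G1 = 0" using nz True e by (simp add: q G_def G1_def)
    have "(\<lambda>n. (x - e) * Lap p (del n) x t) \<longlonglongrightarrow> (x - e) * (p\<^sup>2 * (norm G powr (p - 2) * (norm G1)\<^sup>2))"
    proof (cases "G1 = 0")
      case True
      then show ?thesis by (simp add: Lap_def G1_def)
    next
      case False
      then have "G \<noteq> 0" using nz' by simp
      then have n0: "(norm G)\<^sup>2 + 0 \<noteq> 0" by simp
      have "(\<lambda>n. (x - e) * Lap p (del n) x t) \<longlonglongrightarrow>
        (x - e) * (p * ((norm G)\<^sup>2 + 0) powr (p / 2 - 2) * (norm G1)\<^sup>2 * (p * (norm G)\<^sup>2 + 2 * 0))"
        unfolding Lap_def G_def[symmetric] G1_def[symmetric]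
        by (intro tendsto_intros del) (use n0 in auto)
      also have "((norm G)\<^sup>2 + 0) powr (p / 2 - 2) = norm G powr (p - 4)"
        by (simp add: square_powr algebra_simps)
      also have "(x - e) * (p * norm G powr (p - 4) * (norm G1)\<^sup>2 * (p * (norm G)\<^sup>2 + 2 * 0)) =
          (x - e) * (p\<^sup>2 * ((norm G powr (p - 4) * (norm G)\<^sup>2) * (norm G1)\<^sup>2))"
        by (simp add: power2_eq_square algebra_simps)
      also have "norm G powr (p - 4) * (norm G)\<^sup>2 = norm G powr (p - 2)"
        using \<open>G \<noteq> 0\<close> powr_add[of "norm G" "p - 4" 2] by simp
      finally show ?thesis .
    qed
    then have "(\<lambda>n. ennreal ((x - e) * Lap p (del n) x t)) \<longlonglongrightarrow>
        ennreal ((x - e) * (p\<^sup>2 * (norm G powr (p - 2) * (norm G1)\<^sup>2)))"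
      by (rule tendsto_ennrealI)
    also have "ennreal ((x - e) * (p\<^sup>2 * (norm G powr (p - 2) * (norm G1)\<^sup>2))) = ennreal (p\<^sup>2) * dens p e T q"
    proof -
      have "ennreal (p\<^sup>2) * ennreal (norm G powr (p - 2) * (norm G1)\<^sup>2 * (x - e)) =
          ennreal (p\<^sup>2 * (norm G powr (p - 2) * (norm G1)\<^sup>2 * (x - e)))"
        by (rule ennreal_mult'[symmetric]) simp
      then show ?thesis
        using True e by (simp add: dens_def q G_def G1_def mult_ac)
    qed
    finally show ?thesis
    proof (rule Lim_transform_eventually)
      obtain N :: nat where "x - e \<le> real N" using real_arch_simple by blast
      then show "\<forall>\<^sub>F n in sequentially. ennreal ((x - e) * Lap p (del n) x t) = ennreal (Phi p T n q)"
        using True by (intro eventually_sequentiallyI[of N]) (auto simp: Phi_def q split: split_indicator)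
    qed
  qed
qed

text \<open>The exponent \<open>p / 2 - 1\<close> changes sign at \<open>p = 2\<close>. Below,
  dropping \<open>d\<close> from the base increases the power, so the limit density dominates up to
  a factor; above, the base is at most \<open>B\<^sup>2 + 1\<close>, and the density for exponent
  \<open>2\<close> remains.\<close>

lemma Phi_le:
  assumes p: "p \<ge> 1"
    and nz: "fst q > 0 \<longrightarrow> g (Complex (fst q) (snd q)) \<noteq> 0 \<or> deriv g (Complex (fst q) (snd q)) = 0"
  shows "p \<le> 2 \<Longrightarrow> ennreal (Phi p T n q) \<le> ennreal (2 * p) * dens p e T q"
    and "p \<ge> 2 \<Longrightarrow> ennreal (Phi p T n q) \<le> ennreal (p\<^sup>2 * (B\<^sup>2 + 1) powr (p / 2 - 1)) * dens 2 e T q"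
proof -
  obtain x t where q: "q = (x, t)" by (cases q)
  define G G1 where "G = g (Complex x t)" and "G1 = deriv g (Complex x t)"
  define w where "w = (norm G)\<^sup>2 + del n"
  have w: "w > 0" using w_pos[OF del(1)] by (simp add: w_def)
  show "ennreal (Phi p T n q) \<le> ennreal (2 * p) * dens p e T q" if "p \<le> 2"
  proof (cases "x > e \<and> t \<in> {-T..T} \<and> G1 \<noteq> 0")
    case True
    then have "G \<noteq> 0" using nz e by (simp add: q G_def G1_def)
    have "Phi p T n q \<le> (x - e) * Lap p (del n) x t"
      using True Lap_nonneg[OF p del(1)] by (auto simp: Phi_def q split: split_indicator)
    also have "\<dots> = (x - e) * (p * w powr (p / 2 - 2) * (norm G1)\<^sup>2 * (p * (norm G)\<^sup>2 + 2 * del n))"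
      by (simp add: Lap_def G_def G1_def w_def)
    also have "\<dots> \<le> (x - e) * (p * w powr (p / 2 - 2) * (norm G1)\<^sup>2 * (2 * w))"
    proof -
      have "p * (norm G)\<^sup>2 \<le> 2 * (norm G)\<^sup>2" using that by (intro mult_right_mono) auto
      then show ?thesis using True p by (intro mult_left_mono) (auto simp: w_def)
    qed
    also have "\<dots> = (2 * p) * ((w powr (p / 2 - 2) * w) * (norm G1)\<^sup>2 * (x - e))"
      by (simp add: algebra_simps)
    also have "w powr (p / 2 - 2) * w = w powr (p / 2 - 1)"
      using powr_add[of w "p / 2 - 2" 1] w by simp
    also have "w powr (p / 2 - 1) \<le> ((norm G)\<^sup>2) powr (p / 2 - 1)"
      using that \<open>G \<noteq> 0\<close> del(1)[of n] by (intro powr_mono2') (auto simp: w_def)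
    also have "((norm G)\<^sup>2) powr (p / 2 - 1) = norm G powr (p - 2)"
      by (simp add: square_powr algebra_simps)
    finally have "Phi p T n q \<le> (2 * p) * (norm G powr (p - 2) * (norm G1)\<^sup>2 * (x - e))"
      using True p by (simp add: mult_left_mono mult_right_mono)
    then have "ennreal (Phi p T n q) \<le> ennreal ((2 * p) * (norm G powr (p - 2) * (norm G1)\<^sup>2 * (x - e)))"
      by (rule ennreal_leI)
    also have "\<dots> = ennreal (2 * p) * ennreal (norm G powr (p - 2) * (norm G1)\<^sup>2 * (x - e))"
      using p by (intro ennreal_mult') simp
    finally show ?thesis using True e by (simp add: dens_def q G_def G1_def)
  next
    case False
    then have "Phi p T n q = 0" by (auto simp: Phi_def q Lap_def G1_def split: split_indicator)
    then show ?thesis by simp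
  qed
  show "ennreal (Phi p T n q) \<le> ennreal (p\<^sup>2 * (B\<^sup>2 + 1) powr (p / 2 - 1)) * dens 2 e T q" if "p \<ge> 2"
  proof (cases "x > e \<and> t \<in> {-T..T} \<and> G1 \<noteq> 0")
    case True
    then have "G \<noteq> 0" using nz e by (simp add: q G_def G1_def)
    have "norm G \<le> B" unfolding G_def using True e by (intro bound) auto
    then have wB: "w \<le> B\<^sup>2 + 1" unfolding w_def using del by (intro add_mono power_mono) auto
    have "Phi p T n q \<le> (x - e) * Lap p (del n) x t"
      using True Lap_nonneg[OF p del(1)] by (auto simp: Phi_def q split: split_indicator)
    also have "\<dots> = (x - e) * (p * w powr (p / 2 - 2) * (norm G1)\<^sup>2 * (p * (norm G)\<^sup>2 + 2 * del n))"
      by (simp add: Lap_def G_def G1_def w_def)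
    also have "\<dots> \<le> (x - e) * (p * w powr (p / 2 - 2) * (norm G1)\<^sup>2 * (p * w))"
    proof -
      have "2 * del n \<le> p * del n" using that less_imp_le[OF del(1)] by (intro mult_right_mono) auto
      then show ?thesis using True p by (intro mult_left_mono) (auto simp: w_def algebra_simps)
    qed
    also have "\<dots> = p\<^sup>2 * (w powr (p / 2 - 2) * w) * ((norm G1)\<^sup>2 * (x - e))"
      by (simp add: algebra_simps power2_eq_square)
    also have "w powr (p / 2 - 2) * w = w powr (p / 2 - 1)"
      using powr_add[of w "p / 2 - 2" 1] w by simp
    also have "p\<^sup>2 * w powr (p / 2 - 1) * ((norm G1)\<^sup>2 * (x - e)) \<le>
        p\<^sup>2 * (B\<^sup>2 + 1) powr (p / 2 - 1) * ((norm G1)\<^sup>2 * (x - e))"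
      using that wB w True by (intro mult_right_mono mult_left_mono powr_mono2) auto
    finally have "ennreal (Phi p T n q) \<le> ennreal (p\<^sup>2 * (B\<^sup>2 + 1) powr (p / 2 - 1) * ((norm G1)\<^sup>2 * (x - e)))"
      by (rule ennreal_leI)
    also have "\<dots> = ennreal (p\<^sup>2 * (B\<^sup>2 + 1) powr (p / 2 - 1)) * ennreal ((norm G1)\<^sup>2 * (x - e))"
      by (intro ennreal_mult') simp
    \<comment> \<open>\<open>norm G powr 0\<close> is 1 only because \<open>G\<close> is nonzero;
      \<open>0 powr 0\<close> would be 0.\<close>
    finally show ?thesis using True e \<open>G \<noteq> 0\<close> by (simp add: dens_def q G_def G1_def)
  next
    case False
    then have "Phi p T n q = 0" by (auto simp: Phi_def q Lap_def G1_def split: split_indicator)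
    then show ?thesis by simp
  qed
qed

text \<open>The share of the horizontal edges in \<open>green_rectangle\<close>, which survives when
  the right edge recedes.\<close>

definition K :: "real \<Rightarrow> real" where
  "K p = 2 * Q p * (e / ln 2 + 1 / (ln 2)\<^sup>2)"

text \<open>On the receding right edge \<open>g\<close> tends to \<open>c\<close>, the origin of the
  term \<open>norm c powr p\<close>; one constant dominates both families.\<close>

lemma U_integral_tendsto:
  assumes p: "p \<ge> 1"
  shows "(\<lambda>n. integral {-T..T} (U p (del n) e)) \<longlonglongrightarrow> integral {-T..T} (\<lambda>t. norm (g (Complex e t)) powr p)"
    and "(\<lambda>n. integral {-T..T} (U p (del n) (e + real n))) \<longlonglongrightarrow> integral {-T..T} (\<lambda>t. norm c powr p)"
proof -
  have Ub: "norm (U p (del n) x t) \<le> (B\<^sup>2 + 1) powr (p / 2)" if "x > 0" for n x t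
  proof -
    have "(norm (g (Complex x t)))\<^sup>2 \<le> B\<^sup>2" using bound[of "Complex x t"] that by (intro power_mono) auto
    then have "U p (del n) x t \<le> (B\<^sup>2 + 1) powr (p / 2)"
      unfolding U_def using del(1)[of n] del(2)[of n] p by (intro powr_mono2 add_mono) (auto intro: add_nonneg_nonneg less_imp_le)
    then show ?thesis by (simp add: U_def)
  qed
  have Ui: "U p (del n) x integrable_on {-T..T}" if "x > 0" for n x
    by (intro integrable_continuous_interval cont_slice(1) cont_U del that)
  have lim: "(\<lambda>n. ((norm (G n))\<^sup>2 + del n) powr (p / 2)) \<longlonglongrightarrow> norm l powr p" if "G \<longlonglongrightarrow> l" for G and l :: complex
  proof -
    have "(\<lambda>n. ((norm (G n))\<^sup>2 + del n) powr (p / 2)) \<longlonglongrightarrow> ((norm l)\<^sup>2 + 0) powr (p / 2)"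
      using p less_imp_le[OF del(1)]
      by (intro tendsto_powr' tendsto_intros that del) (auto intro!: always_eventually add_nonneg_nonneg)
    also have "((norm l)\<^sup>2 + 0) powr (p / 2) = norm l powr p"
      by (simp add: square_powr)
    finally show ?thesis .
  qed
  show "(\<lambda>n. integral {-T..T} (U p (del n) e)) \<longlonglongrightarrow> integral {-T..T} (\<lambda>t. norm (g (Complex e t)) powr p)"
    by (rule dominated_convergence(2)[where h = "\<lambda>_. (B\<^sup>2 + 1) powr (p / 2)"])
      (use Ub[OF e] Ui[OF e] lim in \<open>auto simp: U_def\<close>)
  show "(\<lambda>n. integral {-T..T} (U p (del n) (e + real n))) \<longlonglongrightarrow> integral {-T..T} (\<lambda>t. norm c powr p)"
  proof (rule dominated_convergence(2)[where h = "\<lambda>_. (B\<^sup>2 + 1) powr (p / 2)"])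
    fix t
    have "(\<lambda>n. g (Complex (e + real n) t)) \<longlonglongrightarrow> c"
    proof (rule LIM_zero_cancel, rule Lim_null_comparison)
      show "\<forall>\<^sub>F n in sequentially. norm (g (Complex (e + real n) t) - c) \<le> C * 2 powr - (e + real n)"
        using decay[of "Complex (e + real _) t"] e by (auto intro!: always_eventually)
      have "(\<lambda>n. 2 powr - (e + real n)) \<longlonglongrightarrow> 0" by real_asymp
      then show "(\<lambda>n. C * 2 powr - (e + real n)) \<longlonglongrightarrow> 0" by (rule tendsto_mult_right_zero)
    qed
    then show "(\<lambda>n. U p (del n) (e + real n) t) \<longlonglongrightarrow> norm c powr p"
      unfolding U_def by (rule lim)
  qed (use Ub Ui e in \<open>auto simp: add_pos_nonneg\<close>)
qed

text \<open>
  The error \<open>K p\<close> does not depend on \<open>T\<close>: the horizontal boundary terms \<open>(x - e) * |\<partial>U/\<partial>t|\<close> are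
  integrable in \<open>x\<close>. Fatou's lemma yields the finiteness that dominated convergence then needs; for
  \<open>p \<ge> 2\<close> the dominating function is the limit density for the exponent \<open>2\<close>.
\<close>

theorem green_strip:
  assumes p: "p \<ge> 1" and T: "T \<ge> 0"
  obtains I where "I \<ge> 0" "integral\<^sup>N lborel (dens p e T) = ennreal I"
    "\<bar>p\<^sup>2 * I - (integral {-T..T} (\<lambda>t. norm (g (Complex e t)) powr p) - 2 * T * norm c powr p)\<bar> \<le> K p"
proof -
  define A where "A p n = integral {-T..T} (U p (del n) e) - integral {-T..T} (U p (del n) (e + real n))" for p n
  define A' where "A' p = integral {-T..T} (\<lambda>t. norm (g (Complex e t)) powr p) - 2 * T * norm c powr p" for p
  define E where "E p n = 2 * T * (e + real n) * (Q p * 2 powr (- (e + real n))) + K p" for p n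
  have A: "A p \<longlonglongrightarrow> A' p" if "p \<ge> 1" for p
    using tendsto_diff[OF U_integral_tendsto[OF that, of T]] T by (simp add: A_def[abs_def] A'_def mult_ac)
  \<comment> \<open>Exponential decay of the normal derivative beats the linear weight on the right
    edge.\<close>
  have E: "E p \<longlonglongrightarrow> K p" for p
  proof -
    have "(\<lambda>n. (e + real n) * 2 powr (- (e + real n))) \<longlonglongrightarrow> 0" by real_asymp
    then have "(\<lambda>n. (2 * T * Q p) * ((e + real n) * 2 powr (- (e + real n))) + K p) \<longlonglongrightarrow> (2 * T * Q p) * 0 + K p"
      by (intro tendsto_intros)
    moreover have "E p = (\<lambda>n. (2 * T * Q p) * ((e + real n) * 2 powr (- (e + real n))) + K p)"
      by (simp only: E_def[abs_def] mult_ac)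
    ultimately show ?thesis by simp
  qed
  have JE: "\<bar>J p T n - A p n\<bar> \<le> E p n" if "p \<ge> 1" for p n
    unfolding J_def A_def E_def K_def
    by (rule green_rectangle[OF del(1,2) that]) (use T in auto)
  have fin: "integral\<^sup>N lborel (\<lambda>q. ennreal (p\<^sup>2) * dens p e T q) < \<infinity>" if p: "p \<ge> 1" for p
  proof -
    have "integral\<^sup>N lborel (\<lambda>q. ennreal (p\<^sup>2) * dens p e T q) = integral\<^sup>N lborel (\<lambda>q. liminf (\<lambda>n. ennreal (Phi p T n q)))"
    proof (rule nn_integral_cong_AE)
      show "AE q in lborel. ennreal (p\<^sup>2) * dens p e T q = liminf (\<lambda>n. ennreal (Phi p T n q))"
        using AE_nonzero
      proof eventually_elim
        case (elim q)
        show ?case using lim_imp_Liminf[OF _ Phi_tendsto[OF p elim, of T]] by simp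
      qed
    qed
    also have "\<dots> \<le> liminf (\<lambda>n. integral\<^sup>N lborel (\<lambda>q. ennreal (Phi p T n q)))"
      by (rule nn_integral_liminf) simp
    also have "\<dots> = liminf (\<lambda>n. ennreal (J p T n))"
      by (simp add: nn_integral_Phi[OF p])
    also have "\<dots> \<le> liminf (\<lambda>n. ennreal (A p n + E p n))"
    proof (intro Liminf_mono always_eventually allI ennreal_leI)
      show "J p T n \<le> A p n + E p n" for n using JE[OF p, of n] by linarith
    qed
    also have "\<dots> = ennreal (A' p + K p)"
      by (intro lim_imp_Liminf tendsto_ennrealI tendsto_add A E p) simp
    finally show ?thesis by (simp add: order_le_less_trans)
  qed
  have fin': "integral\<^sup>N lborel (\<lambda>q. ennreal r * dens p e T q) < \<infinity>" if "p \<ge> 1" for p r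
  proof -
    have "p\<^sup>2 > 0" using that by simp
    have "integral\<^sup>N lborel (dens p e T) < \<infinity>"
    proof (rule ccontr)
      assume "\<not> ?thesis"
      then have "integral\<^sup>N lborel (dens p e T) = \<infinity>" by (simp add: top.not_eq_extremum[symmetric])
      then show False using fin[OF that] \<open>p\<^sup>2 > 0\<close> by (simp add: nn_integral_cmult ennreal_mult_top)
    qed
    then show ?thesis by (simp add: nn_integral_cmult ennreal_mult_less_top)
  qed
  obtain w where [measurable]: "w \<in> borel_measurable borel"
    and w: "\<And>n. AE q in lborel. ennreal (Phi p T n q) \<le> w q" "integral\<^sup>N lborel w < \<infinity>"
  proof (cases "p \<le> 2")
    case True
    show ?thesis
    proof (rule that[of "\<lambda>q. ennreal (2 * p) * dens p e T q"])
      show "AE q in lborel. ennreal (Phi p T n q) \<le> ennreal (2 * p) * dens p e T q" for n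
        using AE_nonzero by eventually_elim (rule Phi_le(1)[OF p _ True])
    qed (use fin'[OF p] in auto)
  next
    case False
    show ?thesis
    proof (rule that[of "\<lambda>q. ennreal (p\<^sup>2 * (B\<^sup>2 + 1) powr (p / 2 - 1)) * dens 2 e T q"])
      show "AE q in lborel. ennreal (Phi p T n q) \<le> ennreal (p\<^sup>2 * (B\<^sup>2 + 1) powr (p / 2 - 1)) * dens 2 e T q" for n
        using AE_nonzero by eventually_elim (rule Phi_le(2)[OF p], use False in auto)
    qed (use fin'[of 2] in auto)
  qed
  have lim: "(\<lambda>n. integral\<^sup>N lborel (\<lambda>q. ennreal (Phi p T n q))) \<longlonglongrightarrow> integral\<^sup>N lborel (\<lambda>q. ennreal (p\<^sup>2) * dens p e T q)"
  proof (rule nn_integral_dominated_convergence[where w = w])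
    show "AE q in lborel. (\<lambda>n. ennreal (Phi p T n q)) \<longlonglongrightarrow> ennreal (p\<^sup>2) * dens p e T q"
      using AE_nonzero by eventually_elim (rule Phi_tendsto[OF p])
  qed (use w in auto)
  define I where "I = enn2real (integral\<^sup>N lborel (dens p e T))"
  have I: "integral\<^sup>N lborel (dens p e T) = ennreal I" "I \<ge> 0"
    using fin'[OF p, of 1] by (auto simp: I_def)
  have "integral\<^sup>N lborel (\<lambda>q. ennreal (p\<^sup>2) * dens p e T q) = ennreal (p\<^sup>2 * I)"
    by (simp add: nn_integral_cmult I(1) ennreal_mult')
  with lim have "(\<lambda>n. ennreal (J p T n)) \<longlonglongrightarrow> ennreal (p\<^sup>2 * I)"
    by (simp add: nn_integral_Phi[OF p])
  then have "J p T \<longlonglongrightarrow> p\<^sup>2 * I"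
    by (rule tendsto_ennrealD) (use I nn_integral_Phi(2)[OF p] in auto)
  then have "(\<lambda>n. \<bar>J p T n - A p n\<bar>) \<longlonglongrightarrow> \<bar>p\<^sup>2 * I - A' p\<bar>"
    by (intro tendsto_intros A p)
  then have "\<bar>p\<^sup>2 * I - A' p\<bar> \<le> K p"
    by (rule LIMSEQ_le[OF _ E]) (use JE[OF p] in auto)
  then show ?thesis using that[OF I(2,1)] by (simp add: A'_def)
qed

end

section \<open>Haar measure and the maximal ergodic inequality\<close>

lemma sets_circle_measure [measurable_cong]: "sets circle_measure = sets borel"
  by (simp add: circle_measure_def)

lemma space_circle_measure [simp]: "space circle_measure = UNIV"
  by (simp add: circle_measure_def)

lemma cis_measurable [measurable]: "(\<lambda>\<theta>. cis (2 * pi * \<theta>)) \<in> borel_measurable borel"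
  unfolding cis_conv_exp by (intro borel_measurable_continuous_onI continuous_intros)

lemma prob_space_uniform: "prob_space (uniform_measure lborel {0..<1::real})"
  by (rule prob_space_uniform_measure) auto

lemma prob_space_circle_measure: "prob_space circle_measure"
  unfolding circle_measure_def
  by (rule prob_space.prob_space_distr[OF prob_space_uniform]) simp

lemma emeasure_circle:
  assumes "A \<in> sets borel"
  shows "emeasure circle_measure A = emeasure lborel ({0..<1} \<inter> {\<theta>. cis (2 * pi * \<theta>) \<in> A})"
proof -
  have [measurable]: "A \<in> sets borel" by fact
  have *: "(\<lambda>\<theta>. cis (2 * pi * \<theta>)) -` A = {\<theta>. cis (2 * pi * \<theta>) \<in> A}" by auto
  have [measurable]: "{\<theta>. cis (2 * pi * \<theta>) \<in> A} \<in> sets borel" by measurable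
  show ?thesis
    unfolding circle_measure_def by (subst emeasure_distr) (auto simp: * divide_ennreal_def)
qed

lemma emeasure_lborel_translate:
  assumes "S \<in> sets borel"
  shows "emeasure lborel {x::real. x + c \<in> S} = emeasure lborel S"
proof -
  have "emeasure lborel S = emeasure (distr lborel borel ((+) c)) S"
    by (simp add: lborel_distr_plus)
  also have "\<dots> = emeasure lborel {x. x + c \<in> S}"
    using assms by (subst emeasure_distr) (auto simp: vimage_def add.commute)
  finally show ?thesis ..
qed

text \<open>In the angle, measured in turns, rotation is translation by \<open>\<alpha>\<close>
  modulo 1: the translated unit interval is cut at 1 and its overhang moved back by one
  period.\<close>

lemma circle_measure_rotate:
  assumes w: "norm w = 1" and A: "A \<in> sets borel"
  shows "emeasure circle_measure {y. w * y \<in> A} = emeasure circle_measure A"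
proof -
  define \<alpha> where "\<alpha> = Arg2pi w / (2 * pi)"
  have \<alpha>: "0 \<le> \<alpha>" "\<alpha> < 1" using Arg2pi_ge_0[of w] Arg2pi_lt_2pi[of w] by (auto simp: \<alpha>_def)
  have w': "w = cis (2 * pi * \<alpha>)"
    using Arg2pi_eq[of w] w by (simp add: \<alpha>_def cis_conv_exp)
  define P where "P = {\<theta>. cis (2 * pi * \<theta>) \<in> A}"
  have [measurable]: "A \<in> sets borel" by fact
  have P[measurable]: "P \<in> sets borel" unfolding P_def by measurable
  have per: "\<theta> + 1 \<in> P \<longleftrightarrow> \<theta> \<in> P" for \<theta>
  proof -
    have "cis (2 * pi * (\<theta> + 1)) = cis (2 * pi * \<theta>) * cis (2 * pi)"
      by (simp only: cis_mult distrib_left mult_1_right)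
    also have "cis (2 * pi) = 1" by (simp add: complex_eq_iff)
    finally show ?thesis by (simp add: P_def)
  qed
  have m: "{y. w * y \<in> A} \<in> sets borel" by measurable
  have "emeasure circle_measure {y. w * y \<in> A} = emeasure lborel {x. x + \<alpha> \<in> {\<alpha>..<1 + \<alpha>} \<inter> P}"
    unfolding emeasure_circle[OF m]
    by (intro arg_cong[where f = "emeasure lborel"]) (auto simp: P_def w' cis_mult algebra_simps)
  also have "\<dots> = emeasure lborel ({\<alpha>..<1 + \<alpha>} \<inter> P)"
    by (rule emeasure_lborel_translate) simp
  also have "{\<alpha>..<1 + \<alpha>} \<inter> P = ({\<alpha>..<1} \<inter> P) \<union> ({1..<1 + \<alpha>} \<inter> P)"
    using \<alpha> by auto
  also have "emeasure lborel \<dots> = emeasure lborel ({\<alpha>..<1} \<inter> P) + emeasure lborel ({1..<1 + \<alpha>} \<inter> P)"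
    by (rule plus_emeasure[symmetric]) auto
  also have "emeasure lborel ({1..<1 + \<alpha>} \<inter> P) = emeasure lborel {x. x + 1 \<in> {1..<1 + \<alpha>} \<inter> P}"
    by (rule emeasure_lborel_translate[symmetric]) simp
  also have "{x. x + 1 \<in> {1..<1 + \<alpha>} \<inter> P} = {0..<\<alpha>} \<inter> P"
    using per by (auto simp: algebra_simps)
  also have "emeasure lborel ({\<alpha>..<1} \<inter> P) + emeasure lborel ({0..<\<alpha>} \<inter> P) = emeasure lborel (({\<alpha>..<1} \<inter> P) \<union> ({0..<\<alpha>} \<inter> P))"
    by (rule plus_emeasure) auto
  also have "({\<alpha>..<1} \<inter> P) \<union> ({0..<\<alpha>} \<inter> P) = {0..<1} \<inter> P" using \<alpha> by auto
  also have "emeasure lborel \<dots> = emeasure circle_measure A"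
    unfolding emeasure_circle[OF A] P_def ..
  finally show ?thesis .
qed

text \<open>Identifies the product sigma-algebra with the Borel sets of the product topology, so
  that continuity of the flow and of the twists yields measurability.\<close>

lemma sets_m_inf [measurable_cong]: "sets m_inf = sets borel"
proof -
  have "sets m_inf = sets (Pi\<^sub>M UNIV (\<lambda>i::nat. borel :: complex measure))"
    unfolding m_inf_def by (intro sets_PiM_cong refl sets_circle_measure)
  also have "\<dots> = sets borel" by (rule sets_PiM_equal_borel)
  finally show ?thesis .
qed

lemma space_m_inf [simp]: "space m_inf = UNIV"
  using sets_eq_imp_space_eq[OF sets_m_inf] by simp

lemma prob_space_m_inf: "prob_space m_inf"
  unfolding m_inf_def by (rule prob_space_PiM) (rule prob_space_circle_measure)

interpretation m_inf: prob_space m_inf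
  by (rule prob_space_m_inf)

lemma continuous_rot: "continuous_on UNIV (\<lambda>(t, z). rot t z)"
proof -
  have "continuous_on UNIV (\<lambda>x::real \<times> (nat \<Rightarrow> complex). snd x n)" for n
    by (rule continuous_on_product_then_coordinatewise[OF continuous_on_snd[OF continuous_on_id]])
  then show ?thesis
    unfolding rot_def case_prod_unfold cis_conv_exp
    by (intro continuous_on_coordinatewise_then_product continuous_on_mult) (auto intro!: continuous_intros)
qed

lemma rot_measurable2 [measurable]:
  assumes [measurable]: "f \<in> borel_measurable M" "h \<in> borel_measurable M"
  shows "(\<lambda>x. rot (f x) (h x)) \<in> borel_measurable M"
proof -
  have "(\<lambda>(t, z). rot t z) \<in> borel_measurable (borel \<Otimes>\<^sub>M borel)"
    unfolding borel_prod by (rule borel_measurable_continuous_onI[OF continuous_rot])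
  then have "(\<lambda>x. (\<lambda>(t, z). rot t z) (f x, h x)) \<in> borel_measurable M"
    by (rule measurable_compose[rotated]) measurable
  then show ?thesis by simp
qed

text \<open>A product measure is determined on finite cylinders, where the rotation acts on each
  coordinate separately.\<close>

lemma m_inf_rot: "distr m_inf m_inf (rot t) = m_inf"
proof -
  interpret product_prob_space "\<lambda>_::nat. circle_measure" UNIV
    by (rule product_prob_spaceI) (rule prob_space_circle_measure)
  have r[measurable]: "rot t \<in> measurable m_inf m_inf"
    unfolding measurable_cong_sets[OF refl sets_m_inf] by measurable
  have "distr m_inf m_inf (rot t) = Pi\<^sub>M UNIV (\<lambda>_. circle_measure)"
  proof (rule PiM_eq)
    show "sets (distr m_inf m_inf (rot t)) = sets (Pi\<^sub>M UNIV (\<lambda>_. circle_measure))"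
      by (simp add: m_inf_def)
    fix J :: "nat set" and F :: "nat \<Rightarrow> complex set"
    assume J: "finite J" "J \<subseteq> UNIV" "\<And>j. j \<in> J \<Longrightarrow> F j \<in> sets circle_measure"
    define c where "c n = cis (- t * ln (real n))" for n
    define F' where "F' j = {y. c j * y \<in> F j}" for j
    have F': "F' j \<in> sets circle_measure" if "j \<in> J" for j
    proof -
      have [measurable]: "F j \<in> sets borel" using J(3)[OF that] by (simp add: sets_circle_measure)
      show ?thesis unfolding F'_def sets_circle_measure by measurable
    qed
    have pm: "prod_emb UNIV (\<lambda>_. circle_measure) J (Pi\<^sub>E J F) \<in> sets m_inf"
      unfolding m_inf_def using J by (intro sets_PiM_I) auto
    have "emeasure (distr m_inf m_inf (rot t)) (prod_emb UNIV (\<lambda>_. circle_measure) J (Pi\<^sub>E J F)) =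
        emeasure m_inf (prod_emb UNIV (\<lambda>_. circle_measure) J (Pi\<^sub>E J F'))"
      using pm by (subst emeasure_distr)
        (auto simp: prod_emb_def PiE_iff F'_def rot_def c_def mult.commute intro!: arg_cong[where f = "emeasure m_inf"])
    also have "\<dots> = (\<Prod>j\<in>J. emeasure circle_measure (F' j))"
      unfolding m_inf_def using J F' by (intro emeasure_PiM_emb) auto
    also have "\<dots> = (\<Prod>j\<in>J. emeasure circle_measure (F j))"
      unfolding F'_def
      by (intro prod.cong refl circle_measure_rotate) (use J in \<open>auto simp: c_def sets_circle_measure\<close>)
    finally show "emeasure (distr m_inf m_inf (rot t)) (prod_emb UNIV (\<lambda>_. circle_measure) J (Pi\<^sub>E J F)) =
      (\<Prod>j\<in>J. emeasure circle_measure (F j))" .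
  qed
  then show ?thesis by (simp add: m_inf_def)
qed

lemma AE_torus: "AE z in m_inf. z \<in> torus"
proof -
  have "AE w in circle_measure. norm w = 1"
    unfolding circle_measure_def by (subst AE_distr_iff) auto
  then have "AE z in m_inf. norm (z n) = 1" for n
    unfolding m_inf_def by (intro AE_PiM_component prob_space_circle_measure) auto
  then show ?thesis by (simp add: torus_def AE_all_countable)
qed

lemma sum_lessThan_add:
  fixes h :: "nat \<Rightarrow> 'a::comm_monoid_add"
  shows "(\<Sum>k<n + r. h k) = (\<Sum>k<n. h k) + (\<Sum>k<r. h (n + k))"
  by (induction r) (simp_all add: add_ac)

text \<open>Greedy covering of the bad starting points below \<open>N\<close> by disjoint intervals of large average.\<close>

lemma maximal_counting:
  fixes h :: "nat \<Rightarrow> ennreal"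
  shows "(\<Sum>k<N. if \<exists>n\<in>{1..m}. of_nat n * l \<le> (\<Sum>j<n. h (k + j)) then l else 0) \<le> (\<Sum>k<N + m. h k)"
proof (induction N arbitrary: h rule: less_induct)
  case (less N)
  define e where "e h k = (if \<exists>n\<in>{1..m}. of_nat n * l \<le> (\<Sum>j<n. h (k + j)) then l else 0)" for h :: "nat \<Rightarrow> ennreal" and k
  have IH: "(\<Sum>k<N'. e h' k) \<le> (\<Sum>k<N' + m. h' k)" if "N' < N" for N' h'
    using less[OF that, of h'] by (simp add: e_def)
  have shift: "e h (n + k) = e (\<lambda>j. h (n + j)) k" for n k
    by (simp add: e_def add.assoc)
  have le: "e h k \<le> l" for h k by (simp add: e_def)
  have "(\<Sum>k<N. e h k) \<le> (\<Sum>k<N + m. h k)"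
  proof (cases "\<exists>n\<in>{1..m}. of_nat n * l \<le> (\<Sum>j<n. h j)")
    case False
    show ?thesis
    proof (cases N)
      case (Suc N')
      have "(\<Sum>k<N. e h k) = (\<Sum>k<1 + N'. e h k)" using Suc by simp
      also have "\<dots> = e h 0 + (\<Sum>k<N'. e h (1 + k))" unfolding sum_lessThan_add by simp
      also have "e h 0 = 0" using False by (simp add: e_def)
      also have "0 + (\<Sum>k<N'. e h (1 + k)) \<le> (\<Sum>k<N' + m. h (1 + k))"
        unfolding shift using IH[of N'] Suc by simp
      also have "\<dots> \<le> (\<Sum>k<1 + (N' + m). h k)" unfolding sum_lessThan_add by simp
      finally show ?thesis using Suc by simp
    qed simp
  next
    case True
    then obtain n where n: "1 \<le> n" "n \<le> m" "of_nat n * l \<le> (\<Sum>j<n. h j)" by auto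
    have sl: "(\<Sum>k<r. e h k) \<le> of_nat r * l" for r
      using sum_mono[of "{..<r}" "e h" "\<lambda>_. l", OF le] by simp
    \<comment> \<open>The last interval may overrun \<open>N\<close>, by less than \<open>m\<close>;
      hence the right-hand sum extends to \<open>N + m\<close>.\<close>
    show ?thesis
    proof (cases "N \<le> n")
      case True
      have "(\<Sum>k<N. e h k) \<le> of_nat N * l" by (rule sl)
      also have "\<dots> \<le> of_nat n * l" using True by (intro mult_right_mono) auto
      also have "\<dots> \<le> (\<Sum>j<n. h j)" by (rule n)
      also have "\<dots> \<le> (\<Sum>j<N + m. h j)" using n by (intro sum_mono2) auto
      finally show ?thesis .
    next
      case False
      then obtain r where r: "N = n + r" by (metis le_add_diff_inverse nat_le_linear)
      have "(\<Sum>k<N. e h k) = (\<Sum>k<n. e h k) + (\<Sum>k<r. e (\<lambda>j. h (n + j)) k)"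
        unfolding r sum_lessThan_add shift ..
      also have "\<dots> \<le> (\<Sum>j<n. h j) + (\<Sum>k<r + m. h (n + k))"
        using n r by (intro add_mono order_trans[OF sl n(3)] IH) auto
      also have "\<dots> = (\<Sum>k<N + m. h k)" unfolding r add.assoc by (simp add: sum_lessThan_add)
      finally show ?thesis .
    qed
  qed
  then show ?case by (simp add: e_def)
qed

text \<open>\<open>maximal_counting\<close> is integrated along orbits of length \<open>N\<close>.
  By invariance every summand has the same integral, so dividing by \<open>N\<close> makes the
  boundary factor \<open>(N + m) / N\<close> tend to 1; afterwards \<open>m\<close> tends to
  infinity by continuity from below.\<close>

lemma (in prob_space) maximal_ergodic:
  fixes H :: "'a \<Rightarrow> ennreal"
  assumes \<tau>: "\<tau> \<in> measurable M M" and inv: "distr M M \<tau> = M"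
    and H[measurable]: "H \<in> borel_measurable M" and "l < \<infinity>"
  shows "l * emeasure M {x \<in> space M. \<exists>n\<ge>1. of_nat n * l \<le> (\<Sum>k<n. H ((\<tau> ^^ k) x))} \<le> integral\<^sup>N M H"
proof -
  note \<tau>[measurable]
  have \<tau>k[measurable]: "(\<tau> ^^ k) \<in> measurable M M" for k
    by (induction k) (auto simp: id_def o_def intro!: measurable_compose[OF _ \<tau>])
  have invk: "integral\<^sup>N M (\<lambda>x. G ((\<tau> ^^ k) x)) = integral\<^sup>N M G" if [measurable]: "G \<in> borel_measurable M"
    for G :: "'a \<Rightarrow> ennreal" and k
  proof (induction k)
    case (Suc k)
    have "integral\<^sup>N M (\<lambda>x. G ((\<tau> ^^ Suc k) x)) = integral\<^sup>N M (\<lambda>x. G ((\<tau> ^^ k) (\<tau> x)))"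
      by (simp add: funpow_swap1)
    also have "\<dots> = integral\<^sup>N (distr M M \<tau>) (\<lambda>x. G ((\<tau> ^^ k) x))"
      by (subst nn_integral_distr) auto
    finally show ?case using Suc by (simp add: inv)
  qed simp
  define E where "E m = {x \<in> space M. \<exists>n\<in>{1..m}. of_nat n * l \<le> (\<Sum>k<n. H ((\<tau> ^^ k) x))}" for m :: nat
  have E[measurable]: "E m \<in> sets M" for m unfolding E_def by measurable
  have key: "of_nat N * (l * emeasure M (E m)) \<le> of_nat (N + m) * integral\<^sup>N M H" for N m
  proof -
    have "of_nat N * (l * emeasure M (E m)) = (\<Sum>k<N. integral\<^sup>N M (\<lambda>x. l * indicator (E m) ((\<tau> ^^ k) x)))"
      by (subst invk[of "\<lambda>x. l * indicator (E m) x"]) (auto simp: nn_integral_cmult)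
    also have "\<dots> = integral\<^sup>N M (\<lambda>x. \<Sum>k<N. l * indicator (E m) ((\<tau> ^^ k) x))"
      by (rule nn_integral_sum[symmetric]) simp
    also have "\<dots> \<le> integral\<^sup>N M (\<lambda>x. \<Sum>k<N + m. H ((\<tau> ^^ k) x))"
    proof (rule nn_integral_mono)
      fix x assume x: "x \<in> space M"
      have "(\<Sum>k<N. l * indicator (E m) ((\<tau> ^^ k) x)) =
          (\<Sum>k<N. if \<exists>n\<in>{1..m}. of_nat n * l \<le> (\<Sum>j<n. H ((\<tau> ^^ (k + j)) x)) then l else 0)"
      proof (intro sum.cong refl)
        fix k
        have "(\<tau> ^^ k) x \<in> space M" using measurable_space[OF \<tau>k x] .
        moreover have "(\<tau> ^^ j) ((\<tau> ^^ k) x) = (\<tau> ^^ (k + j)) x" for j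
          by (simp add: funpow_add add.commute[of k])
        ultimately show "l * indicator (E m) ((\<tau> ^^ k) x) =
            (if \<exists>n\<in>{1..m}. of_nat n * l \<le> (\<Sum>j<n. H ((\<tau> ^^ (k + j)) x)) then l else 0)"
          by (auto simp: E_def split: split_indicator)
      qed
      also have "\<dots> \<le> (\<Sum>k<N + m. H ((\<tau> ^^ k) x))" by (rule maximal_counting)
      finally show "(\<Sum>k<N. l * indicator (E m) ((\<tau> ^^ k) x)) \<le> (\<Sum>k<N + m. H ((\<tau> ^^ k) x))" .
    qed
    also have "\<dots> = (\<Sum>k<N + m. integral\<^sup>N M (\<lambda>x. H ((\<tau> ^^ k) x)))"
      by (rule nn_integral_sum) simp
    also have "\<dots> = of_nat (N + m) * integral\<^sup>N M H"
      by (simp add: invk)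
    finally show ?thesis .
  qed
  have Em: "l * emeasure M (E m) \<le> integral\<^sup>N M H" for m
  proof (cases "integral\<^sup>N M H = \<infinity>")
    case False
    then obtain y where y: "integral\<^sup>N M H = ennreal y" "y \<ge> 0" by (cases "integral\<^sup>N M H") auto
    obtain L where L: "l * emeasure M (E m) = ennreal L" "L \<ge> 0"
      using \<open>l < \<infinity>\<close> by (cases "l * emeasure M (E m)") (auto simp: ennreal_mult_eq_top_iff)
    have "L \<le> (1 + real m / real (Suc N)) * y" for N
    proof -
      have "ennreal (real (Suc N) * L) \<le> ennreal (real (Suc N + m) * y)"
        using key[of "Suc N" m] L y by (simp add: ennreal_mult ennreal_of_nat_eq_real_of_nat del: of_nat_Suc of_nat_add)
      then have "real (Suc N) * L \<le> real (Suc N + m) * y"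
        using y by (subst (asm) ennreal_le_iff) (auto simp del: of_nat_Suc)
      then have "real (Suc N) * L \<le> (real (Suc N) + real m) * y"
        by (simp only: of_nat_add)
      then have "L \<le> (real (Suc N) + real m) * y / real (Suc N)"
        by (simp add: pos_le_divide_eq mult.commute del: of_nat_Suc)
      also have "\<dots> = (1 + real m / real (Suc N)) * y"
        by (simp add: add_divide_distrib distrib_right del: of_nat_Suc)
      finally show ?thesis .
    qed
    moreover have "(\<lambda>N. (1 + real m / real (Suc N)) * y) \<longlonglongrightarrow> (1 + 0) * y"
      by (intro tendsto_intros) real_asymp
    ultimately have "L \<le> y" by (intro LIMSEQ_le_const) auto
    then show ?thesis using L y by (simp add: ennreal_leI)
  qed simp
  have inc: "incseq E" by (auto simp: E_def incseq_def)
  have "l * emeasure M (\<Union>m. E m) = (SUP m. l * emeasure M (E m))"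
    by (subst SUP_emeasure_incseq[symmetric]) (auto simp: inc SUP_mult_left_ennreal)
  also have "\<dots> \<le> integral\<^sup>N M H" by (rule SUP_least) (rule Em)
  also have "(\<Union>m. E m) = {x \<in> space M. \<exists>n\<ge>1. of_nat n * l \<le> (\<Sum>k<n. H ((\<tau> ^^ k) x))}"
    unfolding E_def by force
  finally show ?thesis .
qed

section \<open>Unique ergodicity of the Kronecker flow\<close>

text \<open>On the torus a monomial depends only on the ratio \<open>m / n\<close>, and the positive
  rationals index the dual group of the prime coordinates; the conjugate carries the negative
  exponents. \<open>rot t\<close> multiplies a monomial by
  \<open>cis (t * (ln n - ln m))\<close>.\<close>

inductive trigpoly :: "((nat \<Rightarrow> complex) \<Rightarrow> complex) \<Rightarrow> bool" where
  monomial: "m > 0 \<Longrightarrow> n > 0 \<Longrightarrow> trigpoly (\<lambda>z. c * (char_of z m * cnj (char_of z n)))"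
| add: "trigpoly P \<Longrightarrow> trigpoly Q \<Longrightarrow> trigpoly (\<lambda>z. P z + Q z)"

lemma trigpoly_monomial_mult:
  assumes "trigpoly Q" "m > 0" "n > 0"
  shows "trigpoly (\<lambda>z. c * (char_of z m * cnj (char_of z n)) * Q z)"
  using assms(1)
proof induction
  case (monomial m' n' c')
  have "(\<lambda>z. c * (char_of z m * cnj (char_of z n)) * (c' * (char_of z m' * cnj (char_of z n')))) =
      (\<lambda>z. (c * c') * (char_of z (m * m') * cnj (char_of z (n * n'))))"
    using assms monomial by (simp add: char_of_mult fun_eq_iff mult_ac)
  then show ?case using assms monomial trigpoly.monomial by simp
next
  case (add P Q)
  then show ?case using trigpoly.add[OF add.IH] by (simp add: distrib_left)
qed

lemma trigpoly_mult:
  assumes "trigpoly P" "trigpoly Q"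
  shows "trigpoly (\<lambda>z. P z * Q z)"
  using assms(1)
proof induction
  case (monomial m n c)
  then show ?case by (rule trigpoly_monomial_mult[OF assms(2)])
next
  case (add P P')
  then show ?case using trigpoly.add[OF add.IH] by (simp add: distrib_right)
qed

lemma trigpoly_cnj: "trigpoly P \<Longrightarrow> trigpoly (\<lambda>z. cnj (P z))"
proof (induction rule: trigpoly.induct)
  case (monomial m n c)
  have "(\<lambda>z. cnj (c * (char_of z m * cnj (char_of z n)))) = (\<lambda>z. cnj c * (char_of z n * cnj (char_of z m)))"
    by (simp add: fun_eq_iff mult_ac)
  then show ?case using monomial trigpoly.monomial by simp
next
  case (add P Q)
  then show ?case using trigpoly.add[OF add.IH] by simp
qed

lemma trigpoly_const: "trigpoly (\<lambda>_. c)"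
  using trigpoly.monomial[of 1 1 c] by simp

lemma trigpoly_continuous: "trigpoly P \<Longrightarrow> continuous_on A P"
  by (induction rule: trigpoly.induct) (auto intro!: continuous_intros)

lemma trigpoly_cong_prime: "trigpoly P \<Longrightarrow> (\<And>p. prime p \<Longrightarrow> z p = w p) \<Longrightarrow> P z = P w"
  by (induction rule: trigpoly.induct) (metis char_of_cong_prime, metis)

lemma continuous_rot_t: "continuous_on A (\<lambda>t. rot t z)"
  unfolding rot_def cis_conv_exp
  by (intro continuous_on_coordinatewise_then_product continuous_intros)

lemma trigpoly_rot_integrable:
  "trigpoly P \<Longrightarrow> (\<lambda>t. P (rot t z)) integrable_on {a..b::real}"
  by (intro integrable_continuous_interval continuous_on_compose2[OF trigpoly_continuous[of P UNIV] continuous_rot_t]) auto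

text \<open>A monomial is an eigenfunction of the flow. Its frequency vanishes only for
  \<open>m = n\<close>, when it is constant on the torus; otherwise its integral stays bounded in
  \<open>T\<close> and the mean is 0. Neither value depends on the starting point.\<close>

lemma trigpoly_mean:
  assumes "trigpoly P"
  shows "\<exists>L. \<forall>z\<in>torus. ((\<lambda>T. (1 / (2 * T)) *\<^sub>R integral {-T..T} (\<lambda>t. P (rot t z))) \<longlongrightarrow> L) at_top"
  using assms
proof induction
  case (monomial m n c)
  define \<theta> where "\<theta> = ln (real n) - ln (real m)"
  define w where "w z = c * (char_of z m * cnj (char_of z n))" for z
  have w: "c * (char_of (rot t z) m * cnj (char_of (rot t z) n)) = w z * cis (t * \<theta>)" for t z
    using monomial by (simp add: char_of_rot w_def \<theta>_def cis_cnj cis_mult algebra_simps)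
  show ?case
  proof (cases "m = n")
    case True
    have "((\<lambda>T. (1 / (2 * T)) *\<^sub>R integral {-T..T} (\<lambda>t. w z * cis (t * \<theta>))) \<longlongrightarrow> c) at_top" if z: "z \<in> torus" for z
    proof (rule Lim_transform_eventually[OF tendsto_const])
      have "char_of z n * cnj (char_of z n) = 1"
        using norm_char_of[OF z, of n] by (simp add: complex_norm_square[symmetric])
      then have "w z = c" using True by (simp add: w_def)
      show "eventually (\<lambda>T. c = (1 / (2 * T)) *\<^sub>R integral {-T..T} (\<lambda>t. w z * cis (t * \<theta>))) at_top"
        by (rule eventually_mono[OF eventually_gt_at_top[of 0]])
          (use True \<open>w z = c\<close> in \<open>auto simp: \<theta>_def scaleR_conv_of_real\<close>)
    qed
    then show ?thesis unfolding w by blast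
  next
    case False
    then have \<theta>: "\<theta> \<noteq> 0" using monomial by (simp add: \<theta>_def)
    have "((\<lambda>T. (1 / (2 * T)) *\<^sub>R integral {-T..T} (\<lambda>t. w z * cis (t * \<theta>))) \<longlongrightarrow> 0) at_top" if z: "z \<in> torus" for z
    proof (rule Lim_null_comparison)
      have nw: "norm (w z) = norm c" using z by (simp add: w_def norm_mult norm_char_of)
      show "eventually (\<lambda>T. norm ((1 / (2 * T)) *\<^sub>R integral {-T..T} (\<lambda>t. w z * cis (t * \<theta>))) \<le> norm c / \<bar>\<theta>\<bar> * (1 / T)) at_top"
        using eventually_gt_at_top[of 0]
      proof eventually_elim
        case (elim T)
        define A where "A t = w z * cis (t * \<theta>) / (\<i> * of_real \<theta>)" for t
        have "((\<lambda>t. w z * cis (t * \<theta>)) has_integral A T - A (-T)) {-T..T}"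
        proof (rule fundamental_theorem_of_calculus)
          fix t
          have "((\<lambda>t. cis (t * \<theta>)) has_vector_derivative \<theta> *\<^sub>R (\<i> * cis (t * \<theta>))) (at t)"
          proof -
            have "((\<lambda>t. \<i> * complex_of_real (t * \<theta>)) has_vector_derivative \<i> * of_real \<theta>) (at t)"
              by (intro has_vector_derivative_mult_right has_vector_derivative_of_real)
                (auto intro!: derivative_eq_intros)
            from field_vector_diff_chain_at[OF this DERIV_exp] show ?thesis
              by (simp add: o_def cis_conv_exp scaleR_conv_of_real mult_ac)
          qed
          then have "((\<lambda>t. w z / (\<i> * of_real \<theta>) * cis (t * \<theta>)) has_vector_derivative w z / (\<i> * of_real \<theta>) * (\<theta> *\<^sub>R (\<i> * cis (t * \<theta>)))) (at t)"
            by (rule has_vector_derivative_mult_right)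
          then have "(A has_vector_derivative w z * cis (t * \<theta>)) (at t)"
            using \<theta> by (simp add: A_def[abs_def] scaleR_conv_of_real field_simps)
          then show "(A has_vector_derivative w z * cis (t * \<theta>)) (at t within {-T..T})"
            by (rule has_vector_derivative_at_within)
        qed (use elim in auto)
        then have "integral {-T..T} (\<lambda>t. w z * cis (t * \<theta>)) = A T - A (-T)" by (rule integral_unique)
        moreover have "norm (A t) = norm c / \<bar>\<theta>\<bar>" for t
          by (simp add: A_def norm_mult norm_divide nw)
        then have "norm (A T - A (-T)) \<le> norm c / \<bar>\<theta>\<bar> + norm c / \<bar>\<theta>\<bar>"
          by (metis norm_triangle_ineq4)
        ultimately have "norm (integral {-T..T} (\<lambda>t. w z * cis (t * \<theta>))) \<le> 2 * (norm c / \<bar>\<theta>\<bar>)"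
          by (simp only: mult_2)
        then have "(1 / (2 * T)) * norm (integral {-T..T} (\<lambda>t. w z * cis (t * \<theta>))) \<le> (1 / (2 * T)) * (2 * (norm c / \<bar>\<theta>\<bar>))"
          using elim by (intro mult_left_mono) auto
        then show ?case using elim by (simp only: norm_scaleR) (simp add: mult.commute)
      qed
      have "((\<lambda>T::real. 1 / T) \<longlongrightarrow> 0) at_top" by real_asymp
      then show "((\<lambda>T. norm c / \<bar>\<theta>\<bar> * (1 / T)) \<longlongrightarrow> 0) at_top" by (rule tendsto_mult_right_zero)
    qed
    then show ?thesis unfolding w by blast
  qed
next
  case (add P Q)
  then obtain L L' where L: "\<forall>z\<in>torus. ((\<lambda>T. (1 / (2 * T)) *\<^sub>R integral {-T..T} (\<lambda>t. P (rot t z))) \<longlongrightarrow> L) at_top"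
    "\<forall>z\<in>torus. ((\<lambda>T. (1 / (2 * T)) *\<^sub>R integral {-T..T} (\<lambda>t. Q (rot t z))) \<longlongrightarrow> L') at_top" by blast
  show ?case
    using L add.hyps
    by (intro exI[of _ "L + L'"] ballI)
      (simp add: integral_add trigpoly_rot_integrable scaleR_add_right tendsto_add)
qed

text \<open>Coordinates at non-primes are frozen, since characters cannot separate points that differ only there.\<close>

definition prime_torus :: "(nat \<Rightarrow> complex) set" where
  "prime_torus = {z \<in> torus. \<forall>n. \<not> prime n \<longrightarrow> z n = 1}"

definition prime_proj :: "(nat \<Rightarrow> complex) \<Rightarrow> nat \<Rightarrow> complex" where
  "prime_proj z = (\<lambda>n. if prime n then z n else 1)"

lemma prime_proj_mem: "z \<in> torus \<Longrightarrow> prime_proj z \<in> prime_torus"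
  by (simp add: prime_proj_def prime_torus_def torus_def)

lemma prime_torus_subset: "prime_torus \<subseteq> torus"
  by (auto simp: prime_torus_def)

lemma compact_prime_torus: "compact prime_torus"
proof -
  define S where "S n = (if prime n then sphere 0 1 else {1::complex})" for n :: nat
  have "prime_torus = Pi\<^sub>E UNIV S"
    by (auto simp: prime_torus_def torus_def S_def PiE_iff split: if_splits) (metis norm_one)
  moreover have "compactin (product_topology (\<lambda>_. euclidean) UNIV) (Pi\<^sub>E UNIV S)"
    unfolding compactin_PiE by (auto simp: S_def)
  ultimately show ?thesis by (simp add: euclidean_product_topology)
qed

lemma continuous_prime_proj_rot: "continuous_on A (\<lambda>t. prime_proj (rot t z))"
proof (intro continuous_on_coordinatewise_then_product)
  show "continuous_on A (\<lambda>t. prime_proj (rot t z) n)" for n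
    unfolding prime_proj_def rot_def cis_conv_exp
    by (cases "prime n") (auto intro!: continuous_intros)
qed

text \<open>Stone-Weierstrass for real parts. They are closed under products since
  \<open>Re P * Re Q\<close> is the real part of \<open>P * (Q + cnj Q) / 2\<close>, and
  \<open>Re (c * z q)\<close> with \<open>c = 1\<close> or \<open>c = \<i>\<close> separates points
  through the real or the imaginary part of one prime coordinate.\<close>

lemma trigpoly_dense:
  fixes u :: "(nat \<Rightarrow> complex) \<Rightarrow> real"
  assumes u: "continuous_on prime_torus u" and "e > 0"
  obtains P where "trigpoly P" "\<And>z. z \<in> prime_torus \<Longrightarrow> \<bar>u z - Re (P z)\<bar> < e"
proof -
  define R where "R = {u. \<exists>P. trigpoly P \<and> u = (\<lambda>z. Re (P z))}"
  interpret function_ring_on R prime_torus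
  proof
    show "compact prime_torus" by (rule compact_prime_torus)
    fix f assume "f \<in> R"
    then obtain P where P: "trigpoly P" "f = (\<lambda>z. Re (P z))" by (auto simp: R_def)
    then show "continuous_on prime_torus f"
      by (auto intro!: continuous_intros trigpoly_continuous)
    fix g assume "g \<in> R"
    then obtain Q where Q: "trigpoly Q" "g = (\<lambda>z. Re (Q z))" by (auto simp: R_def)
    have "trigpoly (\<lambda>z. P z + Q z)" by (rule trigpoly.add[OF P(1) Q(1)])
    then show "(\<lambda>x. f x + g x) \<in> R" unfolding R_def P Q by (auto intro!: exI[of _ "\<lambda>z. P z + Q z"])
    have "trigpoly (\<lambda>z. (1 / 2) * (P z * (Q z + cnj (Q z))))"
      by (intro trigpoly_mult trigpoly_const trigpoly.add trigpoly_cnj P Q)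
    moreover have "Re (P x) * Re (Q x) = Re ((1 / 2) * (P x * (Q x + cnj (Q x))))" for x
      unfolding complex_add_cnj by simp
    ultimately show "(\<lambda>x. f x * g x) \<in> R" unfolding R_def P Q by blast
  next
    show "(\<lambda>_. c) \<in> R" for c
      unfolding R_def by (auto intro!: exI[of _ "\<lambda>_. of_real c"] trigpoly_const)
  next
    fix x y assume xy: "x \<in> prime_torus" "y \<in> prime_torus" "x \<noteq> y"
    then obtain q where q: "x q \<noteq> y q" by blast
    then have pq: "prime q" using xy by (auto simp: prime_torus_def)
    have R: "(\<lambda>z. Re (c * z q)) \<in> R" for c
    proof -
      have "trigpoly (\<lambda>z. c * (char_of z q * cnj (char_of z 1)))"
        using pq by (intro trigpoly.monomial) (auto simp: prime_gt_0_nat)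
      then show ?thesis using pq by (auto simp: R_def char_of_prime)
    qed
    show "\<exists>f\<in>R. f x \<noteq> f y"
    proof (cases "Re (x q) = Re (y q)")
      case False
      then show ?thesis using R[of 1] by (intro bexI[of _ "\<lambda>z. Re (1 * z q)"]) auto
    next
      case True
      then have "Im (x q) \<noteq> Im (y q)" using q by (simp add: complex_eq_iff)
      then show ?thesis using R[of \<i>] by (intro bexI[of _ "\<lambda>z. Re (\<i> * z q)"]) auto
    qed
  qed
  from Stone_Weierstrass_basic[OF u \<open>e > 0\<close>] that show ?thesis
    by (auto simp: R_def)
qed

text \<open>Uniform approximation moves every average by at most \<open>1 / Suc k\<close>, whatever
  \<open>T\<close> and \<open>z\<close>. The means \<open>L k\<close> of the approximants are thus
  Cauchy and the limits in \<open>k\<close> and \<open>T\<close> may be exchanged; the result is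
  independent of \<open>z\<close> because each \<open>L k\<close> is.\<close>

theorem torus_flow_mean:
  fixes u :: "(nat \<Rightarrow> complex) \<Rightarrow> real"
  assumes u: "continuous_on prime_torus u"
  shows "\<exists>L. \<forall>z\<in>torus. ((\<lambda>T. (1 / (2 * T)) * integral {-T..T} (\<lambda>t. u (prime_proj (rot t z)))) \<longlongrightarrow> L) at_top"
proof -
  define A where "A v z T = (1 / (2 * T)) * integral {-T..T} (\<lambda>t. v (prime_proj (rot t z)))"
    for v :: "(nat \<Rightarrow> complex) \<Rightarrow> real" and z T
  have "\<exists>P. trigpoly P \<and> (\<forall>z\<in>prime_torus. \<bar>u z - Re (P z)\<bar> < 1 / Suc k)" for k
    using trigpoly_dense[OF u, of "1 / Suc k"] by (metis of_nat_0_less_iff zero_less_Suc zero_less_divide_1_iff)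
  then obtain P where P: "\<And>k. trigpoly (P k)" "\<And>k z. z \<in> prime_torus \<Longrightarrow> \<bar>u z - Re (P k z)\<bar> < 1 / Suc k"
    by metis
  define v where "v k z = Re (P k z)" for k z
  have "\<exists>L. \<forall>z\<in>torus. (A (v k) z \<longlongrightarrow> L) at_top" for k
  proof -
    obtain L where L: "\<And>z. z \<in> torus \<Longrightarrow> ((\<lambda>T. (1 / (2 * T)) *\<^sub>R integral {-T..T} (\<lambda>t. P k (rot t z))) \<longlongrightarrow> L) at_top"
      using trigpoly_mean[OF P(1)[of k]] by blast
    have "A (v k) z T = Re ((1 / (2 * T)) *\<^sub>R integral {-T..T} (\<lambda>t. P k (rot t z)))" for z T
    proof -
      have "v k (prime_proj (rot t z)) = Re (P k (rot t z))" for t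
        unfolding v_def using trigpoly_cong_prime[OF P(1)[of k], of "prime_proj (rot t z)" "rot t z"]
        by (simp add: prime_proj_def)
      moreover have "integral {-T..T} (\<lambda>t. Re (P k (rot t z))) = Re (integral {-T..T} (\<lambda>t. P k (rot t z)))"
        using integral_linear[OF trigpoly_rot_integrable[OF P(1)] bounded_linear_Re] by (simp add: o_def)
      ultimately show ?thesis by (simp add: A_def)
    qed
    then have "A (v k) z = (\<lambda>T. Re ((1 / (2 * T)) *\<^sub>R integral {-T..T} (\<lambda>t. P k (rot t z))))" for z
      by blast
    then show ?thesis using tendsto_Re[OF L] by (intro exI[of _ "Re L"]) simp
  qed
  then obtain L where L: "\<And>k z. z \<in> torus \<Longrightarrow> (A (v k) z \<longlongrightarrow> L k) at_top" by metis
  have cont: "(\<lambda>t. w (prime_proj (rot t z))) integrable_on {a..b}"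
    if "continuous_on prime_torus w" "z \<in> torus" for w :: "(nat \<Rightarrow> complex) \<Rightarrow> real" and z and a b :: real
    by (intro integrable_continuous_interval continuous_on_compose2[OF that(1) continuous_prime_proj_rot])
      (use that in \<open>auto intro: prime_proj_mem\<close>)
  have cv: "continuous_on prime_torus (v k)" for k
    unfolding v_def by (intro continuous_intros trigpoly_continuous P)
  have close: "\<bar>A u z T - A (v k) z T\<bar> \<le> 1 / Suc k" if z: "z \<in> torus" and T: "T > 0" for z T k
  proof -
    have "norm (integral {-T..T} (\<lambda>t. u (prime_proj (rot t z)) - v k (prime_proj (rot t z)))) \<le> integral {-T..T} (\<lambda>t. 1 / real (Suc k))"
      using P(2)[of "prime_proj (rot _ z)" k] z
      by (intro integral_norm_bound_integral integrable_diff cont u cv integrable_const_ivl)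
        (auto simp: v_def prime_proj_mem less_imp_le)
    also have "integral {-T..T} (\<lambda>t. u (prime_proj (rot t z)) - v k (prime_proj (rot t z))) =
        integral {-T..T} (\<lambda>t. u (prime_proj (rot t z))) - integral {-T..T} (\<lambda>t. v k (prime_proj (rot t z)))"
      by (rule integral_diff[OF cont[OF u z] cont[OF cv z]])
    finally show ?thesis
      using T unfolding A_def right_diff_distrib[symmetric] abs_mult by (simp add: field_simps)
  qed
  \<comment> \<open>As \<open>L k\<close> does not depend on the character, comparing two of them at
    one base point suffices.\<close>
  have o: "(\<lambda>_. 1) \<in> torus" by (simp add: torus_def)
  have Lclose: "\<bar>L k - L j\<bar> \<le> 1 / Suc k + 1 / Suc j" for k j
  proof (rule tendsto_upperbound)
    show "((\<lambda>T. \<bar>A (v k) (\<lambda>_. 1) T - A (v j) (\<lambda>_. 1) T\<bar>) \<longlongrightarrow> \<bar>L k - L j\<bar>) at_top"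
      by (intro tendsto_intros L o)
    show "eventually (\<lambda>T. \<bar>A (v k) (\<lambda>_. 1) T - A (v j) (\<lambda>_. 1) T\<bar> \<le> 1 / Suc k + 1 / Suc j) at_top"
      using eventually_gt_at_top[of 0]
    proof eventually_elim
      case (elim T)
      show ?case using close[OF o elim, of k] close[OF o elim, of j] by linarith
    qed
  qed simp
  have inv0: "(\<lambda>k. 1 / real (Suc k)) \<longlonglongrightarrow> 0" by real_asymp
  have "Cauchy L"
  proof (rule metric_CauchyI)
    fix e :: real assume "e > 0"
    then obtain M where M: "\<And>k. k \<ge> M \<Longrightarrow> 1 / real (Suc k) < e / 2"
      using order_tendstoD(2)[OF inv0, of "e / 2"] unfolding eventually_sequentially by auto
    show "\<exists>M. \<forall>m\<ge>M. \<forall>n\<ge>M. dist (L m) (L n) < e"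
    proof (intro exI[of _ M] allI impI)
      fix m n assume "M \<le> m" "M \<le> n"
      then show "dist (L m) (L n) < e" using Lclose[of m n] M[of m] M[of n] by (simp add: dist_real_def)
    qed
  qed
  then obtain l where l: "L \<longlonglongrightarrow> l" using Cauchy_convergent convergentD by blast
  have "(A u z \<longlongrightarrow> l) at_top" if z: "z \<in> torus" for z
  proof (rule swap_uniform_limit'[where f = "\<lambda>k. A (v k) z" and g = L and F = sequentially and S = "{0<..}"])
    show "\<forall>\<^sub>F k in sequentially. (A (v k) z \<longlongrightarrow> L k) at_top" using L[OF z] by simp
    show "uniform_limit {0<..} (\<lambda>k. A (v k) z) (A u z) sequentially"
    proof (rule uniform_limitI)
      fix e :: real assume "e > 0"
      with inv0 have "\<forall>\<^sub>F k in sequentially. 1 / real (Suc k) < e" by (rule order_tendstoD)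
      then show "\<forall>\<^sub>F k in sequentially. \<forall>T\<in>{0<..}. dist (A (v k) z T) (A u z T) < e"
      proof eventually_elim
        case (elim k)
        show ?case using close[OF z, of _ k] elim by (force simp: dist_real_def abs_minus_commute)
      qed
    qed
    show "\<forall>\<^sub>F T in at_top. T \<in> {(0::real)<..}" by (rule eventually_mono[OF eventually_gt_at_top[of 0]]) simp
  qed (use l in auto)
  then show ?thesis unfolding A_def by blast
qed

context hinf
begin

lemma F_prime_proj: "F (prime_proj z) = F z"
proof -
  have "char_of (prime_proj z) = char_of z"
    by (rule char_of_cong_prime) (simp add: prime_proj_def)
  then show ?thesis unfolding f_chi_def by simp
qed

text \<open>The value of \<open>F z\<close> at the single point \<open>e\<close> is a continuous
  function of the character on the compact \<open>prime_torus\<close>. Its values along an orbit of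
  the flow are those of \<open>F z\<close> on the vertical line through \<open>e\<close>.\<close>

lemma Hp_mean:
  assumes "e > 0" "p > 0"
  shows "\<exists>L. \<forall>z\<in>torus. ((\<lambda>T. (1 / (2 * T)) * integral {-T..T} (\<lambda>t. norm (F z (Complex e t)) powr p)) \<longlongrightarrow> L) at_top"
proof -
  have "continuous_on prime_torus (\<lambda>z. norm (F z (of_real e)) powr p)"
  proof (rule continuous_on_powr')
    have "continuous_on prime_torus (\<lambda>z. F z (of_real e))"
      unfolding continuous_on_sequentially o_def
    proof (intro allI ballI impI)
      fix z w assume *: "w \<in> prime_torus" "(\<forall>n. z n \<in> prime_torus) \<and> z \<longlonglongrightarrow> w"
      show "(\<lambda>n. F (z n) (of_real e)) \<longlonglongrightarrow> F w (of_real e)"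
      proof (rule F_tendsto)
        show "(\<lambda>k. z k p) \<longlonglongrightarrow> w p" for p
          using * by (intro tendsto_compose[OF _ conjunct2[OF *(2)]]) 
            (metis continuous_on_product_coordinates continuous_on_def UNIV_I)
      qed (use * prime_torus_subset assms in auto)
    qed
    then show "continuous_on prime_torus (\<lambda>z. norm (F z (of_real e)))" by (rule continuous_on_norm)
  qed (use assms in auto)
  then obtain L where L: "\<forall>z\<in>torus. ((\<lambda>T. (1 / (2 * T)) * integral {-T..T}
      (\<lambda>t. norm (F (prime_proj (rot t z)) (of_real e)) powr p)) \<longlongrightarrow> L) at_top"
    using torus_flow_mean by blast
  have "F (prime_proj (rot t z)) (of_real e) = F z (Complex e t)" if "z \<in> torus" for z t
    using F_rot[OF that, of "of_real e" t] assms by (simp add: F_prime_proj Complex_eq)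
  then show ?thesis using L by (intro exI[of _ L]) simp
qed

end

section \<open>Averages of the area integral\<close>

lemma closed_torus: "closed torus"
proof -
  have "torus = (\<Inter>n. {z. norm (z n) = 1})" by (auto simp: torus_def)
  moreover have "closed {z::nat \<Rightarrow> complex. norm (z n) = 1}" for n
    by (intro closed_Collect_eq continuous_intros continuous_on_product_coordinates)
  then have "closed (\<Inter>n. {z::nat \<Rightarrow> complex. norm (z n) = 1})"
    by (intro closed_INT ballI)
  ultimately show ?thesis by (simp only:)
qed

lemma tendsto_fun_component:
  fixes z :: "nat \<Rightarrow> 'a::countable \<Rightarrow> 'b::metric_space"
  assumes "z \<longlonglongrightarrow> w"
  shows "(\<lambda>k. z k p) \<longlonglongrightarrow> w p"
proof -
  have "isCont (\<lambda>x. x p) w"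
    by (rule continuous_on_interior[OF continuous_on_product_coordinates]) simp
  from isCont_tendsto_compose[OF this assms] show ?thesis .
qed

lemma nn_integral_rot:
  fixes H :: "(nat \<Rightarrow> complex) \<Rightarrow> ennreal"
  assumes [measurable]: "H \<in> borel_measurable borel"
  shows "(\<integral>\<^sup>+ z. H (rot t z) \<partial>m_inf) = integral\<^sup>N m_inf H"
proof -
  have [measurable]: "rot t \<in> measurable m_inf m_inf"
    unfolding measurable_cong_sets[OF refl sets_m_inf] by measurable
  have "integral\<^sup>N m_inf H = integral\<^sup>N (distr m_inf m_inf (rot t)) H" by (simp add: m_inf_rot)
  also have "\<dots> = (\<integral>\<^sup>+ z. H (rot t z) \<partial>m_inf)" by (rule nn_integral_distr) auto
  finally show ?thesis ..
qed

lemma nn_integral_flow: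
  fixes H :: "(nat \<Rightarrow> complex) \<Rightarrow> ennreal"
  assumes [measurable]: "H \<in> borel_measurable borel" and "l \<le> r"
  shows "(\<integral>\<^sup>+ z. (\<integral>\<^sup>+ t\<in>{l..r}. H (rot t z) \<partial>lborel) \<partial>m_inf) = ennreal (r - l) * integral\<^sup>N m_inf H"
proof -
  interpret pair_sigma_finite "lborel :: real measure" m_inf
    by (intro pair_sigma_finite.intro lborel.sigma_finite_measure_axioms m_inf.sigma_finite_measure_axioms)
  have "(\<integral>\<^sup>+ z. (\<integral>\<^sup>+ t\<in>{l..r}. H (rot t z) \<partial>lborel) \<partial>m_inf) =
      (\<integral>\<^sup>+ t. (\<integral>\<^sup>+ z. H (rot t z) * indicator {l..r} t \<partial>m_inf) \<partial>lborel)"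
    by (rule Fubini') measurable
  also have "\<dots> = (\<integral>\<^sup>+ t. integral\<^sup>N m_inf H * indicator {l..r} t \<partial>lborel)"
    by (intro nn_integral_cong, subst nn_integral_multc) (auto simp: nn_integral_rot)
  also have "\<dots> = ennreal (r - l) * integral\<^sup>N m_inf H"
    using \<open>l \<le> r\<close> by (simp add: nn_integral_cmult mult.commute)
  finally show ?thesis .
qed

lemma rot_funpow: "(rot c ^^ k) z = rot (real k * c) z"
  by (induction k) (simp_all add: rot_add algebra_simps)

lemma nn_integral_shift:
  fixes h :: "real \<Rightarrow> ennreal"
  assumes [measurable]: "h \<in> borel_measurable borel"
  shows "(\<integral>\<^sup>+ t\<in>{c + l..c + r}. h t \<partial>lborel) = (\<integral>\<^sup>+ t\<in>{l..r}. h (c + t) \<partial>lborel)"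
proof -
  have "(\<integral>\<^sup>+ t\<in>{c + l..c + r}. h t \<partial>lborel) = (\<integral>\<^sup>+ t. h t * indicator {c + l..c + r} t \<partial>distr lborel borel ((+) c))"
    by (simp add: lborel_distr_plus)
  also have "\<dots> = (\<integral>\<^sup>+ t. h (c + t) * indicator {c + l..c + r} (c + t) \<partial>lborel)"
    by (rule nn_integral_distr) auto
  also have "\<dots> = (\<integral>\<^sup>+ t\<in>{l..r}. h (c + t) \<partial>lborel)"
    by (intro nn_integral_cong) (auto split: split_indicator)
  finally show ?thesis .
qed

text \<open>Unit intervals to the right follow the iterates of \<open>rot 1\<close>, those to the
  left the iterates of \<open>rot (-1)\<close>; each half is thereby in reach of the discrete
  maximal inequality.\<close>

lemma nn_integral_split:
  fixes h :: "real \<Rightarrow> ennreal"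
  assumes [measurable]: "h \<in> borel_measurable borel"
  shows "(\<integral>\<^sup>+ t\<in>{-real N..real N}. h t \<partial>lborel) \<le>
    (\<Sum>k<N. \<integral>\<^sup>+ t\<in>{0..1}. h (real k + t) \<partial>lborel) + (\<Sum>k<N. \<integral>\<^sup>+ t\<in>{-1..0}. h (- real k + t) \<partial>lborel)"
proof (induction N)
  case 0
  have "(\<integral>\<^sup>+ t\<in>{0..0::real}. h t \<partial>lborel) = 0"
    by (rule nn_integral_null_set) (simp add: finite_imp_null_set_lborel)
  then show ?case by simp
next
  case (Suc N)
  have "(\<integral>\<^sup>+ t\<in>{-real (Suc N)..real (Suc N)}. h t \<partial>lborel) \<le>
    (\<integral>\<^sup>+ t. h t * indicator {-real N..real N} t + (h t * indicator {real N + 0..real N + 1} t +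
       h t * indicator {-real N + -1..-real N + 0} t) \<partial>lborel)"
    by (intro nn_integral_mono) (auto split: split_indicator)
  also have "\<dots> = (\<integral>\<^sup>+ t\<in>{-real N..real N}. h t \<partial>lborel) + ((\<integral>\<^sup>+ t\<in>{real N + 0..real N + 1}. h t \<partial>lborel) +
      (\<integral>\<^sup>+ t\<in>{-real N + -1..-real N + 0}. h t \<partial>lborel))"
    by (subst nn_integral_add, simp, simp)+ simp
  also have "\<dots> = (\<integral>\<^sup>+ t\<in>{-real N..real N}. h t \<partial>lborel) + ((\<integral>\<^sup>+ t\<in>{0..1}. h (real N + t) \<partial>lborel) +
      (\<integral>\<^sup>+ t\<in>{-1..0}. h (-real N + t) \<partial>lborel))"
    by (simp only: nn_integral_shift assms)
  also have "\<dots> \<le> (\<Sum>k<N. \<integral>\<^sup>+ t\<in>{0..1}. h (real k + t) \<partial>lborel) + (\<Sum>k<N. \<integral>\<^sup>+ t\<in>{-1..0}. h (- real k + t) \<partial>lborel) +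
      ((\<integral>\<^sup>+ t\<in>{0..1}. h (real N + t) \<partial>lborel) + (\<integral>\<^sup>+ t\<in>{-1..0}. h (-real N + t) \<partial>lborel))"
    by (intro add_right_mono Suc)
  finally show ?case by (simp add: add_ac)
qed

section \<open>Energy on the torus and its averages along the flow\<close>

locale hinf_p = hinf +
  fixes p :: real
  assumes p: "p \<ge> 1"
begin

text \<open>Extension by \<open>0\<close> off the torus, where \<open>f_chi\<close> is unspecified, makes the integrands measurable.\<close>

definition F_ext :: "(nat \<Rightarrow> complex) \<times> complex \<Rightarrow> complex" where
  "F_ext x = indicator (torus \<times> {s. Re s > 0}) x *\<^sub>R F (fst x) (snd x)"

definition dF_ext :: "(nat \<Rightarrow> complex) \<times> complex \<Rightarrow> complex" where
  "dF_ext x = indicator (torus \<times> {s. Re s > 0}) x *\<^sub>R deriv (F (fst x)) (snd x)"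

lemma F_ext_measurable: "F_ext \<in> borel_measurable borel"
  unfolding F_ext_def
proof (rule borel_measurable_continuous_on_indicator)
  show "torus \<times> {s. Re s > 0} \<in> sets borel"
    unfolding borel_prod[symmetric] using closed_torus open_RHP[of 0]
    by (intro pair_measureI) auto
  show "continuous_on (torus \<times> {s. Re s > 0}) (\<lambda>x. F (fst x) (snd x))"
    unfolding continuous_on_sequentially o_def
  proof (intro allI ballI impI)
    fix x y assume y: "y \<in> torus \<times> {s. 0 < Re s}" and x: "(\<forall>n. x n \<in> torus \<times> {s. 0 < Re s}) \<and> x \<longlonglongrightarrow> y"
    show "(\<lambda>n. F (fst (x n)) (snd (x n))) \<longlonglongrightarrow> F (fst y) (snd y)"
    proof (rule F_tendsto)
      show "(\<lambda>k. fst (x k) q) \<longlonglongrightarrow> fst y q" for q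
        using x by (intro tendsto_fun_component[where z = "\<lambda>k. fst (x k)"] tendsto_fst) auto
    qed (use x y in \<open>auto simp: mem_Times_iff intro: tendsto_snd\<close>)
  qed
qed

lemma F_differentiable: "z \<in> torus \<Longrightarrow> Re s > 0 \<Longrightarrow> F z field_differentiable at s"
  using holomorphic_on_imp_differentiable_at[OF F_hol open_RHP] by auto

text \<open>The derivative is a pointwise limit of difference quotients; their increments are
  positive reals, so the shifted point stays in the half-plane.\<close>

lemma dF_ext_measurable: "dF_ext \<in> borel_measurable borel"
proof (rule borel_measurable_LIMSEQ_metric)
  define h where "h n = complex_of_real (1 / real (Suc n))" for n
  note F_ext_measurable[measurable]
  have [measurable]: "(\<lambda>x::(nat \<Rightarrow> complex) \<times> complex. (fst x, snd x + h n)) \<in> borel_measurable borel" for n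
    by (intro borel_measurable_continuous_onI continuous_intros)
  have A: "torus \<times> {s. Re s > 0} \<in> sets borel"
    unfolding borel_prod[symmetric] using closed_torus open_RHP[of 0]
    by (intro pair_measureI) auto
  note [measurable] = A
  show "(\<lambda>x. indicator (torus \<times> {s. Re s > 0}) x *\<^sub>R ((F_ext (fst x, snd x + h n) - F_ext x) / h n)) \<in> borel_measurable borel" for n
    by measurable
  fix x :: "(nat \<Rightarrow> complex) \<times> complex"
  show "(\<lambda>n. indicator (torus \<times> {s. Re s > 0}) x *\<^sub>R ((F_ext (fst x, snd x + h n) - F_ext x) / h n)) \<longlonglongrightarrow> dF_ext x"
  proof (cases "x \<in> torus \<times> {s. Re s > 0}")
    case True
    then have x: "fst x \<in> torus" "Re (snd x) > 0" by auto
    have h: "h n \<noteq> 0" "Re (h n) > 0" for n by (auto simp: h_def simp del: of_nat_Suc)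
    have "((\<lambda>h. (F (fst x) (snd x + h) - F (fst x) (snd x)) / h) \<longlongrightarrow> deriv (F (fst x)) (snd x)) (at 0)"
      using F_differentiable[OF x] by (simp add: DERIV_deriv_iff_field_differentiable[symmetric] DERIV_def)
    moreover have "filterlim h (at 0) sequentially"
    proof (rule filterlim_atI)
      have "(\<lambda>n. 1 / real (Suc n)) \<longlonglongrightarrow> 0" by real_asymp
      from tendsto_of_real[OF this] show "h \<longlonglongrightarrow> 0" unfolding h_def[abs_def] of_real_0 .
    qed (use h in auto)
    ultimately have "(\<lambda>n. (F (fst x) (snd x + h n) - F (fst x) (snd x)) / h n) \<longlonglongrightarrow> deriv (F (fst x)) (snd x)"
      by (rule filterlim_compose)
    moreover have "F_ext (fst x, snd x + h n) = F (fst x) (snd x + h n)" "F_ext x = F (fst x) (snd x)" for n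
      using True x h(2)[of n] by (auto simp: F_ext_def add_pos_pos)
    ultimately show ?thesis using True by (simp add: dF_ext_def)
  qed (simp add: dF_ext_def)
qed

text \<open>Only the positive real axis is needed as domain: other points of the half-plane are
  reached by rotating the character, as \<open>energy_density_rot\<close> shows.\<close>

definition energy_density :: "(nat \<Rightarrow> complex) \<Rightarrow> real \<Rightarrow> real" where
  "energy_density z \<sigma> = norm (F_ext (z, of_real \<sigma>)) powr (p - 2) * norm (dF_ext (z, of_real \<sigma>)) ^ 2"

lemma energy_density_nonneg: "energy_density z \<sigma> \<ge> 0"
  by (simp add: energy_density_def)

lemma energy_density_measurable [measurable]:
  fixes u :: "_ \<Rightarrow> nat \<Rightarrow> complex"
  assumes [measurable]: "u \<in> borel_measurable N" "h \<in> borel_measurable N"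
  shows "(\<lambda>x. energy_density (u x) (h x)) \<in> borel_measurable N"
proof -
  have m: "(\<lambda>x. (u x, complex_of_real (h x))) \<in> borel_measurable N" by measurable
  note [measurable] = measurable_compose[OF m F_ext_measurable] measurable_compose[OF m dF_ext_measurable]
  show ?thesis unfolding energy_density_def by measurable
qed

lemma energy_density_rot:
  assumes z: "z \<in> torus" and \<sigma>: "\<sigma> > 0"
  shows "energy_density (rot t z) \<sigma> = norm (F z (Complex \<sigma> t)) powr (p - 2) * norm (deriv (F z) (Complex \<sigma> t)) ^ 2"
proof -
  have s: "Complex \<sigma> t = of_real \<sigma> + \<i> * of_real t" by (simp add: Complex_eq)
  have "((\<lambda>s. F z (s + \<i> * of_real t)) has_field_derivative deriv (F z) (of_real \<sigma> + \<i> * of_real t) * 1) (at (of_real \<sigma>))"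
    by (rule DERIV_chain2[where g = "\<lambda>s. s + \<i> * of_real t"])
      (use F_differentiable[OF z, of "of_real \<sigma> + \<i> * of_real t"] \<sigma> in
        \<open>auto simp: DERIV_deriv_iff_field_differentiable intro!: derivative_eq_intros\<close>)
  then have "(F (rot t z) has_field_derivative deriv (F z) (of_real \<sigma> + \<i> * of_real t) * 1) (at (of_real \<sigma>))"
    by (rule has_field_derivative_transform_within_open[of _ _ _ "{s. Re s > 0}"])
      (use \<sigma> z in \<open>auto simp: F_rot intro: open_RHP\<close>)
  then have "deriv (F (rot t z)) (of_real \<sigma>) = deriv (F z) (Complex \<sigma> t)"
    unfolding s by (simp add: DERIV_imp_deriv)
  then show ?thesis
    using z \<sigma> by (simp add: energy_density_def F_ext_def dF_ext_def F_rot s)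
qed

text \<open>For \<open>e > 0\<close> the negative values of the weight \<open>\<sigma> - e\<close> are cut off by \<open>ennreal\<close>.\<close>

definition energy :: "real \<Rightarrow> (nat \<Rightarrow> complex) \<Rightarrow> ennreal" where
  "energy e z = (\<integral>\<^sup>+ \<sigma>\<in>{0<..}. ennreal (energy_density z \<sigma> * (\<sigma> - e)) \<partial>lborel)"

text \<open>The weight is what \<open>energy e\<close> misses: \<open>\<sigma>\<close> is the
  positive part of \<open>\<sigma> - e\<close> plus \<open>min \<sigma> e\<close>.\<close>

definition near_energy :: "real \<Rightarrow> (nat \<Rightarrow> complex) \<Rightarrow> ennreal" where
  "near_energy e z = (\<integral>\<^sup>+ \<sigma>\<in>{0<..}. ennreal (energy_density z \<sigma> * min \<sigma> e) \<partial>lborel)"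

lemma energy_measurable [measurable]: "energy e \<in> borel_measurable borel"
  unfolding energy_def by measurable

lemma near_energy_measurable [measurable]: "near_energy e \<in> borel_measurable borel"
  unfolding near_energy_def by measurable

lemma energy_rot:
  assumes z: "z \<in> torus"
  shows "energy e (rot t z) = (\<integral>\<^sup>+ \<sigma>\<in>{0<..}. ennreal (norm (F z (Complex \<sigma> t)) powr (p - 2) *
     norm (deriv (F z) (Complex \<sigma> t)) ^ 2 * (\<sigma> - e)) \<partial>lborel)"
  unfolding energy_def by (intro nn_integral_cong) (auto simp: energy_density_rot[OF z] split: split_indicator)

lemma energy_0_eq:
  assumes "e > 0"
  shows "energy 0 z = energy e z + near_energy e z"
proof -
  have "energy 0 z = (\<integral>\<^sup>+ \<sigma>. ennreal (energy_density z \<sigma> * (\<sigma> - e)) * indicator {0<..} \<sigma> + ennreal (energy_density z \<sigma> * min \<sigma> e) * indicator {0<..} \<sigma> \<partial>lborel)"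
    unfolding energy_def
  proof (intro nn_integral_cong)
    fix \<sigma> :: real
    have "ennreal (energy_density z \<sigma> * \<sigma>) = ennreal (energy_density z \<sigma> * (\<sigma> - e)) + ennreal (energy_density z \<sigma> * min \<sigma> e)" if "\<sigma> > 0"
    proof (cases "\<sigma> \<le> e")
      case True
      then have "energy_density z \<sigma> * (\<sigma> - e) \<le> 0" using energy_density_nonneg by (intro mult_nonneg_nonpos) auto
      then show ?thesis using True by (simp add: ennreal_neg)
    next
      case False
      then have "ennreal (energy_density z \<sigma> * (\<sigma> - e)) + ennreal (energy_density z \<sigma> * e) = ennreal (energy_density z \<sigma> * (\<sigma> - e) + energy_density z \<sigma> * e)"
        using assms energy_density_nonneg[of z \<sigma>] by (intro ennreal_plus[symmetric] mult_nonneg_nonneg) auto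
      then show ?thesis using False by (simp add: right_diff_distrib)
    qed
    then show "ennreal (energy_density z \<sigma> * (\<sigma> - 0)) * indicator {0<..} \<sigma> =
      ennreal (energy_density z \<sigma> * (\<sigma> - e)) * indicator {0<..} \<sigma> + ennreal (energy_density z \<sigma> * min \<sigma> e) * indicator {0<..} \<sigma>"
      by (auto split: split_indicator)
  qed
  also have "\<dots> = energy e z + near_energy e z"
    unfolding energy_def near_energy_def by (rule nn_integral_add) auto
  finally show ?thesis .
qed

lemma energy_antimono: "e \<le> e' \<Longrightarrow> energy e' z \<le> energy e z"
  unfolding energy_def
  by (intro nn_integral_mono) (auto intro!: ennreal_leI mult_left_mono energy_density_nonneg split: split_indicator)

lemma energy_SUP: "(SUP n. energy (1 / real (Suc n)) z) = energy 0 z"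
proof -
  define u where "u n \<sigma> = ennreal (energy_density z \<sigma> * (\<sigma> - 1 / real (Suc n))) * indicator {0<..} \<sigma>" for n \<sigma>
  have "incseq u"
    unfolding u_def
    by (intro incseq_SucI le_funI mult_right_mono ennreal_leI mult_left_mono energy_density_nonneg) (auto simp: field_simps)
  have "(SUP n. energy (1 / real (Suc n)) z) = (\<integral>\<^sup>+ \<sigma>. (SUP n. u n \<sigma>) \<partial>lborel)"
    unfolding energy_def u_def[symmetric]
    by (intro nn_integral_monotone_convergence_SUP[symmetric] \<open>incseq u\<close>) (simp add: u_def)
  also have "\<dots> = energy 0 z"
    unfolding energy_def
  proof (intro nn_integral_cong)
    fix \<sigma>
    have "(\<lambda>n. energy_density z \<sigma> * (\<sigma> - 1 / real (Suc n))) \<longlonglongrightarrow> energy_density z \<sigma> * (\<sigma> - 0)"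
      by (intro tendsto_intros) real_asymp
    then have "(\<lambda>n. u n \<sigma>) \<longlonglongrightarrow> ennreal (energy_density z \<sigma> * (\<sigma> - 0)) * indicator {0<..} \<sigma>"
      unfolding u_def by (auto intro!: tendsto_ennrealI split: split_indicator)
    moreover have "(\<lambda>n. u n \<sigma>) \<longlonglongrightarrow> (SUP n. u n \<sigma>)"
      using \<open>incseq u\<close> by (intro LIMSEQ_SUP) (auto simp: incseq_def le_fun_def)
    ultimately show "(SUP n. u n \<sigma>) = ennreal (energy_density z \<sigma> * (\<sigma> - 0)) * indicator {0<..} \<sigma>"
      by (rule LIMSEQ_unique[rotated])
  qed
  finally show ?thesis .
qed

definition avg :: "real \<Rightarrow> real \<Rightarrow> (nat \<Rightarrow> complex) \<Rightarrow> ennreal" where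
  "avg e T z = ennreal (p\<^sup>2 / (2 * T)) * (\<integral>\<^sup>+ t\<in>{-T..T}. energy e (rot t z) \<partial>lborel)"

definition p_mean :: "real \<Rightarrow> real" where
  "p_mean e = (SOME L. \<forall>z\<in>torus. ((\<lambda>T. (1 / (2 * T)) * integral {-T..T} (\<lambda>t. norm (F z (Complex e t)) powr p)) \<longlongrightarrow> L) at_top)"

lemma p_mean:
  assumes "e > 0" "z \<in> torus"
  shows "((\<lambda>T. (1 / (2 * T)) * integral {-T..T} (\<lambda>t. norm (F z (Complex e t)) powr p)) \<longlongrightarrow> p_mean e) at_top"
  using someI_ex[OF Hp_mean[OF assms(1), of p]] p assms unfolding p_mean_def by auto

lemma mean_integral_le:
  assumes "e > 0" "z \<in> torus" "T \<ge> 0"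
  shows "integral {-T..T} (\<lambda>t. norm (F z (Complex e t)) powr p) \<le> 2 * T * B powr p"
proof -
  have c: "continuous_on {-T..T} (\<lambda>t. norm (F z (Complex e t)) powr p)"
    unfolding Complex_eq using assms p
    by (intro continuous_on_powr' continuous_on_norm
        continuous_on_compose2[OF holomorphic_on_imp_continuous_on[OF F_hol[OF assms(2)]]])
      (auto intro!: continuous_intros)
  have "integral {-T..T} (\<lambda>t. norm (F z (Complex e t)) powr p) \<le> integral {-T..T} (\<lambda>t. B powr p)"
    using assms p F_bound[OF assms(2)]
    by (intro integral_le integrable_continuous_interval c) (auto intro!: powr_mono2)
  then show ?thesis using assms by simp
qed

text \<open>\<open>green_strip\<close> divided by \<open>2 * T\<close>. That \<open>K\<close> is
  chosen before \<open>z\<close> and \<open>T\<close> matters twice: for the limit in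
  \<open>T\<close>, and for dominated convergence over the torus.\<close>

lemma avg_bounds:
  assumes e: "e > 0"
  obtains K where "\<And>z T. z \<in> torus \<Longrightarrow> T > 0 \<Longrightarrow> \<exists>r\<ge>0. avg e T z = ennreal r \<and>
     \<bar>r - ((1 / (2 * T)) * integral {-T..T} (\<lambda>t. norm (F z (Complex e t)) powr p) - norm (a 1) powr p)\<bar> \<le> K / T"
proof -
  obtain C where C: "C > 0" "\<And>z s. z \<in> torus \<Longrightarrow> Re s > 0 \<Longrightarrow> norm (F z s - a 1) \<le> C * 2 powr (- Re s)"
    using F_decay by blast
  show ?thesis
  proof (rule that)
    fix z T assume z: "z \<in> torus" and T: "(T::real) > 0"
    interpret h: halfplane "F z" "a 1" B C e
      by unfold_locales (use z e C F_hol F_bound in auto)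
    obtain I where I: "I \<ge> 0" "integral\<^sup>N lborel (h.dens p e T) = ennreal I"
      "\<bar>p\<^sup>2 * I - (integral {-T..T} (\<lambda>t. norm (F z (Complex e t)) powr p) - 2 * T * norm (a 1) powr p)\<bar> \<le> h.K p"
      using h.green_strip[OF p, of T] T by auto
    have "(\<integral>\<^sup>+ t\<in>{-T..T}. energy e (rot t z) \<partial>lborel) = ennreal I"
      unfolding energy_rot[OF z] h.nn_integral_dens I(2) ..
    then have "avg e T z = ennreal (p\<^sup>2 / (2 * T) * I)"
      unfolding avg_def using T I(1) by (simp only: ennreal_mult[symmetric] divide_nonneg_pos zero_le_power2 mult_pos_pos zero_less_numeral)
    moreover have "p\<^sup>2 / (2 * T) * I - ((1 / (2 * T)) * integral {-T..T} (\<lambda>t. norm (F z (Complex e t)) powr p) - norm (a 1) powr p)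
        = (1 / (2 * T)) * (p\<^sup>2 * I - (integral {-T..T} (\<lambda>t. norm (F z (Complex e t)) powr p) - 2 * T * norm (a 1) powr p))"
      using T by (simp add: field_simps)
    moreover have "\<bar>(1 / (2 * T)) * (p\<^sup>2 * I - (integral {-T..T} (\<lambda>t. norm (F z (Complex e t)) powr p) - 2 * T * norm (a 1) powr p))\<bar>
        \<le> (1 / (2 * T)) * h.K p"
      unfolding abs_mult using T I(3) by (intro mult_mono) auto
    ultimately show "\<exists>r\<ge>0. avg e T z = ennreal r \<and>
     \<bar>r - ((1 / (2 * T)) * integral {-T..T} (\<lambda>t. norm (F z (Complex e t)) powr p) - norm (a 1) powr p)\<bar> \<le> (halfplane.K B C e p / 2) / T"
      using T I(1) by (intro exI[of _ "p\<^sup>2 / (2 * T) * I"]) auto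
  qed
qed

lemma avg_tendsto:
  assumes e: "e > 0" and z: "z \<in> torus"
  shows "((\<lambda>T. avg e T z) \<longlongrightarrow> ennreal (p_mean e - norm (a 1) powr p)) at_top"
    and "p_mean e \<ge> norm (a 1) powr p"
proof -
  define A where "A T = (1 / (2 * T)) * integral {-T..T} (\<lambda>t. norm (F z (Complex e t)) powr p) - norm (a 1) powr p" for T
  obtain K where K: "\<And>z T. z \<in> torus \<Longrightarrow> T > 0 \<Longrightarrow> \<exists>r\<ge>0. avg e T z = ennreal r \<and>
     \<bar>r - ((1 / (2 * T)) * integral {-T..T} (\<lambda>t. norm (F z (Complex e t)) powr p) - norm (a 1) powr p)\<bar> \<le> K / T"
    using avg_bounds[OF e] by blast
  have r: "\<bar>enn2real (avg e T z) - A T\<bar> \<le> K / T" "ennreal (enn2real (avg e T z)) = avg e T z" if T: "T > 0" for T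
    using K[OF z T] by (auto simp: A_def)
  have "((\<lambda>T. enn2real (avg e T z) - A T) \<longlongrightarrow> 0) at_top"
  proof (rule Lim_null_comparison)
    show "\<forall>\<^sub>F T in at_top. norm (enn2real (avg e T z) - A T) \<le> K * (1 / T)"
      using eventually_gt_at_top[of 0] by eventually_elim (use r in auto)
    have "((\<lambda>T::real. 1 / T) \<longlongrightarrow> 0) at_top" by real_asymp
    then show "((\<lambda>T. K * (1 / T)) \<longlongrightarrow> 0) at_top" by (rule tendsto_mult_right_zero)
  qed
  moreover have "(A \<longlongrightarrow> p_mean e - norm (a 1) powr p) at_top"
    unfolding A_def by (intro tendsto_diff tendsto_const p_mean e z)
  ultimately have lim: "((\<lambda>T. enn2real (avg e T z)) \<longlongrightarrow> p_mean e - norm (a 1) powr p) at_top"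
    using tendsto_add by fastforce
  show "p_mean e \<ge> norm (a 1) powr p"
    using tendsto_lowerbound[OF lim, of 0] by simp
  have "((\<lambda>T. ennreal (enn2real (avg e T z))) \<longlongrightarrow> ennreal (p_mean e - norm (a 1) powr p)) at_top"
    using lim by (rule tendsto_ennrealI)
  then show "((\<lambda>T. avg e T z) \<longlongrightarrow> ennreal (p_mean e - norm (a 1) powr p)) at_top"
    by (rule Lim_transform_eventually)
      (rule eventually_mono[OF eventually_gt_at_top[of 0]], rule r(2), assumption)
qed

lemma p_mean_le: "e > 0 \<Longrightarrow> p_mean e \<le> B powr p"
proof (rule tendsto_upperbound[OF p_mean[OF _ one_torus]])
  assume e: "e > 0"
  show "\<forall>\<^sub>F T in at_top. 1 / (2 * T) * integral {-T..T} (\<lambda>t. norm (F (\<lambda>_. 1) (Complex e t)) powr p) \<le> B powr p"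
    using eventually_gt_at_top[of 0]
  proof eventually_elim
    case (elim T)
    then show ?case using mean_integral_le[OF e one_torus, of T] by (simp add: field_simps)
  qed
qed auto

text \<open>Invariance makes the torus integral of \<open>avg e T\<close> independent of
  \<open>T\<close>, while the averages converge at every point of the torus to one constant. The
  uniform bound and the finite measure justify exchanging limit and integral.\<close>

lemma nn_integral_energy:
  assumes e: "e > 0"
  shows "ennreal (p\<^sup>2) * integral\<^sup>N m_inf (energy e) = ennreal (p_mean e - norm (a 1) powr p)"
proof -
  obtain K where K: "\<And>z T. z \<in> torus \<Longrightarrow> T > 0 \<Longrightarrow> \<exists>r\<ge>0. avg e T z = ennreal r \<and>
     \<bar>r - ((1 / (2 * T)) * integral {-T..T} (\<lambda>t. norm (F z (Complex e t)) powr p) - norm (a 1) powr p)\<bar> \<le> K / T"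
    using avg_bounds[OF e] by blast
  have bd: "avg e T z \<le> ennreal (B powr p + \<bar>K\<bar>)" if z: "z \<in> torus" and T: "T \<ge> 1" for T z
  proof -
    obtain r where r: "avg e T z = ennreal r"
      "\<bar>r - ((1 / (2 * T)) * integral {-T..T} (\<lambda>t. norm (F z (Complex e t)) powr p) - norm (a 1) powr p)\<bar> \<le> K / T"
      using K[OF z, of T] T by auto
    have "(1 / (2 * T)) * integral {-T..T} (\<lambda>t. norm (F z (Complex e t)) powr p) \<le> B powr p"
      using mean_integral_le[OF e z, of T] T by (simp add: field_simps)
    moreover have "K / T \<le> \<bar>K\<bar> / 1" using T by (intro frac_le) auto
    moreover have "norm (a 1) powr p \<ge> 0" by simp
    ultimately have "r \<le> B powr p + \<bar>K\<bar>" using r(2) by linarith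
    then show ?thesis unfolding r(1) by (rule ennreal_leI)
  qed
  have avg_int: "integral\<^sup>N m_inf (avg e T) = ennreal (p\<^sup>2) * integral\<^sup>N m_inf (energy e)" if T: "T > 0" for T
  proof -
    have "integral\<^sup>N m_inf (avg e T) = ennreal (p\<^sup>2 / (2 * T)) * (\<integral>\<^sup>+ z. (\<integral>\<^sup>+ t\<in>{-T..T}. energy e (rot t z) \<partial>lborel) \<partial>m_inf)"
      unfolding avg_def by (rule nn_integral_cmult) measurable
    also have "\<dots> = ennreal (p\<^sup>2 / (2 * T)) * (ennreal (2 * T) * integral\<^sup>N m_inf (energy e))"
      using T by (subst nn_integral_flow) auto
    also have "\<dots> = ennreal (p\<^sup>2 / (2 * T) * (2 * T)) * integral\<^sup>N m_inf (energy e)"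
      using T by (subst ennreal_mult) (auto simp: mult.assoc)
    finally show ?thesis using T by simp
  qed
  have "(\<lambda>n. integral\<^sup>N m_inf (avg e (real (Suc n)))) \<longlonglongrightarrow> (\<integral>\<^sup>+ z. ennreal (p_mean e - norm (a 1) powr p) \<partial>m_inf)"
  proof (rule nn_integral_dominated_convergence[where w = "\<lambda>_. ennreal (B powr p + \<bar>K\<bar>)"])
    show "AE z in m_inf. avg e (real (Suc n)) z \<le> ennreal (B powr p + \<bar>K\<bar>)" for n
      using AE_torus by eventually_elim (rule bd, auto)
    show "AE z in m_inf. (\<lambda>n. avg e (real (Suc n)) z) \<longlonglongrightarrow> ennreal (p_mean e - norm (a 1) powr p)"
      using AE_torus
    proof eventually_elim
      case (elim z)
      have "filterlim (\<lambda>n. real (Suc n)) at_top sequentially"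
        by (rule filterlim_compose[OF filterlim_real_sequentially filterlim_Suc])
      then show ?case by (rule filterlim_compose[OF avg_tendsto(1)[OF e elim]])
    qed
    show "avg e (real (Suc n)) \<in> borel_measurable m_inf" for n
      unfolding avg_def by measurable
    show "(\<integral>\<^sup>+ z. ennreal (B powr p + \<bar>K\<bar>) \<partial>m_inf) < \<infinity>"
      using m_inf.emeasure_space_1 by simp
  qed auto
  then have "(\<lambda>n. ennreal (p\<^sup>2) * integral\<^sup>N m_inf (energy e)) \<longlonglongrightarrow> ennreal (p_mean e - norm (a 1) powr p)"
    using m_inf.emeasure_space_1 by (simp add: avg_int del: of_nat_Suc)
  then show ?thesis by (simp add: LIMSEQ_const_iff)
qed

definition total_energy :: real where
  "total_energy = enn2real (ennreal (p\<^sup>2) * integral\<^sup>N m_inf (energy 0))"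

lemma total_energy_SUP: "(SUP n. ennreal (p_mean (1 / real (Suc n)) - norm (a 1) powr p)) = ennreal (p\<^sup>2) * integral\<^sup>N m_inf (energy 0)"
proof -
  have "ennreal (p\<^sup>2) * integral\<^sup>N m_inf (energy 0) = ennreal (p\<^sup>2) * (\<integral>\<^sup>+ z. (SUP n. energy (1 / real (Suc n)) z) \<partial>m_inf)"
    by (simp only: energy_SUP)
  also have "(\<integral>\<^sup>+ z. (SUP n. energy (1 / real (Suc n)) z) \<partial>m_inf) = (SUP n. integral\<^sup>N m_inf (energy (1 / real (Suc n))))"
  proof (rule nn_integral_monotone_convergence_SUP)
    show "incseq (\<lambda>n. energy (1 / real (Suc n)))"
      by (intro incseq_SucI le_funI energy_antimono) (simp add: field_simps)
  qed measurable
  also have "ennreal (p\<^sup>2) * \<dots> = (SUP n. ennreal (p\<^sup>2) * integral\<^sup>N m_inf (energy (1 / real (Suc n))))"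
    by (rule SUP_mult_left_ennreal)
  finally show ?thesis by (simp add: nn_integral_energy)
qed

text \<open>Finiteness comes from \<open>p_mean e \<le> B powr p\<close>, a bound that does not
  degenerate as \<open>e\<close> tends to 0.\<close>

lemma total_energy: "ennreal (p\<^sup>2) * integral\<^sup>N m_inf (energy 0) = ennreal total_energy" "total_energy \<ge> 0"
proof -
  have "ennreal (p\<^sup>2) * integral\<^sup>N m_inf (energy 0) \<le> ennreal (B powr p)"
    unfolding total_energy_SUP[symmetric]
  proof (intro SUP_least ennreal_leI)
    fix n show "p_mean (1 / real (Suc n)) - norm (a 1) powr p \<le> B powr p"
      using p_mean_le[of "1 / real (Suc n)"] by (simp add: add_increasing2 diff_le_eq)
  qed
  then show "ennreal (p\<^sup>2) * integral\<^sup>N m_inf (energy 0) = ennreal total_energy"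
    unfolding total_energy_def by (simp add: order_le_less_trans[OF _ ennreal_less_top])
  show "total_energy \<ge> 0" by (simp add: total_energy_def)
qed

lemma p_mean_upper:
  assumes "e > 0"
  shows "p_mean e - norm (a 1) powr p \<le> total_energy"
proof -
  have "ennreal (p_mean e - norm (a 1) powr p) \<le> ennreal total_energy"
    unfolding nn_integral_energy[OF assms, symmetric] total_energy(1)[symmetric]
    using assms by (intro mult_left_mono nn_integral_mono energy_antimono) auto
  then show ?thesis using total_energy(2) by (simp add: ennreal_le_iff)
qed

lemma p_mean_antimono:
  assumes "0 < e" "e \<le> e'"
  shows "p_mean e' \<le> p_mean e"
proof -
  have "ennreal (p_mean e' - norm (a 1) powr p) \<le> ennreal (p_mean e - norm (a 1) powr p)"
    unfolding nn_integral_energy[OF assms(1), symmetric] nn_integral_energy[OF less_le_trans[OF assms], symmetric]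
    using assms by (intro mult_left_mono nn_integral_mono energy_antimono) auto
  then show ?thesis using avg_tendsto(2)[OF assms(1) one_torus] by (simp add: ennreal_le_iff)
qed

text \<open>\<open>p_mean\<close> decreases in \<open>e\<close>, so its limit at 0 is its supremum,
  already attained in the limit along \<open>1 / Suc n\<close>.\<close>

lemma p_mean_tendsto: "(p_mean \<longlongrightarrow> total_energy + norm (a 1) powr p) (at_right 0)"
proof (rule order_tendstoI)
  fix y assume y: "y < total_energy + norm (a 1) powr p"
  have "\<exists>n. y < p_mean (1 / real (Suc n))"
  proof (rule ccontr)
    assume "\<nexists>n. y < p_mean (1 / real (Suc n))"
    then have "ennreal total_energy \<le> ennreal (y - norm (a 1) powr p)"
      unfolding total_energy(1)[symmetric] total_energy_SUP[symmetric]
      by (intro SUP_least ennreal_leI diff_right_mono) (auto simp: not_less)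
    \<comment> \<open>\<open>ennreal\<close> truncates negative numbers, so the inequality can be
      read back in the reals only after this check.\<close>
    moreover have "y - norm (a 1) powr p \<ge> 0"
    proof -
      have "\<not> y < p_mean (1 / real (Suc 0))" using \<open>\<nexists>n. y < p_mean (1 / real (Suc n))\<close> by blast
      then have "p_mean (1 / real (Suc 0)) \<le> y" by (simp only: not_less)
      then show ?thesis using avg_tendsto(2)[of "1 / real (Suc 0)", OF _ one_torus] by simp
    qed
    ultimately show False using y by (simp add: ennreal_le_iff)
  qed
  then obtain n where n: "y < p_mean (1 / real (Suc n))" by blast
  show "\<forall>\<^sub>F e in at_right 0. y < p_mean e"
    unfolding eventually_at_right_field
  proof (intro exI[of _ "1 / real (Suc n)"] conjI allI impI)
    fix e assume "0 < e" "e < 1 / real (Suc n)"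
    then have "p_mean (1 / real (Suc n)) \<le> p_mean e" by (intro p_mean_antimono) auto
    then show "y < p_mean e" using n by simp
  qed simp
next
  fix y assume y: "total_energy + norm (a 1) powr p < y"
  show "\<forall>\<^sub>F e in at_right 0. p_mean e < y"
    unfolding eventually_at_right_field
  proof (intro exI[of _ 1] conjI allI impI)
    fix e :: real assume "0 < e"
    then show "p_mean e < y" using p_mean_upper[of e] y by simp
  qed simp
qed

text \<open>The norm concerns the orbit of the trivial character, where \<open>F\<close> is
  \<open>f\<close>; the nested limits are \<open>p_mean\<close> and its limit at 0.\<close>

lemma Hp_norm_eq: "Hp_norm p f powr p = total_energy + norm (a 1) powr p"
proof -
  have inner: "Lim at_top (\<lambda>T. (1 / (2 * T)) * (\<integral>t\<in>{-T..T}. norm (f (Complex e t)) powr p \<partial>lborel)) = p_mean e"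
    if e: "e > 0" for e
  proof (rule tendsto_Lim)
    have c: "continuous_on {-T..T} (\<lambda>t. norm (f (Complex e t)) powr p)" for T
      unfolding Complex_eq using e p
      by (intro continuous_on_powr' continuous_on_norm
          continuous_on_compose2[OF holomorphic_on_imp_continuous_on[OF hol]])
        (auto intro!: continuous_intros)
    have "(\<integral>t\<in>{-T..T}. norm (f (Complex e t)) powr p \<partial>lborel) = integral {-T..T} (\<lambda>t. norm (F (\<lambda>_. 1) (Complex e t)) powr p)" for T
      using set_borel_integral_eq_integral(2)[OF borel_integrable_atLeastAtMost'[OF c[of T]]] e
      by (simp add: F_one)
    then show "((\<lambda>T. (1 / (2 * T)) * (\<integral>t\<in>{-T..T}. norm (f (Complex e t)) powr p \<partial>lborel)) \<longlongrightarrow> p_mean e) at_top"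
      using p_mean[OF e one_torus] by simp
  qed simp
  have "Lim (at_right 0) (\<lambda>e. Lim at_top (\<lambda>T. (1 / (2 * T)) * (\<integral>t\<in>{-T..T}. norm (f (Complex e t)) powr p \<partial>lborel)))
      = total_energy + norm (a 1) powr p"
  proof (rule tendsto_Lim)
    show "((\<lambda>e. Lim at_top (\<lambda>T. (1 / (2 * T)) * (\<integral>t\<in>{-T..T}. norm (f (Complex e t)) powr p \<partial>lborel)))
       \<longlongrightarrow> total_energy + norm (a 1) powr p) (at_right 0)"
    proof (rule Lim_transform_eventually[OF p_mean_tendsto])
      show "\<forall>\<^sub>F e in at_right 0. p_mean e = Lim at_top (\<lambda>T. (1 / (2 * T)) * (\<integral>t\<in>{-T..T}. norm (f (Complex e t)) powr p \<partial>lborel))"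
        unfolding eventually_at_right_field
      proof (intro exI[of _ 1] conjI allI impI)
        fix e :: real assume "0 < e"
        from inner[OF this] show "p_mean e = Lim at_top (\<lambda>T. (1 / (2 * T)) * (\<integral>t\<in>{-T..T}. norm (f (Complex e t)) powr p \<partial>lborel))"
          by (rule sym)
      qed simp
    qed
  qed simp
  moreover have "total_energy + norm (a 1) powr p \<ge> 0" using total_energy(2) by simp
  ultimately show ?thesis
    unfolding Hp_norm_def using p by (simp add: powr_powr)
qed

end

section \<open>Almost everywhere convergence up to the imaginary axis\<close>

context hinf_p
begin

text \<open>Finite total energy allows subtraction: the integral of \<open>near_energy\<close> is
  the defect of \<open>energy e\<close> from \<open>energy 0\<close>, which monotone convergence
  sends to 0.\<close>

lemma near_energy_tendsto: "(\<lambda>n. integral\<^sup>N m_inf (near_energy (1 / real (Suc n)))) \<longlonglongrightarrow> 0"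
proof -
  define x where "x n = integral\<^sup>N m_inf (energy (1 / real (Suc n)))" for n
  have p2: "ennreal (p\<^sup>2) \<noteq> 0" using p by simp
  have fin: "integral\<^sup>N m_inf (energy 0) < \<infinity>"
  proof (rule ccontr)
    assume "\<not> ?thesis"
    then have "integral\<^sup>N m_inf (energy 0) = \<infinity>" by (simp add: top.not_eq_extremum[symmetric])
    then show False using total_energy(1) p2 by (simp add: ennreal_mult_top)
  qed
  have sum: "integral\<^sup>N m_inf (energy 0) = x n + integral\<^sup>N m_inf (near_energy (1 / real (Suc n)))" for n
    unfolding x_def by (subst nn_integral_add[symmetric]) (auto simp: energy_0_eq intro!: nn_integral_cong)
  have "x \<longlonglongrightarrow> (SUP n. x n)"
    unfolding x_def
    by (intro LIMSEQ_SUP incseq_SucI nn_integral_mono energy_antimono) (simp add: field_simps)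
  also have "(SUP n. x n) = integral\<^sup>N m_inf (energy 0)"
    unfolding x_def energy_SUP[symmetric]
    by (rule nn_integral_monotone_convergence_SUP[symmetric])
      (auto intro!: incseq_SucI le_funI energy_antimono simp: field_simps)
  finally have "(\<lambda>n. integral\<^sup>N m_inf (energy 0) - x n) \<longlonglongrightarrow> integral\<^sup>N m_inf (energy 0) - integral\<^sup>N m_inf (energy 0)"
    using fin by (intro tendsto_diff_ennreal tendsto_const) auto
  moreover have "integral\<^sup>N m_inf (energy 0) - x n = integral\<^sup>N m_inf (near_energy (1 / real (Suc n)))" for n
  proof -
    have "x n \<noteq> \<infinity>" using sum[of n] fin by (auto simp: top_add)
    then show ?thesis unfolding sum[of n] by (simp add: ennreal_add_diff_cancel_left)
  qed
  ultimately show ?thesis using fin by simp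
qed

text \<open>A superlevel set of the maximal function of \<open>near_energy\<close> along the flow.
  Integer radii keep it a countable union.\<close>

definition bad :: "real \<Rightarrow> real \<Rightarrow> (nat \<Rightarrow> complex) set" where
  "bad l e = {z. \<exists>N\<ge>1. ennreal (2 * real N * l) \<le> (\<integral>\<^sup>+ t\<in>{-real N..real N}. near_energy e (rot t z) \<partial>lborel)}"

lemma bad_measurable [measurable]: "bad l e \<in> sets borel"
  unfolding bad_def by measurable

text \<open>If the integral over \<open>[-N, N]\<close> reaches \<open>2 * N * l\<close>, one of the
  two halves reaches \<open>N * l\<close>. The maximal inequality for \<open>rot 1\<close> or
  \<open>rot (-1)\<close> then applies, and the two halves account for the factor 2.\<close>

lemma emeasure_bad:
  assumes l: "l > 0"
  shows "ennreal l * emeasure m_inf (bad l e) \<le> 2 * integral\<^sup>N m_inf (near_energy e)"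
proof -
  define H1 where "H1 z = (\<integral>\<^sup>+ t\<in>{0..1}. near_energy e (rot t z) \<partial>lborel)" for z
  define H2 where "H2 z = (\<integral>\<^sup>+ t\<in>{-1..0}. near_energy e (rot t z) \<partial>lborel)" for z
  have [measurable]: "H1 \<in> borel_measurable borel" "H2 \<in> borel_measurable borel"
    unfolding H1_def H2_def by measurable
  have [measurable]: "rot t \<in> measurable m_inf m_inf" for t
    unfolding measurable_cong_sets[OF refl sets_m_inf] by measurable
  define E where "E c H = {z. \<exists>n\<ge>1. of_nat n * ennreal l \<le> (\<Sum>k<n. H (rot (real k * c) z))}"
    for c and H :: "(nat \<Rightarrow> complex) \<Rightarrow> ennreal"
  have E: "ennreal l * emeasure m_inf (E c H) \<le> integral\<^sup>N m_inf H" if [measurable]: "H \<in> borel_measurable borel" for c H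
    using m_inf.maximal_ergodic[of "rot c" H "ennreal l"] m_inf_rot[of c]
    by (simp add: E_def rot_funpow measurable_cong_sets[OF sets_m_inf refl])
  have Em[measurable]: "E c H \<in> sets borel" if [measurable]: "H \<in> borel_measurable borel" for c H
    unfolding E_def by measurable
  have "bad l e \<subseteq> E 1 H1 \<union> E (-1) H2"
  proof
    fix z assume "z \<in> bad l e"
    then obtain N where N: "N \<ge> 1" "ennreal (2 * real N * l) \<le> (\<integral>\<^sup>+ t\<in>{-real N..real N}. near_energy e (rot t z) \<partial>lborel)"
      by (auto simp: bad_def)
    have "(\<integral>\<^sup>+ t\<in>{-real N..real N}. near_energy e (rot t z) \<partial>lborel) \<le>
      (\<Sum>k<N. H1 (rot (real k * 1) z)) + (\<Sum>k<N. H2 (rot (real k * - 1) z))"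
      using nn_integral_split[of "\<lambda>t. near_energy e (rot t z)" N]
      by (simp add: H1_def H2_def rot_add add.commute)
    moreover have "ennreal (2 * real N * l) = of_nat N * ennreal l + of_nat N * ennreal l"
    proof -
      have "of_nat N * ennreal l = ennreal (real N * l)"
        using l by (subst ennreal_mult) (auto simp: ennreal_of_nat_eq_real_of_nat)
      moreover have "ennreal (2 * real N * l) = ennreal (real N * l) + ennreal (real N * l)"
        using l by (subst ennreal_plus[symmetric]) auto
      ultimately show ?thesis by simp
    qed
    ultimately have "of_nat N * ennreal l + of_nat N * ennreal l \<le>
      (\<Sum>k<N. H1 (rot (real k * 1) z)) + (\<Sum>k<N. H2 (rot (real k * - 1) z))"
      using N(2) by simp
    then have "of_nat N * ennreal l \<le> (\<Sum>k<N. H1 (rot (real k * 1) z)) \<or>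
      of_nat N * ennreal l \<le> (\<Sum>k<N. H2 (rot (real k * - 1) z))"
      by (metis add_strict_mono not_le)
    then show "z \<in> E 1 H1 \<union> E (-1) H2" using N(1) unfolding E_def by blast
  qed
  then have "emeasure m_inf (bad l e) \<le> emeasure m_inf (E 1 H1 \<union> E (-1) H2)"
    by (intro emeasure_mono) (auto simp: sets_m_inf)
  also have "\<dots> \<le> emeasure m_inf (E 1 H1) + emeasure m_inf (E (-1) H2)"
    by (intro emeasure_subadditive) (auto simp: sets_m_inf)
  finally have "ennreal l * emeasure m_inf (bad l e) \<le> ennreal l * emeasure m_inf (E 1 H1) + ennreal l * emeasure m_inf (E (-1) H2)"
    by (simp add: distrib_left[symmetric] mult_left_mono)
  also have "\<dots> \<le> integral\<^sup>N m_inf H1 + integral\<^sup>N m_inf H2"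
    by (intro add_mono E) auto
  also have "\<dots> = integral\<^sup>N m_inf (near_energy e) + integral\<^sup>N m_inf (near_energy e)"
    unfolding H1_def H2_def by (simp add: nn_integral_flow)
  finally show ?thesis by (simp add: mult_2)
qed

text \<open>The exceptional set lies in every \<open>bad\<close> set, whose measures are bounded by
  integrals tending to 0 while \<open>l\<close> stays fixed.\<close>

lemma AE_good:
  assumes l: "l > 0"
  shows "AE z in m_inf. \<exists>n. z \<notin> bad l (1 / real (Suc n))"
proof -
  define X where "X = (\<Inter>n. bad l (1 / real (Suc n)))"
  have X: "X \<in> sets m_inf" unfolding X_def sets_m_inf by measurable
  have "ennreal l * emeasure m_inf X \<le> 2 * integral\<^sup>N m_inf (near_energy (1 / real (Suc n)))" for n
  proof -
    have "emeasure m_inf X \<le> emeasure m_inf (bad l (1 / real (Suc n)))"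
      by (intro emeasure_mono) (auto simp: X_def sets_m_inf)
    then have "ennreal l * emeasure m_inf X \<le> ennreal l * emeasure m_inf (bad l (1 / real (Suc n)))"
      by (intro mult_left_mono) auto
    then show ?thesis using emeasure_bad[OF l] order_trans by blast
  qed
  moreover have "(\<lambda>n. 2 * integral\<^sup>N m_inf (near_energy (1 / real (Suc n)))) \<longlonglongrightarrow> 2 * 0"
    by (intro ennreal_tendsto_cmult near_energy_tendsto) simp
  ultimately have "ennreal l * emeasure m_inf X \<le> 0"
    by (intro LIMSEQ_le_const) auto
  then have "emeasure m_inf X = 0" using l by simp
  then have "X \<in> null_sets m_inf" using X by (simp add: null_sets_def)
  then show ?thesis by (rule AE_I') (auto simp: X_def)
qed

lemma avg_0_le:
  assumes z: "z \<notin> bad l e" and "l > 0" "e > 0" "T \<ge> 1"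
  shows "avg 0 T z \<le> avg e T z + ennreal (2 * p\<^sup>2 * l)"
proof -
  \<comment> \<open>Rounding \<open>T \<ge> 1\<close> up to an integer at most doubles it, which
    turns the threshold \<open>2 * N * l\<close> into at most \<open>4 * T * l\<close> and accounts
    for the constant \<open>2 * p\<^sup>2 * l\<close>.\<close>
  define N where "N = nat \<lceil>T\<rceil>"
  have N: "N \<ge> 1" "T \<le> real N" "real N \<le> 2 * T" using assms by (auto simp: N_def) linarith+
  have "(\<integral>\<^sup>+ t\<in>{-T..T}. near_energy e (rot t z) \<partial>lborel) \<le> (\<integral>\<^sup>+ t\<in>{-real N..real N}. near_energy e (rot t z) \<partial>lborel)"
    using N by (intro nn_integral_mono) (auto split: split_indicator)
  also have "\<dots> \<le> ennreal (2 * real N * l)"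
  proof -
    have "\<not> ennreal (2 * real N * l) \<le> (\<integral>\<^sup>+ t\<in>{-real N..real N}. near_energy e (rot t z) \<partial>lborel)"
      using z N(1) unfolding bad_def by blast
    then show ?thesis by simp
  qed
  also have "\<dots> \<le> ennreal (4 * T * l)"
    using N assms by (intro ennreal_leI mult_right_mono) auto
  finally have near_energy: "(\<integral>\<^sup>+ t\<in>{-T..T}. near_energy e (rot t z) \<partial>lborel) \<le> ennreal (4 * T * l)" .
  have "avg 0 T z = ennreal (p\<^sup>2 / (2 * T)) * ((\<integral>\<^sup>+ t\<in>{-T..T}. energy e (rot t z) \<partial>lborel) + (\<integral>\<^sup>+ t\<in>{-T..T}. near_energy e (rot t z) \<partial>lborel))"
    unfolding avg_def energy_0_eq[OF \<open>e > 0\<close>] by (simp add: distrib_right nn_integral_add)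
  also have "\<dots> \<le> ennreal (p\<^sup>2 / (2 * T)) * ((\<integral>\<^sup>+ t\<in>{-T..T}. energy e (rot t z) \<partial>lborel) + ennreal (4 * T * l))"
    by (intro mult_left_mono add_left_mono near_energy) auto
  also have "\<dots> = avg e T z + ennreal (p\<^sup>2 / (2 * T) * (4 * T * l))"
    unfolding avg_def distrib_left using assms by (subst ennreal_mult) auto
  also have "p\<^sup>2 / (2 * T) * (4 * T * l) = 2 * p\<^sup>2 * l" using assms by simp
  finally show ?thesis .
qed

text \<open>From below, \<open>avg e\<close> with small \<open>e\<close> already comes close to the
  total energy. From above, the level \<open>l = 1 / Suc m\<close> is fixed before an
  \<open>e\<close> that depends on \<open>z\<close> and keeps it out of the \<open>bad\<close> set.
  Restricting levels to this sequence leaves one null set.\<close>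

lemma avg_0_tendsto: "AE z in m_inf. z \<in> torus \<and> ((\<lambda>T. avg 0 T z) \<longlongrightarrow> ennreal total_energy) at_top"
proof -
  have "AE z in m_inf. \<forall>m. \<exists>n. z \<notin> bad (1 / real (Suc m)) (1 / real (Suc n))"
    unfolding AE_all_countable by (intro allI AE_good) simp
  with AE_torus show ?thesis
  proof eventually_elim
    case (elim z)
    note z = elim(1)
    have "((\<lambda>T. avg 0 T z) \<longlongrightarrow> ennreal total_energy) at_top"
    proof (rule order_tendstoI)
      fix y assume "y < ennreal total_energy"
      then obtain n where n: "y < ennreal (p_mean (1 / real (Suc n)) - norm (a 1) powr p)"
        unfolding total_energy(1)[symmetric] total_energy_SUP[symmetric] less_SUP_iff by blast
      have "\<forall>\<^sub>F T in at_top. y < avg (1 / real (Suc n)) T z"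
        using order_tendstoD(1)[OF avg_tendsto(1)[OF _ z] n] by simp
      then show "\<forall>\<^sub>F T in at_top. y < avg 0 T z"
      proof eventually_elim
        case (elim T)
        have "avg (1 / real (Suc n)) T z \<le> avg 0 T z"
          unfolding avg_def by (intro mult_left_mono nn_integral_mono mult_right_mono energy_antimono) auto
        with elim show ?case by simp
      qed
    next
      fix y assume y: "ennreal total_energy < y"
      have "(\<lambda>m. ennreal (total_energy + 2 * p\<^sup>2 * (1 / real (Suc m)))) \<longlonglongrightarrow> ennreal (total_energy + 2 * p\<^sup>2 * 0)"
        by (intro tendsto_ennrealI tendsto_intros) real_asymp
      then have "\<forall>\<^sub>F m in sequentially. ennreal (total_energy + 2 * p\<^sup>2 * (1 / real (Suc m))) < y"
        using y by (intro order_tendstoD) auto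
      then obtain m where m: "ennreal (total_energy + 2 * p\<^sup>2 * (1 / real (Suc m))) < y"
        by (auto simp: eventually_sequentially)
      obtain n where n: "z \<notin> bad (1 / real (Suc m)) (1 / real (Suc n))" using elim(2) by blast
      have "((\<lambda>T. avg (1 / real (Suc n)) T z + ennreal (2 * p\<^sup>2 * (1 / real (Suc m)))) \<longlongrightarrow>
          ennreal (p_mean (1 / real (Suc n)) - norm (a 1) powr p) + ennreal (2 * p\<^sup>2 * (1 / real (Suc m)))) at_top"
        by (intro tendsto_add tendsto_const avg_tendsto z) simp
      moreover have "ennreal (p_mean (1 / real (Suc n)) - norm (a 1) powr p) + ennreal (2 * p\<^sup>2 * (1 / real (Suc m))) < y"
      proof -
        have "ennreal (p_mean (1 / real (Suc n)) - norm (a 1) powr p) \<le> ennreal total_energy"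
          by (intro ennreal_leI p_mean_upper) simp
        then have "ennreal (p_mean (1 / real (Suc n)) - norm (a 1) powr p) + ennreal (2 * p\<^sup>2 * (1 / real (Suc m))) \<le>
            ennreal (total_energy + 2 * p\<^sup>2 * (1 / real (Suc m)))"
          using total_energy(2) by (subst ennreal_plus) (auto intro: add_right_mono)
        then show ?thesis using m by (rule le_less_trans)
      qed
      ultimately have "\<forall>\<^sub>F T in at_top. avg (1 / real (Suc n)) T z + ennreal (2 * p\<^sup>2 * (1 / real (Suc m))) < y"
        by (rule order_tendstoD)
      then show "\<forall>\<^sub>F T in at_top. avg 0 T z < y"
        using eventually_ge_at_top[of 1]
      proof eventually_elim
        case (elim T)
        show ?case using le_less_trans[OF avg_0_le[OF n _ _ elim(2)] elim(1)] by simp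
      qed
    qed
    then show ?case using z by simp
  qed
qed

end

theorem theorem4p2:
  fixes p :: real and a :: "nat \<Rightarrow> complex" and f :: "complex \<Rightarrow> complex"
  assumes "1 \<le> p"
    and "Hinf_rep a f"
  shows "(ennreal (Hp_norm p f powr p) =
           ennreal (norm (a 1) powr p) + ennreal (p\<^sup>2) *
           (\<integral>\<^sup>+ z. (\<integral>\<^sup>+ \<sigma>\<in>{0<..}.
               ennreal (norm (f_chi a z (of_real \<sigma>)) powr (p - 2) *
                        norm (deriv (f_chi a z) (of_real \<sigma>)) ^ 2 * \<sigma>) \<partial>lborel) \<partial>m_inf)) \<and>
         (AE z in m_inf. \<exists>L.
           ((\<lambda>T. ennreal (p\<^sup>2 / (2 * T)) *
               (\<integral>\<^sup>+ t\<in>{-T..T}. (\<integral>\<^sup>+ \<sigma>\<in>{0<..}.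
                  ennreal (norm (f_chi a z (Complex \<sigma> t)) powr (p - 2) *
                           norm (deriv (f_chi a z) (Complex \<sigma> t)) ^ 2 * \<sigma>) \<partial>lborel) \<partial>lborel))
             \<longlongrightarrow> L) at_top \<and>
           ennreal (Hp_norm p f powr p) = ennreal (norm (a 1) powr p) + L)"
proof -
  obtain B \<kappa> where "hinf a f B \<kappa>" using Hinf_rep_hinf[OF assms(2)] .
  then interpret hinf_p a f B \<kappa> p
    using assms(1) by (intro hinf_p.intro hinf_p_axioms.intro)
  have norm_eq: "ennreal (Hp_norm p f powr p) = ennreal (norm (a 1) powr p) + ennreal total_energy"
    unfolding Hp_norm_eq using total_energy(2) by (simp add: add.commute)
  have G0: "energy 0 (rot t z) = (\<integral>\<^sup>+ \<sigma>\<in>{0<..}. ennreal (norm (f_chi a z (Complex \<sigma> t)) powr (p - 2) *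
      norm (deriv (f_chi a z) (Complex \<sigma> t)) ^ 2 * \<sigma>) \<partial>lborel)" if "z \<in> torus" for t z
    using energy_rot[OF that, of 0 t] by simp
  show ?thesis
  proof (intro conjI)
    have "(\<integral>\<^sup>+ z. (\<integral>\<^sup>+ \<sigma>\<in>{0<..}. ennreal (norm (f_chi a z (of_real \<sigma>)) powr (p - 2) *
        norm (deriv (f_chi a z) (of_real \<sigma>)) ^ 2 * \<sigma>) \<partial>lborel) \<partial>m_inf) = integral\<^sup>N m_inf (energy 0)"
    \<comment> \<open>Off the torus \<open>energy\<close> is built from the extension by 0 and may
      differ from the stated integrand, so only almost everywhere equality is claimed.\<close>
    proof (rule nn_integral_cong_AE)
      show "AE z in m_inf. (\<integral>\<^sup>+ \<sigma>\<in>{0<..}. ennreal (norm (f_chi a z (of_real \<sigma>)) powr (p - 2) *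
        norm (deriv (f_chi a z) (of_real \<sigma>)) ^ 2 * \<sigma>) \<partial>lborel) = energy 0 z"
        using AE_torus
      proof eventually_elim
        case (elim z)
        show ?case using G0[OF elim, of 0] by (simp add: complex_of_real_def)
      qed
    qed
    then show "ennreal (Hp_norm p f powr p) = ennreal (norm (a 1) powr p) + ennreal (p\<^sup>2) *
        (\<integral>\<^sup>+ z. (\<integral>\<^sup>+ \<sigma>\<in>{0<..}. ennreal (norm (f_chi a z (of_real \<sigma>)) powr (p - 2) *
           norm (deriv (f_chi a z) (of_real \<sigma>)) ^ 2 * \<sigma>) \<partial>lborel) \<partial>m_inf)"
      by (simp only: norm_eq total_energy(1))
    show "AE z in m_inf. \<exists>L.
           ((\<lambda>T. ennreal (p\<^sup>2 / (2 * T)) *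
               (\<integral>\<^sup>+ t\<in>{-T..T}. (\<integral>\<^sup>+ \<sigma>\<in>{0<..}.
                  ennreal (norm (f_chi a z (Complex \<sigma> t)) powr (p - 2) *
                           norm (deriv (f_chi a z) (Complex \<sigma> t)) ^ 2 * \<sigma>) \<partial>lborel) \<partial>lborel))
             \<longlongrightarrow> L) at_top \<and>
           ennreal (Hp_norm p f powr p) = ennreal (norm (a 1) powr p) + L"
      using avg_0_tendsto
    proof eventually_elim
      case (elim z)
      then show ?case
        using norm_eq unfolding avg_def G0[OF conjunct1[OF elim]] by blast
    qed
  qed
qed

end
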